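(* Let $F=F^{2,1}\colon[0,\infty)\to[0,\infty)$ be the convex Orlicz function with $F(0)=0$, $F(t)=e^{-1}t^2(-\log t)^{-1}$ for $0<t<1/e$, and $F(t)=t^{3}$ for $t\ge1/e$, and let $G$ be a convex Orlicz function such that $G(t)=t^2(-\log t)$ for $0<t\le e^{-3/2}$. Then both Orlicz sequence spaces $\ell_F$ and $\ell_G$ have a unique greedy basis.
   Context: A convex Orlicz function is a convex function $F\colon[0,\infty)\to[0,\infty)$ with $F(0)=0$, $F(1)=1$. The Orlicz sequence space $\ell_F$ is the Banach space of real sequences $\alpha=(a_n)$ with $\sum_n F(|a_n|/t)<\infty$ for some $t>0$, normed by $\|\alpha\|_F=\inf\{t>0:\sum_nF(|a_n|/t)\le1\}$. (For the functions in the statement, the canonical unit vectors form a symmetric, hence greedy, basis, and $\ell_F^*=\ell_G$ up to equivalent norms.) Bases: a basis is a Schauder basis $(x_n)_{n=1}^\infty$, and all bases are assumed semi-normalized, i.e. $0<\inf_n\|x_n\|\le\sup_n\|x_n\|<\infty$. A basis $(x_n)$ of $X$ with biorthogonal functionals $(x_n^* )$ is greedy if there is a constant $C$ such that for every $x\in X$, every $N\in\mathbb{N}$, and every set $\Lambda\subseteq\mathbb{N}$ with $|\Lambda|=N$ and $\min_{n\in\Lambda}|x_n^*(x)|\ge\max_{n\notin\Lambda}|x_n^*(x)|$, one has $\|x-\sum_{n\in\Lambda}x_n^*(x)x_n\|\le C\inf\{\|x-\sum_{n\in A}\alpha_n x_n\| : |A|=N,\ \alpha_n\in\mathbb{R}\}$.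 Two bases $(x_n)$, $(y_n)$ are equivalent if there is $C\ge1$ with $C^{-1}\|\sum a_nx_n\|\le\|\sum a_ny_n\|\le C\|\sum a_nx_n\|$ for all finitely supported real sequences $(a_n)$. A Banach space has a unique greedy basis if it has a semi-normalized greedy basis $(e_n)$ and every semi-normalized greedy basis of the space is equivalent to $(e_n)$. *)

theory Defs
  imports "HOL-Analysis.Analysis" "HOL-Library.Function_Algebras"
begin

section \<open>Normed spaces and bases on a carrier\<close>

text \<open>
  The Orlicz sequence spaces depend on a function parameter, so a normed space is given by a
  linear subspace \<^term>\<open>V\<close> of an ambient real vector space together with a norm function
  \<^term>\<open>p\<close>, whose values outside \<^term>\<open>V\<close> are irrelevant.
\<close>

definition norm_on :: "'a::real_vector set \<Rightarrow> ('a \<Rightarrow> real) \<Rightarrow> bool" where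
  "norm_on V p \<longleftrightarrow> subspace V
     \<and> (\<forall>v\<in>V. 0 \<le> p v \<and> (p v = 0 \<longleftrightarrow> v = 0))
     \<and> (\<forall>c. \<forall>v\<in>V. p (c *\<^sub>R v) = \<bar>c\<bar> * p v)
     \<and> (\<forall>u\<in>V. \<forall>v\<in>V. p (u + v) \<le> p u + p v)"

definition banach_space_on :: "'a::real_vector set \<Rightarrow> ('a \<Rightarrow> real) \<Rightarrow> bool" where
  "banach_space_on V p \<longleftrightarrow> norm_on V p
     \<and> (\<forall>X. (\<forall>n::nat. X n \<in> V)
            \<and> (\<forall>\<epsilon>>0. \<exists>M. \<forall>m\<ge>M. \<forall>n\<ge>M. p (X m - X n) < \<epsilon>)
          \<longrightarrow> (\<exists>l\<in>V. (\<lambda>n. p (X n - l)) \<longlonglongrightarrow> 0))"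

definition expansion :: "('a::real_vector \<Rightarrow> real) \<Rightarrow> (nat \<Rightarrow> 'a) \<Rightarrow> 'a \<Rightarrow> (nat \<Rightarrow> real) \<Rightarrow> bool" where
  "expansion p x v a \<longleftrightarrow> (\<lambda>N. p (v - (\<Sum>n<N. a n *\<^sub>R x n))) \<longlonglongrightarrow> 0"

definition schauder_basis :: "'a::real_vector set \<Rightarrow> ('a \<Rightarrow> real) \<Rightarrow> (nat \<Rightarrow> 'a) \<Rightarrow> bool" where
  "schauder_basis V p x \<longleftrightarrow> (\<forall>n. x n \<in> V) \<and> (\<forall>v\<in>V. \<exists>!a. expansion p x v a)"

text \<open>The value \<open>x\<^sub>n\<^sup>*(v)\<close> of the \<open>n\<close>-th biorthogonal functional of a Schauder basis.\<close>

definition coord :: "('a::real_vector \<Rightarrow> real) \<Rightarrow> (nat \<Rightarrow> 'a) \<Rightarrow> nat \<Rightarrow> 'a \<Rightarrow> real" where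
  "coord p x n v = (THE a. expansion p x v a) n"

definition semi_normalized :: "('a \<Rightarrow> real) \<Rightarrow> (nat \<Rightarrow> 'a) \<Rightarrow> bool" where
  "semi_normalized p x \<longleftrightarrow> (\<exists>c>0. \<exists>C. \<forall>n. c \<le> p (x n) \<and> p (x n) \<le> C)"

definition best_approx_error ::
    "('a::real_vector \<Rightarrow> real) \<Rightarrow> (nat \<Rightarrow> 'a) \<Rightarrow> nat \<Rightarrow> 'a \<Rightarrow> real" where
  "best_approx_error p x N v =
     Inf {p (v - (\<Sum>n\<in>A. \<alpha> n *\<^sub>R x n)) | A \<alpha>. finite A \<and> card A = N}"

definition greedy_basis :: "'a::real_vector set \<Rightarrow> ('a \<Rightarrow> real) \<Rightarrow> (nat \<Rightarrow> 'a) \<Rightarrow> bool" where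
  "greedy_basis V p x \<longleftrightarrow> schauder_basis V p x
     \<and> (\<exists>C. \<forall>v\<in>V. \<forall>N \<Lambda>. finite \<Lambda> \<and> card \<Lambda> = N
            \<and> (\<forall>n\<in>\<Lambda>. \<forall>k. k \<notin> \<Lambda> \<longrightarrow> \<bar>coord p x k v\<bar> \<le> \<bar>coord p x n v\<bar>)
          \<longrightarrow> p (v - (\<Sum>n\<in>\<Lambda>. coord p x n v *\<^sub>R x n)) \<le> C * best_approx_error p x N v)"

definition equivalent_bases ::
    "('a::real_vector \<Rightarrow> real) \<Rightarrow> (nat \<Rightarrow> 'a) \<Rightarrow> (nat \<Rightarrow> 'a) \<Rightarrow> bool" where
  "equivalent_bases p x y \<longleftrightarrow> (\<exists>C\<ge>1. \<forall>a. finite {n. a n \<noteq> 0} \<longrightarrow>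
     inverse C * p (\<Sum>n | a n \<noteq> 0. a n *\<^sub>R x n) \<le> p (\<Sum>n | a n \<noteq> 0. a n *\<^sub>R y n)
     \<and> p (\<Sum>n | a n \<noteq> 0. a n *\<^sub>R y n) \<le> C * p (\<Sum>n | a n \<noteq> 0. a n *\<^sub>R x n))"

definition has_unique_greedy_basis :: "'a::real_vector set \<Rightarrow> ('a \<Rightarrow> real) \<Rightarrow> bool" where
  "has_unique_greedy_basis V p \<longleftrightarrow> banach_space_on V p
     \<and> (\<exists>e. semi_normalized p e \<and> greedy_basis V p e
          \<and> (\<forall>x. semi_normalized p x \<and> greedy_basis V p x \<longrightarrow> equivalent_bases p x e))"


section \<open>Orlicz sequence spaces\<close>

instantiation "fun" :: (type, real_vector) real_vector
begin

definition "c *\<^sub>R f = (\<lambda>x. c *\<^sub>R f x)"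

instance
  by standard (simp_all add: scaleR_fun_def fun_eq_iff scaleR_add_right scaleR_add_left)

end

text \<open>An Orlicz function \<open>[0,\<infinity>) \<rightarrow> [0,\<infinity>)\<close> is encoded as a function on \<open>\<real>\<close> whose values at
  negative arguments are irrelevant.\<close>

definition convex_orlicz_function :: "(real \<Rightarrow> real) \<Rightarrow> bool" where
  "convex_orlicz_function F \<longleftrightarrow>
     (\<forall>t\<ge>0. 0 \<le> F t) \<and> convex_on {0..} F \<and> F 0 = 0 \<and> F 1 = 1"

definition orlicz_space :: "(real \<Rightarrow> real) \<Rightarrow> (nat \<Rightarrow> real) set" where
  "orlicz_space F = {a. \<exists>t>0. summable (\<lambda>n. F (\<bar>a n\<bar> / t))}"

definition orlicz_norm :: "(real \<Rightarrow> real) \<Rightarrow> (nat \<Rightarrow> real) \<Rightarrow> real" where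
  "orlicz_norm F a =
     Inf {t. 0 < t \<and> summable (\<lambda>n. F (\<bar>a n\<bar> / t)) \<and> (\<Sum>n. F (\<bar>a n\<bar> / t)) \<le> 1}"

definition F21 :: "real \<Rightarrow> real" where
  "F21 t = (if t \<le> 0 then 0
            else if t < 1 / exp 1 then exp (- 1) * t\<^sup>2 * inverse (- ln t)
            else t ^ 3)"

definition F21' :: "real \<Rightarrow> real" where
  "F21' t = (if t \<le> 0 then 0
             else if t < 1 / exp 1 then exp (- 1) * t * (2 / (- ln t) + 1 / (ln t)\<^sup>2)
             else 3 * t\<^sup>2)"

lemma ln_less_minus_one:
  fixes t :: real assumes "0 < t" "t < 1 / exp 1" shows "ln t < - 1"
proof -
  have "ln t < ln (1 / exp 1)" using assms by (subst ln_less_cancel_iff) auto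
  then show ?thesis by (simp add: ln_div)
qed

lemma F21_has_derivative: "(F21 has_real_derivative F21' t) (at t)"
proof -
  consider "t < 0" | "t = 0" | "0 < t" "t < 1 / exp 1" | "t = 1 / exp 1" | "t > 1 / exp 1"
    by linarith
  then show ?thesis
  proof cases
    case 1
    have "((\<lambda>_. 0) has_real_derivative F21' t) (at t)" using 1 by (simp add: F21'_def)
    then show ?thesis
      by (rule has_field_derivative_transform_within_open[of _ _ _ "{..<0}"])
        (use 1 in \<open>auto simp: F21_def\<close>)
  next
    case 2
    have b: "\<bar>F21 h / h\<bar> \<le> \<bar>h\<bar>" if "h \<noteq> 0" "\<bar>h\<bar> < 1 / exp 1" for h
    proof (cases "h > 0")
      case True
      with that have h: "0 < h" "h < 1 / exp 1" by auto
      have L: "inverse (- ln h) \<le> 1" "0 \<le> inverse (- ln h)"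
        using ln_less_minus_one[OF h] by (auto simp: field_simps)
      have "exp (- 1) * inverse (- ln h) \<le> 1 * (1::real)"
        by (rule mult_mono) (use L in auto)
      then have "h * (exp (- 1) * inverse (- ln h)) \<le> h * 1"
        using h by (intro mult_left_mono) auto
      moreover have "0 \<le> h * (exp (- 1) * inverse (- ln h))" using L h by (intro mult_nonneg_nonneg) auto
      moreover have "F21 h / h = h * (exp (- 1) * inverse (- ln h))"
        using h by (simp add: F21_def power2_eq_square)
      ultimately show ?thesis by linarith
    qed (use that in \<open>auto simp: F21_def\<close>)
    have "((\<lambda>h. F21 h / h) \<longlongrightarrow> 0) (at 0)"
    proof (rule tendsto_rabs_zero_cancel, rule tendsto_sandwich[of "\<lambda>_. 0" _ _ "\<lambda>h. \<bar>h\<bar>"])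
      show "\<forall>\<^sub>F h in at 0. \<bar>F21 h / h\<bar> \<le> \<bar>h\<bar>"
        unfolding eventually_at by (rule exI[of _ "1 / exp 1"]) (use b in auto)
      show "((\<lambda>h::real. \<bar>h\<bar>) \<longlongrightarrow> 0) (at 0)"
        by (rule tendsto_rabs_zero) (rule tendsto_ident_at)
    qed auto
    then show ?thesis unfolding DERIV_def 2 by (simp add: F21_def F21'_def)
  next
    case 3
    have d: "((\<lambda>t. exp (- 1) * t\<^sup>2 * inverse (- ln t)) has_real_derivative F21' t) (at t)"
    proof -
      have l: "ln t \<noteq> 0" using ln_less_minus_one[OF 3] by simp
      have "((\<lambda>t. exp (- 1) * t\<^sup>2 * inverse (- ln t)) has_real_derivative
          exp (- 1) * (2 * t) * inverse (- ln t) + exp (- 1) * t\<^sup>2 * (inverse t / (ln t)\<^sup>2)) (at t)"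
        using 3 l by (auto intro!: derivative_eq_intros simp: power2_eq_square divide_inverse)
      also have "exp (- 1) * (2 * t) * inverse (- ln t) + exp (- 1) * t\<^sup>2 * (inverse t / (ln t)\<^sup>2) = F21' t"
        using 3 l by (simp add: F21'_def power2_eq_square divide_inverse algebra_simps)
      finally show ?thesis .
    qed
    then show ?thesis
      by (rule has_field_derivative_transform_within_open[of _ _ _ "{0<..<1 / exp 1}"])
        (use 3 in \<open>auto simp: F21_def\<close>)
  next
    case 4
    have e: "exp (- 1) = t" using 4 by (simp add: exp_minus divide_inverse)
    have t: "0 < t" "ln t = - 1" "exp (- 1) = t" by (simp_all flip: e)
    have d1: "((\<lambda>t. exp (- 1) * t\<^sup>2 * inverse (- ln t)) has_real_derivative 3 * t\<^sup>2) (at t)"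
      using t by (auto intro!: derivative_eq_intros simp: field_simps power2_eq_square)
    have d2: "((\<lambda>t. t ^ 3) has_real_derivative 3 * t\<^sup>2) (at t)"
      by (auto intro!: derivative_eq_intros)
    have "(F21 has_real_derivative 3 * t\<^sup>2) (at t within {..t})"
      by (rule has_field_derivative_transform_within[OF has_field_derivative_at_within[OF d1], of t])
        (use t in \<open>auto simp: F21_def 4[symmetric] dist_real_def power3_eq_cube power2_eq_square\<close>)
    moreover have "(F21 has_real_derivative 3 * t\<^sup>2) (at t within {t..})"
      by (rule has_field_derivative_transform_within[OF has_field_derivative_at_within[OF d2], of 1])
        (use t in \<open>auto simp: F21_def 4[symmetric]\<close>)
    moreover have "{..t} \<union> {t..} = UNIV" by auto
    then have "at t = sup (at t within {..t}) (at t within {t..})"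
      using at_within_union[of t "{..t}" "{t..}"] by (simp only:)
    ultimately have "(F21 has_real_derivative 3 * t\<^sup>2) (at t)"
      unfolding has_field_derivative_iff by (simp only: filterlim_sup)
    then show ?thesis using t by (simp add: F21'_def 4[symmetric])
  next
    case 5
    have p: "t > 0" using 5 by (smt (verit) exp_gt_zero zero_less_divide_1_iff)
    have q: "0 < 1 / exp (1::real)" by simp
    have nn: "\<not> x \<le> 0" if "1 / exp 1 < x" for x :: real using that q by linarith
    have "((\<lambda>t. t ^ 3) has_real_derivative F21' t) (at t)"
      using 5 p by (auto intro!: derivative_eq_intros simp: F21'_def)
    then show ?thesis
      by (rule has_field_derivative_transform_within_open[of _ _ _ "{1 / exp 1<..}"])
        (use 5 in \<open>auto simp: F21_def dest: nn\<close>)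
  qed
qed

lemma F21'_mono:
  assumes "s \<le> t" shows "F21' s \<le> F21' t"
proof -
  have q: "0 < 1 / exp (1::real)" "exp (- 1) = 1 / exp (1::real)" by (auto simp: exp_minus field_simps)
  have b: "0 \<le> 2 / (- ln s) + 1 / (ln s)\<^sup>2 \<and> 2 / (- ln s) + 1 / (ln s)\<^sup>2 \<le> 3"
    if "0 < s" "s < 1 / exp 1" for s :: real
  proof -
    have u: "1 / (- ln s) \<le> 1" "0 \<le> 1 / (- ln s)"
      using ln_less_minus_one[OF that] by (auto simp: field_simps)
    have "(1 / (- ln s))\<^sup>2 \<le> 1\<^sup>2" by (rule power_mono[OF u])
    then have v: "1 / (ln s)\<^sup>2 \<le> 1" by (simp add: power_divide)
    have w: "2 / (- ln s) = 2 * (1 / (- ln s))" by simp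
    have "0 \<le> 1 / (ln s)\<^sup>2" by simp
    with u v show ?thesis unfolding w by linarith
  qed
  consider "s \<le> 0" | "0 < s" "t < 1 / exp 1" | "0 < s" "s < 1 / exp 1" "1 / exp 1 \<le> t" | "0 < s" "1 / exp 1 \<le> s"
    using assms by linarith
  then show ?thesis
  proof cases
    case 1
    have "0 \<le> F21' t" using b by (auto simp: F21'_def intro!: mult_nonneg_nonneg)
    then show ?thesis using 1 by (simp add: F21'_def)
  next
    case 2
    have s: "0 < s" "s < 1 / exp 1" and t: "0 < t" using 2 assms by auto
    have "ln s \<le> ln t" using s t assms by (subst ln_le_cancel_iff) auto
    with ln_less_minus_one[OF t 2(2)] have l: "0 < - ln t" "- ln t \<le> - ln s" by linarith+
    have "2 / (- ln s) \<le> 2 / (- ln t)" using l by (intro divide_left_mono mult_pos_pos) auto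
    moreover have "1 / (- ln s)\<^sup>2 \<le> 1 / (- ln t)\<^sup>2"
      using l by (intro divide_left_mono mult_pos_pos power_mono) auto
    ultimately have "2 / (- ln s) + 1 / (ln s)\<^sup>2 \<le> 2 / (- ln t) + 1 / (ln t)\<^sup>2" by simp
    then have "exp (- 1) * s * (2 / (- ln s) + 1 / (ln s)\<^sup>2) \<le> exp (- 1) * t * (2 / (- ln t) + 1 / (ln t)\<^sup>2)"
      using b[OF s] s assms by (intro mult_mono mult_left_mono) auto
    then show ?thesis using s t 2 by (simp add: F21'_def)
  next
    case 3
    have "F21' s = 1 / exp 1 * s * (2 / (- ln s) + 1 / (ln s)\<^sup>2)" using 3 q by (simp add: F21'_def)
    also have "\<dots> \<le> t * t * 3" using b[OF 3(1,2)] 3 assms q(1) by (intro mult_mono) auto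
    also have "\<dots> = F21' t" using 3 assms by (simp add: F21'_def power2_eq_square)
    finally show ?thesis .
  next
    case 4
    then show ?thesis using assms by (simp add: F21'_def power_mono)
  qed
qed

lemma convex_orlicz_function_F21: "convex_orlicz_function F21"
proof -
  have "convex_on UNIV F21"
    by (rule convex_on_realI[where f' = F21']) (auto intro: F21_has_derivative F21'_mono)
  then have "convex_on {0..} F21" by (rule convex_on_subset) auto
  moreover have "0 \<le> F21 t" if "0 \<le> t" for t
  proof (cases "0 < t \<and> t < 1 / exp 1")
    case True
    then have "0 < - ln t" using ln_less_minus_one[of t] by linarith
    then have "0 \<le> inverse (- ln t)" by (intro less_imp_le positive_imp_inverse_positive)
    then have "0 \<le> exp (- 1) * t\<^sup>2 * inverse (- ln t)" by (intro mult_nonneg_nonneg) auto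
    with True show ?thesis by (simp add: F21_def)
  qed (use that in \<open>auto simp: F21_def\<close>)
  moreover have "F21 1 = 1" by (auto simp: F21_def)
  ultimately show ?thesis by (auto simp: convex_orlicz_function_def F21_def)
qed

end

theory Submission
  imports Defs
begin

text \<open>
  A greedy basis is unconditional and democratic. Write \<open>u n j\<close> for the product of the \<open>j\<close>-th
  coordinate of \<open>x n\<close> and the \<open>n\<close>-th coefficient of the \<open>j\<close>-th unit vector. If every row of \<open>u\<close>
  has an entry bounded away from \<open>0\<close>, averaging over signs compares \<open>x\<close> with the unit vector basis
  in both directions. Otherwise, since \<open>F21 (s * t) / F21 t\<close> tends to \<open>s\<^sup>2\<close> as \<open>t\<close> tends to \<open>0\<close>, there
  are arbitrarily many basis vectors so spread out that they satisfy a lower \<open>l\<^sub>2\<close>-estimate, and by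
  democracy all sums of \<open>N\<close> basis vectors have norm at least of order \<open>sqrt N\<close>. But \<open>N\<close> unit
  vectors only have norm of order \<open>sqrt (N / ln N)\<close>. For this to be compatible with the type 2 upper
  estimate, the unit vectors must be expanded in basis vectors living at very small scales \<open>exp (- k)\<close>
  with coefficients below \<open>N\<close> to a negative power proportional to \<open>k\<close>, whereas at most
  exponentially many (in \<open>k\<close>) basis vectors live at scale \<open>exp (- k)\<close>: the coefficients cannot add
  up. For \<open>G\<close> the argument is applied to the biorthogonal functionals, which live in the space of
  \<open>F21\<close>.
\<close>

section \<open>Averages over signs\<close>

text \<open>What distinguishes \<open>F21\<close> from a power is its logarithm: replacing a small
  argument \<open>t\<close> by \<open>t\<^sup>2\<close> merely halves
  \<open>F21 t / t\<^sup>2\<close>, so coefficients that are large compared with the entries they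
  multiply hardly disturb the modular. The estimates rest on two monotonicity facts,
  \<open>F21 t / t\<^sup>2\<close> increasing and \<open>F21 t / t ^ 4\<close> decreasing, through
  which second and fourth moments of random sign sums control \<open>F21\<close>. For
  \<open>G\<close> the first fails, since \<open>G t / t\<^sup>2\<close> is \<open>- ln t\<close>
  near 0; this is why \<open>G\<close> is reached through duality. In the final count write
  \<open>N = exp (k\<^sub>0 * t)\<close>. If \<open>k \<ge> k\<^sub>0\<close>, a coefficient of at
  least \<open>exp (- k * t)\<close> on a vector with mass at entries below \<open>exp (- k)\<close>
  enlarges the relevant logarithm by a factor of at most \<open>1 + 2 * t\<close>, of order
  \<open>ln N / k\<^sub>0\<close>. The squared norm of the block is of order
  \<open>N / ln N\<close>, so these coefficients have square sum of order
  \<open>N / k\<^sub>0\<close>, a small part of the total, which has order \<open>N\<close>.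
  Democracy serves only to carry a square-root estimate from special sets to all finite
  sets.\<close>

definition signs_of :: "'i set \<Rightarrow> 'i \<Rightarrow> real" where
  "signs_of A = (\<lambda>n. if n \<in> A then 1 else - 1)"

text \<open>The expectation over independent uniform signs indexed by \<open>S\<close>, each subset
  being the set of plus signs. It is vector valued so that random vectors can be averaged as well,
  which is how diagonals of operators are extracted.\<close>

definition sign_avg :: "'i set \<Rightarrow> (('i \<Rightarrow> real) \<Rightarrow> 'a::real_vector) \<Rightarrow> 'a" where
  "sign_avg S f = inverse (2 ^ card S) *\<^sub>R (\<Sum>A\<in>Pow S. f (signs_of A))"

lemma abs_signs_of [simp]: "\<bar>signs_of A n\<bar> = 1"
  by (simp add: signs_of_def)

lemma signs_of_square [simp]: "signs_of A n * signs_of A n = 1"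
  by (simp add: signs_of_def)

lemma sign_avg_const: "finite S \<Longrightarrow> sign_avg S (\<lambda>_. c) = c"
  by (simp add: sign_avg_def sum_constant_scaleR card_Pow)

lemma sign_avg_add: "sign_avg S (\<lambda>\<theta>. f \<theta> + g \<theta>) = sign_avg S f + sign_avg S g"
  by (simp add: sign_avg_def sum.distrib scaleR_add_right)

lemma sign_avg_sum: "sign_avg S (\<lambda>\<theta>. \<Sum>i\<in>I. f i \<theta>) = (\<Sum>i\<in>I. sign_avg S (f i))"
  unfolding sign_avg_def by (subst sum.swap) (simp add: scaleR_sum_right)

lemma sign_avg_scaleR: "sign_avg S (\<lambda>\<theta>. f \<theta> *\<^sub>R v) = sign_avg S f *\<^sub>R v"
  by (simp add: sign_avg_def flip: scaleR_left.sum)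

lemma sign_avg_cmult:
  fixes f :: "('i \<Rightarrow> real) \<Rightarrow> real"
  shows "sign_avg S (\<lambda>\<theta>. c * f \<theta>) = c * sign_avg S f"
  by (simp add: sign_avg_def sum_distrib_left mult.left_commute)

lemma sign_avg_cong:
  assumes "\<And>A. A \<subseteq> S \<Longrightarrow> f (signs_of A) = g (signs_of A)"
  shows "sign_avg S f = sign_avg S g"
  using assms by (auto simp: sign_avg_def intro!: sum.cong)

lemma sign_avg_mono:
  fixes f g :: "('i \<Rightarrow> real) \<Rightarrow> real"
  assumes "\<And>A. A \<subseteq> S \<Longrightarrow> f (signs_of A) \<le> g (signs_of A)"
  shows "sign_avg S f \<le> sign_avg S g"
  using assms by (auto simp: sign_avg_def intro!: sum_mono)

lemma sign_avg_le_const: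
  fixes f :: "('i \<Rightarrow> real) \<Rightarrow> real"
  assumes "finite S" "\<And>A. A \<subseteq> S \<Longrightarrow> f (signs_of A) \<le> c"
  shows "sign_avg S f \<le> c"
  using sign_avg_mono[of S f "\<lambda>_. c"] assms by (simp add: sign_avg_const)

lemma sign_avg_ge_const:
  fixes f :: "('i \<Rightarrow> real) \<Rightarrow> real"
  assumes "finite S" "\<And>A. A \<subseteq> S \<Longrightarrow> c \<le> f (signs_of A)"
  shows "c \<le> sign_avg S f"
  using sign_avg_mono[of S "\<lambda>_. c" f] assms by (simp add: sign_avg_const)

lemma sign_avg_attained:
  fixes f :: "('i \<Rightarrow> real) \<Rightarrow> real"
  assumes "finite S" "c \<le> sign_avg S f"
  obtains A where "A \<subseteq> S" "c \<le> f (signs_of A)"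
proof (rule ccontr)
  assume n: "\<not> thesis"
  have "(\<Sum>A\<in>Pow S. f (signs_of A)) < (\<Sum>A\<in>Pow S. c)"
  proof (rule sum_strict_mono)
    fix A assume "A \<in> Pow S"
    then show "f (signs_of A) < c"
      using n that[of A] by (simp add: not_le[symmetric]) blast
  qed (use assms(1) in auto)
  then have "(\<Sum>A\<in>Pow S. f (signs_of A)) < 2 ^ card S * c"
    using assms(1) by (simp add: card_Pow)
  then have "sign_avg S f < c"
    by (simp add: sign_avg_def field_simps)
  then show False using assms(2) by simp
qed

text \<open>Conditioning on the sign at \<open>n\<close>; this is the induction step for computing
  moments.\<close>

lemma sign_avg_insert:
  assumes "finite S" "n \<notin> S"
  shows "sign_avg (insert n S) f
    = (1/2) *\<^sub>R (sign_avg S (\<lambda>\<theta>. f (\<theta>(n := - 1))) + sign_avg S (\<lambda>\<theta>. f (\<theta>(n := 1))))"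
proof -
  have "(\<Sum>A\<in>Pow (insert n S). f (signs_of A))
      = (\<Sum>A\<in>Pow S. f (signs_of A)) + (\<Sum>A\<in>insert n ` Pow S. f (signs_of A))"
    unfolding Pow_insert by (rule sum.union_disjoint) (use assms in auto)
  also have "(\<Sum>A\<in>Pow S. f (signs_of A)) = (\<Sum>A\<in>Pow S. f ((signs_of A)(n := - 1)))"
  proof (rule sum.cong)
    fix A assume "A \<in> Pow S"
    then have "(signs_of A)(n := - 1) = signs_of A"
      using assms by (auto simp: signs_of_def fun_eq_iff)
    then show "f (signs_of A) = f ((signs_of A)(n := - 1))" by simp
  qed simp
  also have "(\<Sum>A\<in>insert n ` Pow S. f (signs_of A)) = (\<Sum>A\<in>Pow S. f (signs_of (insert n A)))"
    by (subst sum.reindex) (use assms in \<open>auto simp: inj_on_def\<close>)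
  also have "\<dots> = (\<Sum>A\<in>Pow S. f ((signs_of A)(n := 1)))"
  proof (rule sum.cong)
    fix A
    have "signs_of (insert n A) = (signs_of A)(n := 1)"
      by (auto simp: signs_of_def fun_eq_iff)
    then show "f (signs_of (insert n A)) = f ((signs_of A)(n := 1))" by simp
  qed simp
  finally show ?thesis
    using assms by (simp add: sign_avg_def scaleR_add_right del: fun_upd_apply)
qed

lemma sign_avg_insert_real:
  fixes f g :: "('i \<Rightarrow> real) \<Rightarrow> real"
  assumes "finite S" "n \<notin> S" "\<And>\<theta>. (f (\<theta>(n := - 1)) + f (\<theta>(n := 1))) / 2 = g \<theta>"
  shows "sign_avg (insert n S) f = sign_avg S g"
proof -
  have "sign_avg (insert n S) f = (1/2) * sign_avg S (\<lambda>\<theta>. f (\<theta>(n := - 1)) + f (\<theta>(n := 1)))"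
    by (simp only: sign_avg_insert[OF assms(1,2)] sign_avg_add real_scaleR_def)
  also have "\<dots> = sign_avg S (\<lambda>\<theta>. (1/2) * (f (\<theta>(n := - 1)) + f (\<theta>(n := 1))))"
    by (simp only: sign_avg_cmult)
  also have "\<dots> = sign_avg S g"
    using assms(3) by (intro sign_avg_cong) simp
  finally show ?thesis .
qed

lemma sum_fun_upd_other:
  assumes "n \<notin> S"
  shows "(\<Sum>i\<in>S. (\<theta>(n := c)) i * z i) = (\<Sum>i\<in>S. \<theta> i * (z i :: real))"
  by (rule sum.cong) (use assms in auto)

text \<open>Orthonormality of independent signs: the cross terms average to 0.\<close>

lemma sign_avg_bilinear:
  fixes y z :: "'i \<Rightarrow> real"
  assumes "finite S"
  shows "sign_avg S (\<lambda>\<theta>. (\<Sum>i\<in>S. \<theta> i * y i) * (\<Sum>i\<in>S. \<theta> i * z i)) = (\<Sum>i\<in>S. y i * z i)"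
  using assms
proof induction
  case empty
  then show ?case by (simp add: sign_avg_def)
next
  case (insert n S)
  let ?Y = "\<lambda>\<theta>. \<Sum>i\<in>S. \<theta> i * y i" and ?Z = "\<lambda>\<theta>. \<Sum>i\<in>S. \<theta> i * z i"
  have "sign_avg (insert n S) (\<lambda>\<theta>. (\<Sum>i\<in>insert n S. \<theta> i * y i) * (\<Sum>i\<in>insert n S. \<theta> i * z i))
    = sign_avg S (\<lambda>\<theta>. ?Y \<theta> * ?Z \<theta> + y n * z n)"
    using insert.hyps by (intro sign_avg_insert_real)
      (simp_all add: sum_fun_upd_other fun_upd_same del: fun_upd_apply, simp add: field_simps)
  then show ?case
    using insert by (simp add: sign_avg_add sign_avg_const)
qed

lemma sign_avg_square:
  fixes z :: "'i \<Rightarrow> real"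
  assumes "finite S"
  shows "sign_avg S (\<lambda>\<theta>. (\<Sum>i\<in>S. \<theta> i * z i)\<^sup>2) = (\<Sum>i\<in>S. (z i)\<^sup>2)"
  using sign_avg_bilinear[OF assms, of z z] by (simp add: power2_eq_square)

text \<open>Diagonal extraction: correlating a sign sum with one of its signs isolates one
  summand.\<close>

lemma sign_avg_coordinate:
  fixes z :: "'i \<Rightarrow> real"
  assumes "finite S" "n \<in> S"
  shows "sign_avg S (\<lambda>\<theta>. \<theta> n * (\<Sum>i\<in>S. \<theta> i * z i)) = z n"
proof -
  have "(\<Sum>i\<in>S. \<theta> i * of_bool (i = n)) = \<theta> n" for \<theta> :: "'i \<Rightarrow> real"
    using assms by simp
  then show ?thesis
    using sign_avg_bilinear[OF assms(1), of "\<lambda>i. of_bool (i = n)" z] assms by simp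
qed

text \<open>The fourth-moment Khinchin inequality. Adding one sign produces the cross term
  \<open>6 * w\<^sup>2 * X\<^sup>2\<close>, which is exactly the cross term of three times the
  squared sum.\<close>

lemma sign_avg_fourth_power:
  fixes z :: "'i \<Rightarrow> real"
  assumes "finite S"
  shows "sign_avg S (\<lambda>\<theta>. (\<Sum>i\<in>S. \<theta> i * z i) ^ 4) \<le> 3 * (\<Sum>i\<in>S. (z i)\<^sup>2)\<^sup>2"
  using assms
proof induction
  case empty
  then show ?case by (simp add: sign_avg_def)
next
  case (insert n S)
  let ?Z = "\<lambda>\<theta>. \<Sum>i\<in>S. \<theta> i * z i" and ?h = "\<Sum>i\<in>S. (z i)\<^sup>2"
  have id: "((X - w) ^ 4 + (X + w) ^ 4) / 2 = X ^ 4 + (6 * w\<^sup>2) * X\<^sup>2 + w ^ 4" for X w :: real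
  proof -
    have "(X - w) ^ 4 + (X + w) ^ 4 = 2 * (X ^ 4 + (6 * w\<^sup>2) * X\<^sup>2 + w ^ 4)"
      by algebra
    then show ?thesis by simp
  qed
  have "sign_avg (insert n S) (\<lambda>\<theta>. (\<Sum>i\<in>insert n S. \<theta> i * z i) ^ 4)
    = sign_avg S (\<lambda>\<theta>. ((?Z \<theta> - z n) ^ 4 + (?Z \<theta> + z n) ^ 4) / 2)"
    using insert.hyps by (intro sign_avg_insert_real)
      (simp_all add: sum_fun_upd_other fun_upd_same add.commute del: fun_upd_apply)
  also have "\<dots> = sign_avg S (\<lambda>\<theta>. ?Z \<theta> ^ 4) + (6 * (z n)\<^sup>2) * sign_avg S (\<lambda>\<theta>. (?Z \<theta>)\<^sup>2) + z n ^ 4"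
    unfolding id using insert.hyps by (simp add: sign_avg_add sign_avg_cmult sign_avg_const)
  also have "\<dots> \<le> 3 * ?h\<^sup>2 + (6 * (z n)\<^sup>2) * ?h + z n ^ 4"
    using insert by (simp add: sign_avg_square)
  also have "\<dots> \<le> 3 * ((z n)\<^sup>2 + ?h)\<^sup>2"
  proof -
    have "3 * ((z n)\<^sup>2 + ?h)\<^sup>2 - (3 * ?h\<^sup>2 + (6 * (z n)\<^sup>2) * ?h + z n ^ 4) = 2 * ((z n)\<^sup>2)\<^sup>2"
      by algebra
    moreover have "0 \<le> 2 * ((z n)\<^sup>2)\<^sup>2" by simp
    ultimately show ?thesis by linarith
  qed
  finally show ?case using insert.hyps by simp
qed

section \<open>Orlicz sequence spaces\<close>

lemma sum_fun_apply [simp]: "(\<Sum>i\<in>I. f i) x = (\<Sum>i\<in>I. f i x)"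
  by (induction I rule: infinite_finite_induct) auto

lemma scaleR_fun_apply [simp]: "(c *\<^sub>R f) x = c *\<^sub>R f x"
  by (simp add: scaleR_fun_def)

definition restr :: "'i set \<Rightarrow> ('i \<Rightarrow> real) \<Rightarrow> 'i \<Rightarrow> real" where
  "restr J v = (\<lambda>j. if j \<in> J then v j else 0)"

definition unit_seq :: "nat \<Rightarrow> nat \<Rightarrow> real" where
  "unit_seq j = (\<lambda>i. of_bool (i = j))"

lemma sum_unit_seq: "finite J \<Longrightarrow> (\<Sum>j\<in>J. v j *\<^sub>R unit_seq j) = restr J v"
  by (simp add: fun_eq_iff unit_seq_def restr_def if_distrib of_bool_def cong: if_cong)

locale orlicz =
  fixes M :: "real \<Rightarrow> real"
  assumes orlicz_function: "convex_orlicz_function M"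
begin

abbreviation "spc \<equiv> orlicz_space M"
abbreviation "nrm \<equiv> orlicz_norm M"

text \<open>Finite sums replace the series, so that no summability has to be carried along and
  limits can be taken term by term. For positive \<open>t\<close> this is membership in the set
  whose infimum is the norm.\<close>

definition modular_le :: "(nat \<Rightarrow> real) \<Rightarrow> real \<Rightarrow> bool" where
  "modular_le a t \<longleftrightarrow> (\<forall>E. finite E \<longrightarrow> (\<Sum>i\<in>E. M (\<bar>a i\<bar> / t)) \<le> 1)"

lemma M_nonneg: "0 \<le> t \<Longrightarrow> 0 \<le> M t"
  and M_0 [simp]: "M 0 = 0"
  and M_1 [simp]: "M 1 = 1"
  and M_convex: "convex_on {0..} M"
  using orlicz_function by (auto simp: convex_orlicz_function_def)

lemma M_scale_le:
  assumes "0 \<le> c" "c \<le> 1" "0 \<le> t"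
  shows "M (c * t) \<le> c * M t"
  using convex_onD[OF M_convex, of c 0 t] assms by simp

lemma M_mono:
  assumes "0 \<le> s" "s \<le> t"
  shows "M s \<le> M t"
proof (cases "t = 0")
  case False
  then have "M (s / t * t) \<le> s / t * M t"
    using assms by (intro M_scale_le) auto
  also have "\<dots> \<le> 1 * M t"
    using assms False by (intro mult_right_mono M_nonneg) auto
  finally show ?thesis using False by simp
qed (use assms in auto)

lemma M_scale_ge:
  assumes "1 \<le> c" "0 \<le> t"
  shows "c * M t \<le> M (c * t)"
proof -
  have "M (inverse c * (c * t)) \<le> inverse c * M (c * t)"
    using assms by (intro M_scale_le) (auto simp: inverse_le_1_iff)
  then show ?thesis using assms by (simp add: field_simps)
qed

lemma M_le_self: "0 \<le> t \<Longrightarrow> t \<le> 1 \<Longrightarrow> M t \<le> t"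
  using M_scale_le[of t 1] by simp

lemma M_ge_self: "1 \<le> t \<Longrightarrow> t \<le> M t"
  using M_scale_ge[of t 1] by simp

lemma M_convex_comb:
  assumes "0 \<le> u" "0 \<le> v" "u + v = 1" "0 \<le> s" "0 \<le> t"
  shows "M (u * s + v * t) \<le> u * M s + v * M t"
proof -
  have u: "u = 1 - v" and "v \<le> 1" using assms by auto
  then show ?thesis using convex_onD[OF M_convex, of v s t] assms(2,4,5) unfolding u by simp
qed

text \<open>In the open half line convexity suffices; at 0 the squeeze
  \<open>0 \<le> M t \<le> t\<close> takes over.\<close>

lemma M_continuous: "continuous_on {0..} M"
proof -
  have "continuous_on {0<..} M"
    by (intro convex_on_continuous convex_on_subset[OF M_convex]) auto
  then have c: "isCont M t" if "0 < t" for t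
    using that by (simp add: continuous_on_eq_continuous_at)
  have "continuous (at t within {0..}) M" if "0 \<le> t" for t
  proof (cases "t = 0")
    case True
    have "(M \<longlongrightarrow> 0) (at 0 within {0..})"
    proof (rule tendsto_sandwich[of "\<lambda>_. 0" _ _ "\<lambda>t. t"])
      show "\<forall>\<^sub>F t in at 0 within {0..}. 0 \<le> M t"
        by (auto simp: eventually_at_filter M_nonneg)
      show "\<forall>\<^sub>F t in at 0 within {0..}. M t \<le> t"
        unfolding eventually_at by (rule exI[of _ 1]) (auto intro: M_le_self)
    qed (auto intro: tendsto_ident_at)
    then show ?thesis using True by (simp add: continuous_within)
  next
    case False
    then show ?thesis using that c[of t] by (simp add: continuous_at_imp_continuous_at_within)
  qed
  then show ?thesis by (auto simp: continuous_on_eq_continuous_within)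
qed

lemma tendsto_M:
  assumes "(f \<longlongrightarrow> l) F" "\<And>x. 0 \<le> f x" "0 \<le> l"
  shows "((\<lambda>x. M (f x)) \<longlongrightarrow> M l) F"
  by (rule continuous_on_tendsto_compose[OF M_continuous assms(1)]) (use assms in auto)

lemma modular_leD: "modular_le a t \<Longrightarrow> finite E \<Longrightarrow> (\<Sum>i\<in>E. M (\<bar>a i\<bar> / t)) \<le> 1"
  by (simp add: modular_le_def)

lemma modular_le_mono:
  assumes "modular_le a s" "0 < s" "s \<le> t"
  shows "modular_le a t"
  unfolding modular_le_def
proof (intro allI impI)
  fix E :: "nat set" assume E: "finite E"
  have "(\<Sum>i\<in>E. M (\<bar>a i\<bar> / t)) \<le> (\<Sum>i\<in>E. M (\<bar>a i\<bar> / s))"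
    using assms by (intro sum_mono M_mono) (auto intro!: divide_left_mono)
  also have "\<dots> \<le> 1" using assms(1) E by (rule modular_leD)
  finally show "(\<Sum>i\<in>E. M (\<bar>a i\<bar> / t)) \<le> 1" .
qed

lemma modular_le_iff_suminf:
  assumes "0 < t"
  shows "modular_le a t \<longleftrightarrow> summable (\<lambda>n. M (\<bar>a n\<bar> / t)) \<and> (\<Sum>n. M (\<bar>a n\<bar> / t)) \<le> 1"
proof
  assume m: "modular_le a t"
  have nn: "0 \<le> M (\<bar>a n\<bar> / t)" for n using assms by (intro M_nonneg) auto
  have s: "summable (\<lambda>n. M (\<bar>a n\<bar> / t))"
    by (rule bounded_imp_summable[where B = 1]) (use nn modular_leD[OF m] in auto)
  moreover have "(\<Sum>n. M (\<bar>a n\<bar> / t)) \<le> 1"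
    by (rule suminf_le_const[OF s]) (use modular_leD[OF m] in auto)
  ultimately show "summable (\<lambda>n. M (\<bar>a n\<bar> / t)) \<and> (\<Sum>n. M (\<bar>a n\<bar> / t)) \<le> 1" by simp
next
  assume s: "summable (\<lambda>n. M (\<bar>a n\<bar> / t)) \<and> (\<Sum>n. M (\<bar>a n\<bar> / t)) \<le> 1"
  have nn: "0 \<le> M (\<bar>a n\<bar> / t)" for n using assms by (intro M_nonneg) auto
  show "modular_le a t"
    unfolding modular_le_def using s sum_le_suminf[of "\<lambda>n. M (\<bar>a n\<bar> / t)"] nn
    by (meson order_trans)
qed

text \<open>Continuity of \<open>M\<close> lets the bound pass to the limit in each finite sum, so a
  positive norm is itself an admissible scale.\<close>

lemma modular_le_limit:
  assumes t: "0 < t" and s: "\<And>s. t < s \<Longrightarrow> modular_le a s"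
  shows "modular_le a t"
  unfolding modular_le_def
proof (intro allI impI)
  fix E :: "nat set" assume E: "finite E"
  define f where "f = (\<lambda>n::nat. t + inverse (real (Suc n)))"
  have ft: "t < f n" for n by (simp add: f_def)
  have "f \<longlonglongrightarrow> t + 0" unfolding f_def by (intro tendsto_intros LIMSEQ_inverse_real_of_nat)
  then have f: "f \<longlonglongrightarrow> t" by simp
  have "(\<lambda>n. \<Sum>i\<in>E. M (\<bar>a i\<bar> / f n)) \<longlonglongrightarrow> (\<Sum>i\<in>E. M (\<bar>a i\<bar> / t))"
  proof (intro tendsto_sum tendsto_M tendsto_divide tendsto_const f)
    show "0 \<le> \<bar>a i\<bar> / f n" for i n
      using t ft[of n] by (intro divide_nonneg_nonneg) auto
  qed (use t in auto)
  then show "(\<Sum>i\<in>E. M (\<bar>a i\<bar> / t)) \<le> 1"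
    by (rule LIMSEQ_le_const2) (use s ft E in \<open>auto intro: modular_leD\<close>)
qed

lemma norm_set_eq:
  "{t. 0 < t \<and> summable (\<lambda>n. M (\<bar>a n\<bar> / t)) \<and> (\<Sum>n. M (\<bar>a n\<bar> / t)) \<le> 1} = {t. 0 < t \<and> modular_le a t}"
  using modular_le_iff_suminf by auto

text \<open>A finite modular can be brought below 1: enlarging the scale by a factor
  \<open>S \<ge> 1\<close> divides the modular by at least \<open>S\<close>, by convexity and
  \<open>M 0 = 0\<close>.\<close>

lemma spc_iff: "a \<in> spc \<longleftrightarrow> (\<exists>t>0. modular_le a t)"
proof
  assume "a \<in> spc"
  then obtain t where t: "0 < t" and s: "summable (\<lambda>n. M (\<bar>a n\<bar> / t))"
    by (auto simp: orlicz_space_def)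
  define S where "S = max 1 (\<Sum>n. M (\<bar>a n\<bar> / t))"
  have S: "1 \<le> S" by (simp add: S_def)
  have "modular_le a (S * t)"
    unfolding modular_le_def
  proof (intro allI impI)
    fix E :: "nat set" assume E: "finite E"
    have "(\<Sum>i\<in>E. M (\<bar>a i\<bar> / (S * t))) = (\<Sum>i\<in>E. M (inverse S * (\<bar>a i\<bar> / t)))"
      using S t by (simp add: field_simps)
    also have "\<dots> \<le> (\<Sum>i\<in>E. inverse S * M (\<bar>a i\<bar> / t))"
      using S t by (intro sum_mono M_scale_le) (auto simp: inverse_le_1_iff)
    also have "\<dots> = inverse S * (\<Sum>i\<in>E. M (\<bar>a i\<bar> / t))" by (simp add: sum_distrib_left)
    also have "\<dots> \<le> inverse S * S"
    proof (rule mult_left_mono)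
      have "(\<Sum>i\<in>E. M (\<bar>a i\<bar> / t)) \<le> (\<Sum>n. M (\<bar>a n\<bar> / t))"
        using s E t by (intro sum_le_suminf) (auto intro!: M_nonneg)
      then show "(\<Sum>i\<in>E. M (\<bar>a i\<bar> / t)) \<le> S" by (simp add: S_def)
    qed (use S in auto)
    finally show "(\<Sum>i\<in>E. M (\<bar>a i\<bar> / (S * t))) \<le> 1" using S by simp
  qed
  moreover have "0 < S * t" using S t by simp
  ultimately show "\<exists>t>0. modular_le a t" by blast
next
  assume "\<exists>t>0. modular_le a t"
  then show "a \<in> spc" using modular_le_iff_suminf by (auto simp: orlicz_space_def)
qed

lemma nrm_le:
  assumes "modular_le a t" "0 < t"
  shows "nrm a \<le> t"
  unfolding orlicz_norm_def norm_set_eq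
  by (rule cInf_lower) (use assms in \<open>auto intro!: bdd_belowI[of _ 0]\<close>)

lemma nrm_nonneg: "a \<in> spc \<Longrightarrow> 0 \<le> nrm a"
  unfolding orlicz_norm_def norm_set_eq
  by (rule cInf_greatest) (auto simp: spc_iff)

lemma modular_le_nrm:
  assumes "a \<in> spc" "nrm a \<le> t" "0 < t"
  shows "modular_le a t"
proof (rule modular_le_limit)
  fix s assume "t < s"
  then have "Inf {t. 0 < t \<and> modular_le a t} < s"
    using assms by (simp add: orlicz_norm_def norm_set_eq)
  then obtain r where "0 < r" "modular_le a r" "r < s"
    using assms(1) by (subst (asm) cInf_less_iff) (auto simp: spc_iff intro!: bdd_belowI[of _ 0])
  then show "modular_le a s" using modular_le_mono by auto
qed (use assms in auto)

lemma spc_nrm_leI: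
  assumes "modular_le a t" "0 < t"
  shows "a \<in> spc" "nrm a \<le> t"
  using assms nrm_le spc_iff by blast+

lemma nrm_le_lim:
  assumes "\<And>t. r < t \<Longrightarrow> 0 < t \<Longrightarrow> modular_le a t" "0 \<le> r"
  shows "a \<in> spc" "nrm a \<le> r"
proof -
  have "modular_le a (r + 1)" using assms by auto
  then show "a \<in> spc" using assms by (intro spc_nrm_leI(1)[of a "r + 1"]) auto
  show "nrm a \<le> r"
  proof (rule field_le_epsilon)
    fix e :: real assume "0 < e"
    then show "nrm a \<le> r + e" using assms by (intro nrm_le) auto
  qed
qed

text \<open>The normalization \<open>M 1 = 1\<close> and convexity force \<open>M\<close> above the
  identity beyond 1, so a modular of at most 1 has no argument larger than 1.\<close>

lemma abs_coordinate_le: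
  assumes "a \<in> spc"
  shows "\<bar>a i\<bar> \<le> nrm a"
proof (rule field_le_epsilon)
  fix e :: real assume e: "0 < e"
  define t where "t = nrm a + e"
  have t: "0 < t" "nrm a \<le> t" using e nrm_nonneg[OF assms] by (auto simp: t_def)
  have "(\<Sum>i\<in>{i}. M (\<bar>a i\<bar> / t)) \<le> 1"
    using modular_le_nrm[OF assms t(2,1)] by (rule modular_leD) auto
  then have "\<bar>a i\<bar> / t \<le> 1" using M_ge_self[of "\<bar>a i\<bar> / t"] by fastforce
  then show "\<bar>a i\<bar> \<le> nrm a + e" using t by (simp add: t_def field_simps)
qed

lemma modular_le_dominated:
  assumes "modular_le b t" "0 < t" "\<And>i. \<bar>a i\<bar> \<le> \<bar>b i\<bar>"
  shows "modular_le a t"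
  unfolding modular_le_def
proof (intro allI impI)
  fix E :: "nat set" assume E: "finite E"
  have "(\<Sum>i\<in>E. M (\<bar>a i\<bar> / t)) \<le> (\<Sum>i\<in>E. M (\<bar>b i\<bar> / t))"
    using assms by (intro sum_mono M_mono) (auto intro!: divide_right_mono)
  also have "\<dots> \<le> 1" using assms(1) E by (rule modular_leD)
  finally show "(\<Sum>i\<in>E. M (\<bar>a i\<bar> / t)) \<le> 1" .
qed

lemma dominated:
  assumes "b \<in> spc" "\<And>i. \<bar>a i\<bar> \<le> \<bar>b i\<bar>"
  shows "a \<in> spc" "nrm a \<le> nrm b"
proof -
  have "modular_le a t" if "nrm b < t" "0 < t" for t
    by (rule modular_le_dominated[OF modular_le_nrm[OF assms(1)] that(2) assms(2)])
      (use that in auto)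
  note nrm_le_lim[OF this nrm_nonneg[OF assms(1)]]
  then show "a \<in> spc" "nrm a \<le> nrm b" by auto
qed

lemma modular_le_add:
  assumes "modular_le a s" "modular_le b t" "0 < s" "0 < t"
  shows "modular_le (a + b) (s + t)"
  unfolding modular_le_def
proof (intro allI impI)
  fix E :: "nat set" assume E: "finite E"
  define u v where "u = s / (s + t)" and "v = t / (s + t)"
  have uv: "0 \<le> u" "0 \<le> v" "u + v = 1"
    using assms by (auto simp: u_def v_def simp flip: add_divide_distrib)
  have "(\<Sum>i\<in>E. M (\<bar>(a + b) i\<bar> / (s + t))) \<le> (\<Sum>i\<in>E. u * M (\<bar>a i\<bar> / s) + v * M (\<bar>b i\<bar> / t))"
  proof (rule sum_mono)
    fix i
    have "\<bar>(a + b) i\<bar> / (s + t) \<le> (\<bar>a i\<bar> + \<bar>b i\<bar>) / (s + t)"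
      using assms by (intro divide_right_mono) auto
    also have "\<dots> = u * (\<bar>a i\<bar> / s) + v * (\<bar>b i\<bar> / t)"
      using assms by (simp add: u_def v_def add_divide_distrib)
    finally have "M (\<bar>(a + b) i\<bar> / (s + t)) \<le> M (u * (\<bar>a i\<bar> / s) + v * (\<bar>b i\<bar> / t))"
      using assms by (intro M_mono) auto
    also have "\<dots> \<le> u * M (\<bar>a i\<bar> / s) + v * M (\<bar>b i\<bar> / t)"
      using uv assms by (intro M_convex_comb) auto
    finally show "M (\<bar>(a + b) i\<bar> / (s + t)) \<le> u * M (\<bar>a i\<bar> / s) + v * M (\<bar>b i\<bar> / t)" .
  qed
  also have "\<dots> = u * (\<Sum>i\<in>E. M (\<bar>a i\<bar> / s)) + v * (\<Sum>i\<in>E. M (\<bar>b i\<bar> / t))"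
    by (simp add: sum.distrib sum_distrib_left)
  also have "\<dots> \<le> u * 1 + v * 1"
    using uv assms(1,2) E by (intro add_mono mult_left_mono) (auto intro: modular_leD)
  finally show "(\<Sum>i\<in>E. M (\<bar>(a + b) i\<bar> / (s + t))) \<le> 1" using uv by simp
qed

lemma add_spc:
  assumes "a \<in> spc" "b \<in> spc"
  shows "a + b \<in> spc" "nrm (a + b) \<le> nrm a + nrm b"
proof -
  have "modular_le (a + b) t" if "nrm a + nrm b < t" "0 < t" for t
  proof -
    define e where "e = (t - nrm a - nrm b) / 2"
    have "0 < e" using that by (simp add: e_def)
    then have "modular_le (a + b) ((nrm a + e) + (nrm b + e))"
      using nrm_nonneg[OF assms(1)] nrm_nonneg[OF assms(2)] assms
      by (intro modular_le_add modular_le_nrm) auto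
    moreover have "(nrm a + e) + (nrm b + e) = t" by (simp add: e_def)
    ultimately show ?thesis by simp
  qed
  note nrm_le_lim[OF this]
  then show "a + b \<in> spc" "nrm (a + b) \<le> nrm a + nrm b"
    using nrm_nonneg[OF assms(1)] nrm_nonneg[OF assms(2)] by auto
qed

lemma zero_spc: "0 \<in> spc" "nrm 0 = 0"
proof -
  have "modular_le 0 t" for t by (simp add: modular_le_def)
  note nrm_le_lim[of 0, OF this]
  then show "0 \<in> spc" "nrm 0 = 0"
    using nrm_nonneg[of 0] by force+
qed

lemma scale_spc:
  assumes "a \<in> spc"
  shows "c *\<^sub>R a \<in> spc" "nrm (c *\<^sub>R a) = \<bar>c\<bar> * nrm a"
proof -
  have *: "c *\<^sub>R a \<in> spc \<and> nrm (c *\<^sub>R a) \<le> \<bar>c\<bar> * nrm a" if "a \<in> spc" for c a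
  proof (cases "c = 0")
    case True
    then have "c *\<^sub>R a = 0" by (simp add: fun_eq_iff)
    then show ?thesis using zero_spc nrm_nonneg[OF that] True by simp
  next
    case False
    have "modular_le (c *\<^sub>R a) t" if t: "\<bar>c\<bar> * nrm a < t" "0 < t" for t
    proof -
      have "modular_le a (t / \<bar>c\<bar>)"
        using False t \<open>a \<in> spc\<close> by (intro modular_le_nrm) (auto simp: field_simps)
      then show ?thesis
        using False by (simp add: modular_le_def abs_mult field_simps)
    qed
    note nrm_le_lim[OF this]
    then show ?thesis using nrm_nonneg[OF that] by simp
  qed
  show 1: "c *\<^sub>R a \<in> spc" using *[OF assms] by blast
  show "nrm (c *\<^sub>R a) = \<bar>c\<bar> * nrm a"
  proof (cases "c = 0")
    case True
    then have "c *\<^sub>R a = 0" by (simp add: fun_eq_iff)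
    then show ?thesis using zero_spc True by simp
  next
    case False
    have "nrm (inverse c *\<^sub>R (c *\<^sub>R a)) \<le> \<bar>inverse c\<bar> * nrm (c *\<^sub>R a)" using *[OF 1] by blast
    then have "\<bar>c\<bar> * nrm a \<le> nrm (c *\<^sub>R a)" using False by (simp add: field_simps)
    then show ?thesis using *[OF assms, of c] by auto
  qed
qed

lemma norm_on_spc: "norm_on spc nrm"
  unfolding norm_on_def
proof (intro conjI ballI allI)
  show "subspace spc"
    using zero_spc add_spc scale_spc by (auto simp: subspace_def)
  fix v assume v: "v \<in> spc"
  show "0 \<le> nrm v" using v by (rule nrm_nonneg)
  show "nrm v = 0 \<longleftrightarrow> v = 0"
  proof
    assume "nrm v = 0"
    then show "v = 0" using abs_coordinate_le[OF v] by (simp add: fun_eq_iff)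
  qed (use zero_spc in simp)
qed (use add_spc scale_spc in auto)

lemma banach_space_on_spc: "banach_space_on spc nrm"
  unfolding banach_space_on_def
proof (intro conjI allI impI norm_on_spc)
  fix X :: "nat \<Rightarrow> nat \<Rightarrow> real"
  assume X: "(\<forall>n. X n \<in> spc) \<and> (\<forall>\<epsilon>>0. \<exists>N. \<forall>m\<ge>N. \<forall>n\<ge>N. nrm (X m - X n) < \<epsilon>)"
  have sub: "X m - X n \<in> spc" for m n
    using add_spc(1)[of "X m" "(- 1) *\<^sub>R X n"] scale_spc(1)[of "X n" "- 1"] X by simp
  have "Cauchy (\<lambda>n. X n i)" for i
    unfolding Cauchy_def
  proof (intro allI impI)
    fix e :: real assume "0 < e"
    then obtain N where N: "\<forall>m\<ge>N. \<forall>n\<ge>N. nrm (X m - X n) < e" using X by blast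
    have "dist (X m i) (X n i) < e" if "m \<ge> N" "n \<ge> N" for m n
      using abs_coordinate_le[OF sub[of m n], of i] N that by (force simp: dist_real_def)
    then show "\<exists>N. \<forall>m\<ge>N. \<forall>n\<ge>N. dist (X m i) (X n i) < e" by blast
  qed
  moreover define l where "l = (\<lambda>i. lim (\<lambda>n. X n i))"
  ultimately have l: "(\<lambda>n. X n i) \<longlonglongrightarrow> l i" for i
    by (simp add: Cauchy_convergent flip: convergent_LIMSEQ_iff)
  \<comment> \<open>The Cauchy bound is passed to the coordinatewise limit inside each finite
    modular sum.\<close>
  have *: "\<exists>N. \<forall>m\<ge>N. modular_le (X m - l) e" if e: "0 < e" for e
  proof -
    obtain N where N: "\<forall>m\<ge>N. \<forall>n\<ge>N. nrm (X m - X n) < e" using X e by blast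
    have "modular_le (X m - l) e" if m: "m \<ge> N" for m
      unfolding modular_le_def
    proof (intro allI impI)
      fix E :: "nat set" assume E: "finite E"
      have "(\<lambda>n. \<Sum>i\<in>E. M (\<bar>(X m - X n) i\<bar> / e)) \<longlonglongrightarrow> (\<Sum>i\<in>E. M (\<bar>(X m - l) i\<bar> / e))"
        using e by (intro tendsto_sum tendsto_M) (auto intro!: tendsto_intros l)
      moreover have "(\<Sum>i\<in>E. M (\<bar>(X m - X n) i\<bar> / e)) \<le> 1" if "n \<ge> N" for n
        using N m that e E by (intro modular_leD[OF modular_le_nrm[OF sub]]) (auto intro: less_imp_le)
      ultimately show "(\<Sum>i\<in>E. M (\<bar>(X m - l) i\<bar> / e)) \<le> 1"
        by (intro LIMSEQ_le_const2) auto
    qed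
    then show ?thesis by blast
  qed
  have "l \<in> spc"
  proof -
    obtain m where "modular_le (X m - l) 1" using *[of 1] by auto
    then have "X m - l \<in> spc" by (intro spc_nrm_leI(1)[of _ 1]) auto
    then show ?thesis
      using add_spc(1)[of "X m" "(- 1) *\<^sub>R (X m - l)"] scale_spc(1)[of "X m - l" "- 1"] X
      by simp
  qed
  moreover have "(\<lambda>n. nrm (X n - l)) \<longlonglongrightarrow> 0"
  proof (rule LIMSEQ_I)
    fix r :: real assume r: "0 < r"
    then obtain N where N: "\<forall>m\<ge>N. modular_le (X m - l) (r / 2)" using *[of "r / 2"] by auto
    have "norm (nrm (X n - l) - 0) < r" if "n \<ge> N" for n
    proof -
      have "X n - l \<in> spc" "nrm (X n - l) \<le> r / 2"
        using N that r spc_nrm_leI[of "X n - l" "r / 2"] by auto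
      then show ?thesis using nrm_nonneg[of "X n - l"] r by simp
    qed
    then show "\<exists>N. \<forall>n\<ge>N. norm (nrm (X n - l) - 0) < r" by blast
  qed
  ultimately show "\<exists>l\<in>spc. (\<lambda>n. nrm (X n - l)) \<longlonglongrightarrow> 0" by blast
qed

end

section \<open>Greedy bases are unconditional and democratic\<close>

locale normed_carrier =
  fixes V :: "'a::real_vector set" and p :: "'a \<Rightarrow> real"
  assumes norm_on: "norm_on V p"
begin

lemma subspace_V: "subspace V"
  and p_nonneg: "v \<in> V \<Longrightarrow> 0 \<le> p v"
  and p_eq_0_iff: "v \<in> V \<Longrightarrow> p v = 0 \<longleftrightarrow> v = 0"
  and p_scale: "v \<in> V \<Longrightarrow> p (c *\<^sub>R v) = \<bar>c\<bar> * p v"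
  and p_triangle: "u \<in> V \<Longrightarrow> v \<in> V \<Longrightarrow> p (u + v) \<le> p u + p v"
  using norm_on by (auto simp: norm_on_def)

lemma V_closed [simp, intro]:
  "0 \<in> V" "u \<in> V \<Longrightarrow> v \<in> V \<Longrightarrow> u + v \<in> V" "u \<in> V \<Longrightarrow> v \<in> V \<Longrightarrow> u - v \<in> V"
  "u \<in> V \<Longrightarrow> c *\<^sub>R u \<in> V" "(\<And>i. i \<in> I \<Longrightarrow> f i \<in> V) \<Longrightarrow> sum f I \<in> V"
  using subspace_V
  by (auto simp: subspace_0 subspace_add subspace_diff subspace_scale subspace_sum)

lemma p_0 [simp]: "p 0 = 0"
  using p_eq_0_iff[of 0] by simp

lemma p_triangle_diff: "u \<in> V \<Longrightarrow> v \<in> V \<Longrightarrow> p (u - v) \<le> p u + p v"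
  using p_triangle[of u "(- 1) *\<^sub>R v"] p_scale[of v "- 1"] V_closed(4)[of v "- 1"] by simp

lemma p_sum_le: "(\<And>i. i \<in> I \<Longrightarrow> f i \<in> V) \<Longrightarrow> p (sum f I) \<le> (\<Sum>i\<in>I. p (f i))"
proof (induction I rule: infinite_finite_induct)
  case (insert i I)
  then have "p (f i + sum f I) \<le> p (f i) + p (sum f I)" by (intro p_triangle) auto
  then show ?case using insert by simp
qed auto

lemma p_sign_avg_le:
  assumes "\<And>A. A \<subseteq> S \<Longrightarrow> f (signs_of A) \<in> V"
  shows "p (sign_avg S f) \<le> sign_avg S (\<lambda>\<theta>. p (f \<theta>))" "sign_avg S f \<in> V"
proof -
  have "p (sign_avg S f) = inverse (2 ^ card S) * p (\<Sum>A\<in>Pow S. f (signs_of A))"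
    unfolding sign_avg_def using assms by (subst p_scale) auto
  also have "\<dots> \<le> inverse (2 ^ card S) * (\<Sum>A\<in>Pow S. p (f (signs_of A)))"
    using assms by (intro mult_left_mono p_sum_le) auto
  finally show "p (sign_avg S f) \<le> sign_avg S (\<lambda>\<theta>. p (f \<theta>))" by (simp add: sign_avg_def)
  show "sign_avg S f \<in> V" unfolding sign_avg_def using assms by (intro V_closed(4,5)) auto
qed

lemma p_sign_avg_le_const:
  assumes "finite S" "\<And>A. A \<subseteq> S \<Longrightarrow> f (signs_of A) \<in> V" "\<And>A. A \<subseteq> S \<Longrightarrow> p (f (signs_of A)) \<le> R"
  shows "p (sign_avg S f) \<le> R"
  using p_sign_avg_le(1)[of S f] sign_avg_le_const[of S "\<lambda>\<theta>. p (f \<theta>)" R] assms by fastforce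

text \<open>The norm is convex in the multiplier, hence largest at the vertices of the cube. The
  induction runs over a set \<open>D\<close> outside of which the multiplier already consists of
  signs.\<close>

lemma multiplier_extreme:
  fixes w :: "'i \<Rightarrow> 'a"
  assumes A: "finite A" and w: "\<And>n. n \<in> A \<Longrightarrow> w n \<in> V"
    and sgn: "\<And>\<theta>. (\<And>n. n \<in> A \<Longrightarrow> \<bar>\<theta> n\<bar> = 1) \<Longrightarrow> p (\<Sum>n\<in>A. \<theta> n *\<^sub>R w n) \<le> R"
    and "\<And>n. n \<in> A \<Longrightarrow> \<bar>\<theta> n\<bar> \<le> 1"
  shows "p (\<Sum>n\<in>A. \<theta> n *\<^sub>R w n) \<le> R"
proof -
  have "p (\<Sum>n\<in>A. \<theta> n *\<^sub>R w n) \<le> R"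
    if "finite D" "\<And>n. n \<in> A \<Longrightarrow> \<bar>\<theta> n\<bar> \<le> 1" "\<And>n. n \<in> A - D \<Longrightarrow> \<bar>\<theta> n\<bar> = 1" for D \<theta>
    using that
  proof (induction D arbitrary: \<theta> rule: finite_induct)
    case empty
    then show ?case by (intro sgn) auto
  next
    case (insert d D)
    show ?case
    proof (cases "d \<in> A")
      case False
      then show ?thesis using insert by (intro insert.IH) auto
    next
      case True
      let ?S = "\<lambda>\<theta>. \<Sum>n\<in>A. \<theta> n *\<^sub>R w n"
      define u where "u = (1 + \<theta> d) / 2"
      have u: "0 \<le> u" "u \<le> 1" using insert.prems(1)[OF True] by (auto simp: u_def)
      have le: "p (?S (\<theta>(d := 1))) \<le> R" "p (?S (\<theta>(d := - 1))) \<le> R"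
        using insert.prems by (auto intro!: insert.IH)
      have VS: "?S \<theta> \<in> V" for \<theta> using w by auto
      have "\<theta> n *\<^sub>R w n
          = u *\<^sub>R ((\<theta>(d := 1)) n *\<^sub>R w n) + (1 - u) *\<^sub>R ((\<theta>(d := - 1)) n *\<^sub>R w n)" for n
        by (simp add: u_def flip: scaleR_left_distrib) (simp add: field_simps)
      then have "?S \<theta> = u *\<^sub>R ?S (\<theta>(d := 1)) + (1 - u) *\<^sub>R ?S (\<theta>(d := - 1))"
        by (simp only: sum.distrib scaleR_sum_right)
      then have "p (?S \<theta>) \<le> p (u *\<^sub>R ?S (\<theta>(d := 1))) + p ((1 - u) *\<^sub>R ?S (\<theta>(d := - 1)))"
        using VS by (metis p_triangle V_closed(4))
      also have "\<dots> = u * p (?S (\<theta>(d := 1))) + (1 - u) * p (?S (\<theta>(d := - 1)))"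
        using u by (simp only: p_scale[OF VS])
      also have "\<dots> \<le> u * R + (1 - u) * R"
        using u le by (intro add_mono mult_left_mono) auto
      finally show ?thesis by (simp add: algebra_simps)
    qed
  qed
  from this[of A \<theta>] show ?thesis using assms by auto
qed

lemma expansion_add:
  assumes "expansion p x u a" "expansion p x v b" "u \<in> V" "v \<in> V" "\<And>n. x n \<in> V"
  shows "expansion p x (u + v) (\<lambda>n. a n + b n)"
proof -
  let ?u = "\<lambda>N. u - (\<Sum>n<N. a n *\<^sub>R x n)" and ?v = "\<lambda>N. v - (\<Sum>n<N. b n *\<^sub>R x n)"
  have eq: "(u + v) - (\<Sum>n<N. (a n + b n) *\<^sub>R x n) = ?u N + ?v N" for N
    by (simp add: scaleR_left_distrib sum.distrib algebra_simps)
  have in_V: "?u N \<in> V" "?v N \<in> V" for N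
    using assms(3-5) by auto
  have lim: "(\<lambda>N. p (?u N) + p (?v N)) \<longlonglongrightarrow> 0"
    using tendsto_add[OF assms(1,2)[unfolded expansion_def]] by (simp only: add_0_left)
  have "norm (p (?u N + ?v N)) \<le> p (?u N) + p (?v N)" for N
    using p_nonneg[OF V_closed(2)[OF in_V]] p_triangle[OF in_V]
    by (simp only: real_norm_def abs_of_nonneg)
  then have "(\<lambda>N. p (?u N + ?v N)) \<longlonglongrightarrow> 0"
    by (intro Lim_null_comparison[OF always_eventually lim] allI)
  then show ?thesis
    unfolding expansion_def by (simp only: eq)
qed

lemma expansion_scale:
  assumes "expansion p x u a" "u \<in> V" "\<And>n. x n \<in> V"
  shows "expansion p x (c *\<^sub>R u) (\<lambda>n. c * a n)"
proof -
  have "(\<lambda>N. \<bar>c\<bar> * p (u - (\<Sum>n<N. a n *\<^sub>R x n))) \<longlonglongrightarrow> \<bar>c\<bar> * 0"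
    using assms(1) unfolding expansion_def by (intro tendsto_mult_left)
  moreover have "p (c *\<^sub>R u - (\<Sum>n<N. (c * a n) *\<^sub>R x n)) = \<bar>c\<bar> * p (u - (\<Sum>n<N. a n *\<^sub>R x n))" for N
    using assms p_scale[of "u - (\<Sum>n<N. a n *\<^sub>R x n)" c]
    by (simp add: scaleR_diff_right scaleR_sum_right)
  ultimately show ?thesis unfolding expansion_def by simp
qed

lemma expansion_basis_vector:
  assumes "x m \<in> V"
  shows "expansion p x (x m) (\<lambda>n. of_bool (n = m))"
proof -
  have "p (x m - (\<Sum>n<N. of_bool (n = m) *\<^sub>R x n)) = 0" if "N > m" for N
  proof -
    have "(\<Sum>n<N. of_bool (n = m) *\<^sub>R x n) = (\<Sum>n<N. if n = m then x n else 0)"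
      by (rule sum.cong) auto
    also have "\<dots> = x m" using that by (simp add: sum.delta)
    finally show ?thesis by simp
  qed
  then show ?thesis
    unfolding expansion_def
    by (intro tendsto_eventually eventually_sequentiallyI[of "Suc m"]) auto
qed

end

locale schauder_carrier = normed_carrier V p for V :: "'a::real_vector set" and p +
  fixes x :: "nat \<Rightarrow> 'a"
  assumes schauder: "schauder_basis V p x"
begin

abbreviation "crd n v \<equiv> coord p x n v"

lemma x_in_V [simp, intro]: "x n \<in> V"
  using schauder by (simp add: schauder_basis_def)

lemma ex1_expansion: "v \<in> V \<Longrightarrow> \<exists>!a. expansion p x v a"
  using schauder by (simp add: schauder_basis_def)

lemma expansion_coord: "v \<in> V \<Longrightarrow> expansion p x v (\<lambda>n. crd n v)"
  using theI'[OF ex1_expansion] by (simp add: coord_def)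

lemma coord_eqI: "v \<in> V \<Longrightarrow> expansion p x v a \<Longrightarrow> crd n v = a n"
  using ex1_expansion expansion_coord by metis

lemma coord_add: "u \<in> V \<Longrightarrow> v \<in> V \<Longrightarrow> crd n (u + v) = crd n u + crd n v"
  by (rule coord_eqI[where a = "\<lambda>n. crd n u + crd n v"]) (auto intro: expansion_add expansion_coord)

lemma coord_scale: "u \<in> V \<Longrightarrow> crd n (c *\<^sub>R u) = c * crd n u"
  by (rule coord_eqI[where a = "\<lambda>n. c * crd n u"]) (auto intro: expansion_scale expansion_coord)

lemma coord_diff: "u \<in> V \<Longrightarrow> v \<in> V \<Longrightarrow> crd n (u - v) = crd n u - crd n v"
  using coord_add[of u "(- 1) *\<^sub>R v" n] coord_scale[of v n "- 1"] V_closed(4)[of v "- 1"] by simp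

lemma coord_0: "crd n 0 = 0"
  using coord_scale[of 0 n 0] by simp

lemma coord_sum: "(\<And>i. i \<in> I \<Longrightarrow> f i \<in> V) \<Longrightarrow> crd n (sum f I) = (\<Sum>i\<in>I. crd n (f i))"
  by (induction I rule: infinite_finite_induct) (auto simp: coord_0 coord_add)

lemma coord_basis_vector: "crd n (x m) = of_bool (n = m)"
  by (rule coord_eqI[OF _ expansion_basis_vector]) auto

lemma coord_finite_sum:
  assumes "finite E"
  shows "crd n (\<Sum>m\<in>E. c m *\<^sub>R x m) = (if n \<in> E then c n else 0)"
proof -
  have "crd n (\<Sum>m\<in>E. c m *\<^sub>R x m) = (\<Sum>m\<in>E. c m * of_bool (n = m))"
    by (simp add: coord_sum coord_scale coord_basis_vector)
  also have "\<dots> = (\<Sum>m\<in>E. if n = m then c m else 0)" by (rule sum.cong) auto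
  finally show ?thesis using assms by (simp add: sum.delta)
qed

lemma best_approx_error_le:
  assumes "finite A" "v \<in> V"
  shows "best_approx_error p x (card A) v \<le> p (v - (\<Sum>n\<in>A. \<alpha> n *\<^sub>R x n))"
  unfolding best_approx_error_def
proof (rule cInf_lower)
  show "bdd_below {p (v - (\<Sum>n\<in>B. \<beta> n *\<^sub>R x n)) |B \<beta>. finite B \<and> card B = card A}"
    using assms(2) by (intro bdd_belowI[of _ 0]) (auto intro!: p_nonneg)
qed (use assms in auto)

lemma best_approx_error_nonneg:
  assumes "v \<in> V"
  shows "0 \<le> best_approx_error p x N v"
  unfolding best_approx_error_def
proof (rule cInf_greatest)
  have "finite {..<N} \<and> card {..<N} = N" by simp
  then show "{p (v - (\<Sum>n\<in>A. \<alpha> n *\<^sub>R x n)) |A \<alpha>. finite A \<and> card A = N} \<noteq> {}" by blast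
qed (use assms in \<open>auto intro!: p_nonneg\<close>)

end

locale greedy_carrier = schauder_carrier +
  assumes greedy: "greedy_basis V p x" and normalized: "semi_normalized p x"
begin

lemma greedy_constant:
  "\<exists>C\<ge>1. \<forall>v\<in>V. \<forall>\<Lambda> A \<alpha>. finite \<Lambda> \<longrightarrow> finite A \<longrightarrow> card A = card \<Lambda>
      \<longrightarrow> (\<forall>n\<in>\<Lambda>. \<forall>k. k \<notin> \<Lambda> \<longrightarrow> \<bar>crd k v\<bar> \<le> \<bar>crd n v\<bar>)
      \<longrightarrow> p (v - (\<Sum>n\<in>\<Lambda>. crd n v *\<^sub>R x n)) \<le> C * p (v - (\<Sum>n\<in>A. \<alpha> n *\<^sub>R x n))"
proof -
  obtain C where C: "\<forall>v\<in>V. \<forall>N \<Lambda>. finite \<Lambda> \<and> card \<Lambda> = N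
            \<and> (\<forall>n\<in>\<Lambda>. \<forall>k. k \<notin> \<Lambda> \<longrightarrow> \<bar>crd k v\<bar> \<le> \<bar>crd n v\<bar>)
          \<longrightarrow> p (v - (\<Sum>n\<in>\<Lambda>. crd n v *\<^sub>R x n)) \<le> C * best_approx_error p x N v"
    using greedy unfolding greedy_basis_def by blast
  have "p (v - (\<Sum>n\<in>\<Lambda>. crd n v *\<^sub>R x n)) \<le> max C 1 * p (v - (\<Sum>n\<in>A. \<alpha> n *\<^sub>R x n))"
    if "v \<in> V" "finite \<Lambda>" "finite A" "card A = card \<Lambda>"
      "\<And>n k. n \<in> \<Lambda> \<Longrightarrow> k \<notin> \<Lambda> \<Longrightarrow> \<bar>crd k v\<bar> \<le> \<bar>crd n v\<bar>" for v \<Lambda> A \<alpha>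
  proof -
    have "p (v - (\<Sum>n\<in>\<Lambda>. crd n v *\<^sub>R x n)) \<le> C * best_approx_error p x (card A) v"
      using C that by auto
    also have "\<dots> \<le> max C 1 * best_approx_error p x (card A) v"
      using that by (intro mult_right_mono best_approx_error_nonneg) auto
    also have "\<dots> \<le> max C 1 * p (v - (\<Sum>n\<in>A. \<alpha> n *\<^sub>R x n))"
      using that by (intro mult_left_mono best_approx_error_le) auto
    finally show ?thesis .
  qed
  then show ?thesis by (intro exI[of _ "max C 1"]) auto
qed

text \<open>Each term of the expansion is a difference of consecutive remainders, and these
  converge. The bound depends on \<open>v\<close>, which is enough to choose the large constant in
  the next lemma; uniform boundedness of the functionals follows later from
  unconditionality.\<close>

lemma coord_bounded:
  assumes v: "v \<in> V"
  shows "\<exists>B\<ge>0. \<forall>n. \<bar>crd n v\<bar> \<le> B"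
proof -
  obtain c where c: "0 < c" "\<And>n. c \<le> p (x n)" using normalized by (auto simp: semi_normalized_def)
  define r where "r = (\<lambda>N. p (v - (\<Sum>n<N. crd n v *\<^sub>R x n)))"
  have "r \<longlonglongrightarrow> 0" using expansion_coord[OF v] by (simp add: expansion_def r_def)
  then obtain R where R: "\<And>N. \<bar>r N\<bar> \<le> R"
    using convergent_imp_Bseq[of r] by (auto simp: convergent_def Bseq_def)
  have "\<bar>crd n v\<bar> \<le> 2 * R / c" for n
  proof -
    have "\<bar>crd n v\<bar> * c \<le> \<bar>crd n v\<bar> * p (x n)" using c by (intro mult_left_mono) auto
    also have "\<dots> = p (crd n v *\<^sub>R x n)" by (simp add: p_scale)
    also have "crd n v *\<^sub>R x n = (v - (\<Sum>n<n. crd n v *\<^sub>R x n)) - (v - (\<Sum>n<Suc n. crd n v *\<^sub>R x n))"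
      by simp
    also have "p \<dots> \<le> r n + r (Suc n)" unfolding r_def using v by (intro p_triangle_diff) auto
    also have "\<dots> \<le> 2 * R" using R[of n] R[of "Suc n"] by linarith
    finally show ?thesis using c by (simp add: field_simps)
  qed
  moreover have "0 \<le> 2 * R / c" using R[of 0] c by (intro divide_nonneg_pos) auto
  ultimately show ?thesis by blast
qed

text \<open>Adding a large constant to the coefficients in \<open>A\<close> makes \<open>A\<close> a greedy set; the greedy
  inequality then bounds the projection onto the complement of \<open>A\<close>.\<close>

lemma suppression_unconditional:
  "\<exists>C\<ge>1. \<forall>v\<in>V. \<forall>A. finite A \<longrightarrow> p (\<Sum>n\<in>A. crd n v *\<^sub>R x n) \<le> C * p v"
proof -
  obtain C where C: "1 \<le> C" and gr: "\<forall>v\<in>V. \<forall>\<Lambda> A \<alpha>. finite \<Lambda> \<longrightarrow> finite A \<longrightarrow> card A = card \<Lambda>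
      \<longrightarrow> (\<forall>n\<in>\<Lambda>. \<forall>k. k \<notin> \<Lambda> \<longrightarrow> \<bar>crd k v\<bar> \<le> \<bar>crd n v\<bar>)
      \<longrightarrow> p (v - (\<Sum>n\<in>\<Lambda>. crd n v *\<^sub>R x n)) \<le> C * p (v - (\<Sum>n\<in>A. \<alpha> n *\<^sub>R x n))"
    using greedy_constant by blast
  note gr = gr[rule_format]
  have "p (\<Sum>n\<in>A. crd n v *\<^sub>R x n) \<le> (1 + C) * p v" if v: "v \<in> V" and A: "finite A" for v A
  proof -
    obtain B where B: "0 \<le> B" "\<And>n. \<bar>crd n v\<bar> \<le> B" using coord_bounded[OF v] by blast
    define y where "y = v + (\<Sum>n\<in>A. (2 * B) *\<^sub>R x n)"
    have y: "y \<in> V" using v by (auto simp: y_def)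
    have cy: "crd n y = crd n v + (if n \<in> A then 2 * B else 0)" for n
      using v A by (simp add: y_def coord_add coord_finite_sum)
    have "p (y - (\<Sum>n\<in>A. crd n y *\<^sub>R x n)) \<le> C * p (y - (\<Sum>n\<in>A. (2 * B) *\<^sub>R x n))"
    proof (rule gr[OF y A A refl])
      fix n k assume "n \<in> A" "k \<notin> A"
      then show "\<bar>crd k y\<bar> \<le> \<bar>crd n y\<bar>" using B(2)[of n] B(2)[of k] by (simp add: cy)
    qed
    moreover have "y - (\<Sum>n\<in>A. crd n y *\<^sub>R x n) = v - (\<Sum>n\<in>A. crd n v *\<^sub>R x n)"
    proof -
      have "(\<Sum>n\<in>A. crd n y *\<^sub>R x n) = (\<Sum>n\<in>A. crd n v *\<^sub>R x n) + (\<Sum>n\<in>A. (2 * B) *\<^sub>R x n)"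
        by (simp add: cy scaleR_left_distrib sum.distrib)
      then show ?thesis by (simp add: y_def)
    qed
    moreover have "y - (\<Sum>n\<in>A. (2 * B) *\<^sub>R x n) = v" by (simp add: y_def)
    ultimately have "p (v - (\<Sum>n\<in>A. crd n v *\<^sub>R x n)) \<le> C * p v" by simp
    moreover have "p (v - (v - (\<Sum>n\<in>A. crd n v *\<^sub>R x n))) \<le> p v + p (v - (\<Sum>n\<in>A. crd n v *\<^sub>R x n))"
      using v by (intro p_triangle_diff) auto
    ultimately show ?thesis by (simp add: algebra_simps)
  qed
  then show ?thesis using C by (intro exI[of _ "1 + C"]) auto
qed

text \<open>A sign multiplier is a difference of two coordinate projections; convexity then extends
  the bound from signs to all multipliers in the cube.\<close>

lemma multiplier_unconditional:
  "\<exists>K\<ge>1. \<forall>v\<in>V. \<forall>A \<theta>. finite A \<longrightarrow> (\<forall>n\<in>A. \<bar>\<theta> n\<bar> \<le> 1)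
     \<longrightarrow> p (\<Sum>n\<in>A. (\<theta> n * crd n v) *\<^sub>R x n) \<le> K * p v"
proof -
  obtain C where C: "1 \<le> C"
    "\<And>v A. v \<in> V \<Longrightarrow> finite A \<Longrightarrow> p (\<Sum>n\<in>A. crd n v *\<^sub>R x n) \<le> C * p v"
    using suppression_unconditional by blast
  have "p (\<Sum>n\<in>A. (\<theta> n * crd n v) *\<^sub>R x n) \<le> (2 * C) * p v"
    if v: "v \<in> V" and A: "finite A" and \<theta>: "\<And>n. n \<in> A \<Longrightarrow> \<bar>\<theta> n\<bar> \<le> 1" for v A and \<theta> :: "nat \<Rightarrow> real"
  proof -
    have "p (\<Sum>n\<in>A. \<theta> n *\<^sub>R (crd n v *\<^sub>R x n)) \<le> 2 * C * p v"
    proof (rule multiplier_extreme[OF A _ _ \<theta>])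
      fix \<epsilon> :: "nat \<Rightarrow> real" assume \<epsilon>: "\<And>n. n \<in> A \<Longrightarrow> \<bar>\<epsilon> n\<bar> = 1"
      define P where "P = {n \<in> A. \<epsilon> n = 1}"
      have "(\<Sum>n\<in>A. \<epsilon> n *\<^sub>R (crd n v *\<^sub>R x n))
          = (\<Sum>n\<in>A - P. \<epsilon> n *\<^sub>R (crd n v *\<^sub>R x n)) + (\<Sum>n\<in>P. \<epsilon> n *\<^sub>R (crd n v *\<^sub>R x n))"
        using A by (intro sum.subset_diff) (auto simp: P_def)
      also have "(\<Sum>n\<in>A - P. \<epsilon> n *\<^sub>R (crd n v *\<^sub>R x n)) = - (\<Sum>n\<in>A - P. crd n v *\<^sub>R x n)"
        unfolding sum_negf[symmetric]
      proof (rule sum.cong)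
        fix n assume "n \<in> A - P"
        then have "\<epsilon> n = - 1" using \<epsilon>[of n] by (auto simp: P_def abs_if split: if_splits)
        then show "\<epsilon> n *\<^sub>R (crd n v *\<^sub>R x n) = - (crd n v *\<^sub>R x n)" by simp
      qed simp
      also have "(\<Sum>n\<in>P. \<epsilon> n *\<^sub>R (crd n v *\<^sub>R x n)) = (\<Sum>n\<in>P. crd n v *\<^sub>R x n)"
        by (rule sum.cong) (auto simp: P_def)
      finally have "(\<Sum>n\<in>A. \<epsilon> n *\<^sub>R (crd n v *\<^sub>R x n))
          = (\<Sum>n\<in>P. crd n v *\<^sub>R x n) - (\<Sum>n\<in>A - P. crd n v *\<^sub>R x n)" by simp
      then have "p (\<Sum>n\<in>A. \<epsilon> n *\<^sub>R (crd n v *\<^sub>R x n))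
          \<le> p (\<Sum>n\<in>P. crd n v *\<^sub>R x n) + p (\<Sum>n\<in>A - P. crd n v *\<^sub>R x n)"
        using p_triangle_diff[of "\<Sum>n\<in>P. crd n v *\<^sub>R x n" "\<Sum>n\<in>A - P. crd n v *\<^sub>R x n"] by auto
      also have "\<dots> \<le> C * p v + C * p v"
        using v A by (intro add_mono C) (auto simp: P_def)
      finally show "p (\<Sum>n\<in>A. \<epsilon> n *\<^sub>R (crd n v *\<^sub>R x n)) \<le> 2 * C * p v" by simp
    qed auto
    then show ?thesis by simp
  qed
  then show ?thesis using C by (intro exI[of _ "2 * C"]) auto
qed

text \<open>On the indicator of the symmetric difference all nonzero coefficients are equal, so
  either half may be removed as a greedy set while the other serves as the competing approximation.
  The common part is handled by suppression.\<close>

lemma democratic: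
  "\<exists>D\<ge>1. \<forall>A B. finite A \<longrightarrow> finite B \<longrightarrow> card A = card B \<longrightarrow> p (\<Sum>n\<in>A. x n) \<le> D * p (\<Sum>n\<in>B. x n)"
proof -
  obtain C where C: "1 \<le> C" and gr: "\<forall>v\<in>V. \<forall>\<Lambda> A \<alpha>. finite \<Lambda> \<longrightarrow> finite A \<longrightarrow> card A = card \<Lambda>
      \<longrightarrow> (\<forall>n\<in>\<Lambda>. \<forall>k. k \<notin> \<Lambda> \<longrightarrow> \<bar>crd k v\<bar> \<le> \<bar>crd n v\<bar>)
      \<longrightarrow> p (v - (\<Sum>n\<in>\<Lambda>. crd n v *\<^sub>R x n)) \<le> C * p (v - (\<Sum>n\<in>A. \<alpha> n *\<^sub>R x n))"
    using greedy_constant by blast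
  note gr = gr[rule_format]
  obtain S where S: "1 \<le> S"
    "\<And>v A. v \<in> V \<Longrightarrow> finite A \<Longrightarrow> p (\<Sum>n\<in>A. crd n v *\<^sub>R x n) \<le> S * p v"
    using suppression_unconditional by blast
  have "p (\<Sum>n\<in>A. x n) \<le> (S + C * S) * p (\<Sum>n\<in>B. x n)"
    if A: "finite A" and B: "finite B" and card: "card A = card B" for A B
  proof -
    have sub: "p (\<Sum>n\<in>D. x n) \<le> S * p (\<Sum>n\<in>B. x n)" if "D \<subseteq> B" for D
    proof -
      have D: "finite D" using that B finite_subset by blast
      have "crd n (\<Sum>n\<in>B. x n) = of_bool (n \<in> B)" for n
        using coord_finite_sum[OF B, of n "\<lambda>_. 1"] by simp
      then have "(\<Sum>n\<in>D. crd n (\<Sum>n\<in>B. x n) *\<^sub>R x n) = (\<Sum>n\<in>D. x n)"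
        using that by (intro sum.cong) auto
      then show ?thesis using S(2)[of "\<Sum>n\<in>B. x n" D] D by auto
    qed
    define y where "y = (\<Sum>n\<in>(A - B) \<union> (B - A). x n)"
    have y: "y \<in> V" by (auto simp: y_def)
    have cy: "crd n y = of_bool (n \<in> (A - B) \<union> (B - A))" for n
      using coord_finite_sum[of "(A - B) \<union> (B - A)" n "\<lambda>_. 1"] A B by (simp add: y_def)
    have y2: "y = (\<Sum>n\<in>A - B. x n) + (\<Sum>n\<in>B - A. x n)"
      unfolding y_def using A B by (intro sum.union_disjoint) auto
    have "card (A - B) = card (B - A)"
      using A B card by (simp add: card_Diff_subset_Int Int_commute)
    then have "p (y - (\<Sum>n\<in>B - A. crd n y *\<^sub>R x n)) \<le> C * p (y - (\<Sum>n\<in>A - B. 1 *\<^sub>R x n))"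
      using A B by (intro gr y) (auto simp: cy)
    moreover have "(\<Sum>n\<in>B - A. crd n y *\<^sub>R x n) = (\<Sum>n\<in>B - A. x n)"
      by (rule sum.cong) (auto simp: cy)
    ultimately have 1: "p (\<Sum>n\<in>A - B. x n) \<le> C * p (\<Sum>n\<in>B - A. x n)" by (simp add: y2)
    have "(\<Sum>n\<in>A. x n) = (\<Sum>n\<in>A - B. x n) + (\<Sum>n\<in>A \<inter> B. x n)"
      using A by (subst sum.union_disjoint[symmetric]) (auto intro!: sum.cong)
    then have "p (\<Sum>n\<in>A. x n) \<le> p (\<Sum>n\<in>A - B. x n) + p (\<Sum>n\<in>A \<inter> B. x n)"
      by (simp only:) (intro p_triangle, auto)
    also have "p (\<Sum>n\<in>A - B. x n) \<le> C * (S * p (\<Sum>n\<in>B. x n))"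
      using 1 sub[of "B - A"] C by (smt (verit) mult_left_mono Diff_subset)
    also have "p (\<Sum>n\<in>A \<inter> B. x n) \<le> S * p (\<Sum>n\<in>B. x n)"
      by (rule sub) auto
    finally show ?thesis by (simp add: algebra_simps)
  qed
  moreover have "1 \<le> S + C * S" using S(1) C by (smt (verit) mult_nonneg_nonneg)
  ultimately show ?thesis by blast
qed

end

section \<open>The unit vector basis of an Orlicz sequence space\<close>

context orlicz
begin

sublocale normed_carrier spc nrm
  by unfold_locales (rule norm_on_spc)

lemma M_le_1D: "M t \<le> 1 \<Longrightarrow> t \<le> 1"
  using M_ge_self[of t] by linarith

lemma unit_seq_spc: "unit_seq j \<in> spc" "nrm (unit_seq j) = 1"
proof -
  have "modular_le (unit_seq j) 1"
    unfolding modular_le_def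
  proof (intro allI impI)
    fix E :: "nat set" assume E: "finite E"
    have "(\<Sum>i\<in>E. M (\<bar>unit_seq j i\<bar> / 1)) = (\<Sum>i\<in>E. if i = j then 1 else 0)"
      by (rule sum.cong) (auto simp: unit_seq_def)
    then show "(\<Sum>i\<in>E. M (\<bar>unit_seq j i\<bar> / 1)) \<le> 1" using E by simp
  qed
  from spc_nrm_leI[OF this] show s: "unit_seq j \<in> spc" and "nrm (unit_seq j) = 1"
    using abs_coordinate_le[of "unit_seq j" j] by (auto simp: unit_seq_def)
qed

lemma restr_spc [simp]: "finite J \<Longrightarrow> restr J v \<in> spc"
  using unit_seq_spc by (simp flip: sum_unit_seq)

lemma modular_le_restrI:
  assumes "finite J" "(\<Sum>i\<in>J. M (\<bar>v i\<bar> / t)) \<le> 1" "0 < t"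
  shows "modular_le (restr J v) t"
  unfolding modular_le_def
proof (intro allI impI)
  fix E :: "nat set" assume E: "finite E"
  have "(\<Sum>i\<in>E. M (\<bar>restr J v i\<bar> / t)) = (\<Sum>i\<in>E. if i \<in> J then M (\<bar>v i\<bar> / t) else 0)"
    by (rule sum.cong) (auto simp: restr_def)
  also have "\<dots> = (\<Sum>i\<in>E \<inter> J. M (\<bar>v i\<bar> / t))" using E by (simp add: sum.inter_restrict)
  also have "\<dots> \<le> (\<Sum>i\<in>J. M (\<bar>v i\<bar> / t))"
    using assms by (intro sum_mono2) (auto intro!: M_nonneg)
  finally show "(\<Sum>i\<in>E. M (\<bar>restr J v i\<bar> / t)) \<le> 1" using assms by simp
qed

lemma modular_le_restrD:
  assumes "modular_le (restr J v) t" "finite E" "E \<subseteq> J"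
  shows "(\<Sum>i\<in>E. M (\<bar>v i\<bar> / t)) \<le> 1"
proof -
  have "(\<Sum>i\<in>E. M (\<bar>v i\<bar> / t)) = (\<Sum>i\<in>E. M (\<bar>restr J v i\<bar> / t))"
    using assms(3) by (intro sum.cong) (auto simp: restr_def)
  then show ?thesis using modular_leD[OF assms(1,2)] by simp
qed

lemma sign_avg_jensen:
  assumes "finite S" "\<And>\<theta>. 0 \<le> f \<theta>"
  shows "M (sign_avg S f) \<le> sign_avg S (\<lambda>\<theta>. M (f \<theta>))"
proof -
  let ?w = "inverse (2 ^ card S) :: real"
  have "M (\<Sum>A\<in>Pow S. ?w *\<^sub>R f (signs_of A)) \<le> (\<Sum>A\<in>Pow S. ?w * M (f (signs_of A)))"
    using assms by (intro convex_on_sum[OF _ _ M_convex]) (auto simp: card_Pow)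
  then show ?thesis by (simp add: sign_avg_def scaleR_sum_right sum_distrib_left)
qed

text \<open>By diagonal extraction \<open>\<bar>z n\<bar>\<close> is at most the mean modulus of the
  sign sum; Jensen's inequality moves \<open>M\<close> inside the average.\<close>

lemma M_coordinate_le_sign_avg:
  assumes "finite S" "n \<in> S" "0 < r"
  shows "M (\<bar>z n\<bar> / r) \<le> sign_avg S (\<lambda>\<theta>. M (\<bar>\<Sum>i\<in>S. \<theta> i * z i\<bar> / r))"
proof -
  let ?f = "\<lambda>\<theta>. \<bar>\<Sum>i\<in>S. \<theta> i * z i\<bar> / r"
  have sgn: "signs_of A n * y \<le> \<bar>y\<bar>" "- (signs_of A n * y) \<le> \<bar>y\<bar>" for A and y :: real
    by (auto simp: signs_of_def abs_if)
  have "z n \<le> sign_avg S (\<lambda>\<theta>. \<bar>\<Sum>i\<in>S. \<theta> i * z i\<bar>)"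
    unfolding sign_avg_coordinate[OF assms(1,2), of z, symmetric]
    by (rule sign_avg_mono) (rule sgn)
  moreover have "- z n \<le> sign_avg S (\<lambda>\<theta>. \<bar>\<Sum>i\<in>S. \<theta> i * z i\<bar>)"
  proof -
    have "- z n = sign_avg S (\<lambda>\<theta>. - 1 * (\<theta> n * (\<Sum>i\<in>S. \<theta> i * z i)))"
      by (simp only: sign_avg_cmult sign_avg_coordinate[OF assms(1,2)])
    also have "\<dots> \<le> sign_avg S (\<lambda>\<theta>. \<bar>\<Sum>i\<in>S. \<theta> i * z i\<bar>)"
      by (rule sign_avg_mono) (use sgn in simp)
    finally show ?thesis .
  qed
  ultimately have "\<bar>z n\<bar> \<le> sign_avg S (\<lambda>\<theta>. \<bar>\<Sum>i\<in>S. \<theta> i * z i\<bar>)" by simp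
  then have "\<bar>z n\<bar> / r \<le> sign_avg S ?f"
    using assms(3) sign_avg_cmult[of S "inverse r" "\<lambda>\<theta>. \<bar>\<Sum>i\<in>S. \<theta> i * z i\<bar>"]
    by (simp add: field_simps)
  then have "M (\<bar>z n\<bar> / r) \<le> M (sign_avg S ?f)" using assms by (intro M_mono) auto
  also have "\<dots> \<le> sign_avg S (\<lambda>\<theta>. M (?f \<theta>))" using assms by (intro sign_avg_jensen) auto
  finally show ?thesis .
qed

text \<open>Below the norm the modular exceeds 1, and it grows at least linearly as the scale
  shrinks further. The summand \<open>- 1\<close> makes the bound trivial when
  \<open>r \<le> t\<close>.\<close>

lemma modular_ge:
  assumes a: "a \<in> spc" and r: "r < nrm a" and t: "0 < t"
  shows "\<exists>I. finite I \<and> r / t - 1 \<le> (\<Sum>i\<in>I. M (\<bar>a i\<bar> / t))"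
proof (cases "r \<le> t")
  case True
  then show ?thesis using t by (intro exI[of _ "{}"]) auto
next
  case False
  then have "\<not> modular_le a r" using nrm_le[of a r] r t by auto
  then obtain I where I: "finite I" "1 < (\<Sum>i\<in>I. M (\<bar>a i\<bar> / r))"
    by (auto simp: modular_le_def not_le)
  have "r / t * 1 \<le> r / t * (\<Sum>i\<in>I. M (\<bar>a i\<bar> / r))"
    using I(2) False t by (intro mult_left_mono) auto
  also have "\<dots> \<le> (\<Sum>i\<in>I. M (r / t * (\<bar>a i\<bar> / r)))"
    unfolding sum_distrib_left using False t by (intro sum_mono M_scale_ge) auto
  also have "\<dots> = (\<Sum>i\<in>I. M (\<bar>a i\<bar> / t))" using False t by simp
  finally show ?thesis using I(1) by (intro exI[of _ I]) auto
qed

text \<open>Pointwise, the norm is at most \<open>t\<close> times one plus the modular at scale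
  \<open>t\<close>; averaging converts a bound on the mean modular into one on the mean norm. The
  slack \<open>e\<close> appears because \<open>modular_ge\<close> needs a number strictly below the
  norm.\<close>

lemma sign_avg_nrm_le:
  assumes S: "finite S" and W: "\<And>A. A \<subseteq> S \<Longrightarrow> W (signs_of A) \<in> spc" and t: "0 < t"
    and s: "\<And>I. finite I \<Longrightarrow> sign_avg S (\<lambda>\<theta>. \<Sum>i\<in>I. M (\<bar>W \<theta> i\<bar> / t)) \<le> s"
  shows "sign_avg S (\<lambda>\<theta>. nrm (W \<theta>)) \<le> t * (1 + s)"
proof (rule field_le_epsilon)
  fix e :: real assume e: "0 < e"
  have "\<forall>A\<in>Pow S. \<exists>I. finite I
      \<and> (nrm (W (signs_of A)) - e) / t - 1 \<le> (\<Sum>i\<in>I. M (\<bar>W (signs_of A) i\<bar> / t))"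
    using W t e by (intro ballI modular_ge) auto
  then obtain I where I: "\<And>A. A \<subseteq> S \<Longrightarrow> finite (I A)"
      "\<And>A. A \<subseteq> S \<Longrightarrow> (nrm (W (signs_of A)) - e) / t - 1 \<le> (\<Sum>i\<in>I A. M (\<bar>W (signs_of A) i\<bar> / t))"
    unfolding bchoice_iff by auto
  define U where "U = (\<Union>A\<in>Pow S. I A)"
  have U: "finite U" using S I by (auto simp: U_def)
  have "nrm (W (signs_of A)) \<le> t * (\<Sum>i\<in>U. M (\<bar>W (signs_of A) i\<bar> / t)) + (t + e)" if A: "A \<subseteq> S" for A
  proof -
    have "(\<Sum>i\<in>I A. M (\<bar>W (signs_of A) i\<bar> / t)) \<le> (\<Sum>i\<in>U. M (\<bar>W (signs_of A) i\<bar> / t))"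
      using U A t by (intro sum_mono2) (auto simp: U_def intro!: M_nonneg)
    then have "(nrm (W (signs_of A)) - e) / t \<le> (\<Sum>i\<in>U. M (\<bar>W (signs_of A) i\<bar> / t)) + 1"
      using I(2)[OF A] by linarith
    then show ?thesis using t by (simp add: pos_divide_le_eq algebra_simps)
  qed
  then have "sign_avg S (\<lambda>\<theta>. nrm (W \<theta>))
      \<le> sign_avg S (\<lambda>\<theta>. t * (\<Sum>i\<in>U. M (\<bar>W \<theta> i\<bar> / t)) + (t + e))"
    by (rule sign_avg_mono)
  also have "\<dots> = t * sign_avg S (\<lambda>\<theta>. \<Sum>i\<in>U. M (\<bar>W \<theta> i\<bar> / t)) + (t + e)"
    by (simp only: sign_avg_add sign_avg_cmult sign_avg_const[OF S])
  also have "\<dots> \<le> t * s + (t + e)"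
    using t s[OF U] by simp
  finally show "sign_avg S (\<lambda>\<theta>. nrm (W \<theta>)) \<le> t * (1 + s) + e" by (simp add: algebra_simps)
qed

end

section \<open>The doubling condition and the greedy basis of unit vectors\<close>

locale orlicz_delta2 = orlicz +
  fixes D :: real
  assumes delta2: "0 \<le> t \<Longrightarrow> t \<le> 1 \<Longrightarrow> M (2 * t) \<le> D * M t"
begin

lemma D_ge_1: "1 \<le> D"
  using delta2[of 1] M_ge_self[of 2] by simp

text \<open>Halving the scale preserves summability: eventually the terms are below 1, where the
  doubling condition applies. Iteration reaches every scale.\<close>

lemma summable_M:
  assumes v: "v \<in> spc" and e: "0 < e"
  shows "summable (\<lambda>n. M (\<bar>v n\<bar> / e))"
proof -
  obtain t where t: "0 < t" and s: "summable (\<lambda>n. M (\<bar>v n\<bar> / t))"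
    using v by (auto simp: orlicz_space_def)
  have half: "summable (\<lambda>n. M (\<bar>v n\<bar> / (s / 2)))"
    if s: "0 < s" "summable (\<lambda>n. M (\<bar>v n\<bar> / s))" for s
  proof (rule summable_comparison_test_ev)
    have "\<forall>\<^sub>F n in sequentially. M (\<bar>v n\<bar> / s) < 1"
      using order_tendstoD(2)[OF summable_LIMSEQ_zero[OF s(2)], of 1] by simp
    then show "\<forall>\<^sub>F n in sequentially. norm (M (\<bar>v n\<bar> / (s / 2))) \<le> D * M (\<bar>v n\<bar> / s)"
    proof eventually_elim
      case (elim n)
      then have "\<bar>v n\<bar> / s \<le> 1" by (simp add: M_le_1D)
      then have "M (2 * (\<bar>v n\<bar> / s)) \<le> D * M (\<bar>v n\<bar> / s)" using s by (intro delta2) auto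
      moreover have "\<bar>v n\<bar> / (s / 2) = 2 * (\<bar>v n\<bar> / s)" by simp
      ultimately show ?case using s(1) M_nonneg[of "2 * (\<bar>v n\<bar> / s)"]
        by (simp only: real_norm_def abs_of_nonneg) (simp add: zero_le_divide_iff)
    qed
    show "summable (\<lambda>n. D * M (\<bar>v n\<bar> / s))" using s by (intro summable_mult)
  qed
  have pow: "summable (\<lambda>n. M (\<bar>v n\<bar> / (t / 2 ^ k)))" for k
  proof (induction k)
    case (Suc k)
    moreover have "t / 2 ^ Suc k = t / 2 ^ k / 2" by simp
    ultimately show ?case using half[of "t / 2 ^ k"] t by (simp only:) simp
  qed (use s in simp)
  obtain k where "t / e < 2 ^ k" using real_arch_pow[of 2 "t / e"] by auto
  then have k: "t / 2 ^ k \<le> e" using e by (simp add: field_simps)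
  show ?thesis
  proof (rule summable_comparison_test[OF _ pow[of k]], intro exI allI impI)
    fix n
    have "M (\<bar>v n\<bar> / e) \<le> M (\<bar>v n\<bar> / (t / 2 ^ k))"
      using k t e by (intro M_mono divide_left_mono) auto
    then show "norm (M (\<bar>v n\<bar> / e)) \<le> M (\<bar>v n\<bar> / (t / 2 ^ k))"
      using M_nonneg[of "\<bar>v n\<bar> / e"] e by simp
  qed
qed

lemma tail_modular_le:
  assumes v: "v \<in> spc" and e: "0 < e"
  shows "\<exists>N. \<forall>m\<ge>N. modular_le (restr {m..} v) e"
proof -
  let ?f = "\<lambda>n. M (\<bar>v n\<bar> / e)"
  have s: "summable ?f" using v e by (rule summable_M)
  have nn: "0 \<le> ?f n" for n using e by (intro M_nonneg) auto
  have "(\<lambda>n. \<Sum>i<n. ?f i) \<longlonglongrightarrow> suminf ?f" using s by (rule summable_LIMSEQ)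
  then have "\<forall>\<^sub>F n in sequentially. suminf ?f - 1 < (\<Sum>i<n. ?f i)"
    by (rule order_tendstoD) simp
  then obtain N where N: "\<And>n. N \<le> n \<Longrightarrow> suminf ?f - 1 < (\<Sum>i<n. ?f i)"
    by (auto simp: eventually_sequentially)
  have "modular_le (restr {m..} v) e" if m: "N \<le> m" for m
    unfolding modular_le_def
  proof (intro allI impI)
    fix E :: "nat set" assume E: "finite E"
    have "(\<Sum>i\<in>E. M (\<bar>restr {m..} v i\<bar> / e)) = (\<Sum>i\<in>E. if i \<in> {m..} then ?f i else 0)"
      by (rule sum.cong) (auto simp: restr_def)
    also have "\<dots> = (\<Sum>i\<in>E \<inter> {m..}. ?f i)" using E by (simp add: sum.inter_restrict)
    also have "\<dots> \<le> 1"
    proof -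
      have "(\<Sum>i\<in>(E \<inter> {m..}) \<union> {..<m}. ?f i) \<le> suminf ?f"
        using E s nn by (intro sum_le_suminf) auto
      moreover have "(\<Sum>i\<in>(E \<inter> {m..}) \<union> {..<m}. ?f i) = (\<Sum>i\<in>E \<inter> {m..}. ?f i) + (\<Sum>i<m. ?f i)"
        using E by (intro sum.union_disjoint) auto
      ultimately show ?thesis using N[OF m] by linarith
    qed
    finally show "(\<Sum>i\<in>E. M (\<bar>restr {m..} v i\<bar> / e)) \<le> 1" .
  qed
  then show ?thesis by blast
qed

lemma expansion_unit_seq:
  assumes v: "v \<in> spc"
  shows "expansion nrm unit_seq v v"
  unfolding expansion_def
proof (rule LIMSEQ_I)
  fix r :: real assume r: "0 < r"
  obtain N where N: "\<And>m. N \<le> m \<Longrightarrow> modular_le (restr {m..} v) (r / 2)"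
    using tail_modular_le[OF v, of "r / 2"] r by auto
  have "norm (nrm (v - (\<Sum>n<m. v n *\<^sub>R unit_seq n)) - 0) < r" if "N \<le> m" for m
  proof -
    have "v - (\<Sum>n<m. v n *\<^sub>R unit_seq n) = restr {m..} v"
      by (auto simp: sum_unit_seq restr_def fun_eq_iff)
    then show ?thesis
      using spc_nrm_leI[OF N[OF that]] nrm_nonneg[of "restr {m..} v"] r by simp
  qed
  then show "\<exists>N. \<forall>m\<ge>N. norm (nrm (v - (\<Sum>n<m. v n *\<^sub>R unit_seq n)) - 0) < r" by blast
qed

lemma expansion_unit_seq_unique:
  assumes v: "v \<in> spc" and a: "expansion nrm unit_seq v a"
  shows "a = v"
proof
  fix n
  have "(\<lambda>N. nrm (v - (\<Sum>n<N. a n *\<^sub>R unit_seq n))) \<longlonglongrightarrow> 0" using a by (simp add: expansion_def)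
  moreover have "\<bar>v n - a n\<bar> \<le> nrm (v - (\<Sum>n<N. a n *\<^sub>R unit_seq n))" if "Suc n \<le> N" for N
  proof -
    have "v - (\<Sum>n<N. a n *\<^sub>R unit_seq n) \<in> spc" using v by (auto simp: sum_unit_seq)
    from abs_coordinate_le[OF this, of n] show ?thesis
      using that by (simp add: sum_unit_seq restr_def)
  qed
  ultimately have "\<bar>v n - a n\<bar> \<le> 0"
    by (intro LIMSEQ_le_const) blast+
  then show "a n = v n" by simp
qed

lemma schauder_unit_seq: "schauder_basis spc nrm unit_seq"
  unfolding schauder_basis_def
proof (intro conjI allI ballI unit_seq_spc)
  fix v assume "v \<in> spc"
  then show "\<exists>!a. expansion nrm unit_seq v a"
    by (intro ex1I[of _ v] expansion_unit_seq expansion_unit_seq_unique)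
qed

sublocale unit: schauder_carrier spc nrm unit_seq
  by unfold_locales (rule schauder_unit_seq)

lemma coord_unit_seq: "v \<in> spc \<Longrightarrow> coord nrm unit_seq n v = v n"
  by (rule unit.coord_eqI[OF _ expansion_unit_seq])

text \<open>The modular is invariant under rearrangement, so the coordinates in
  \<open>A - \<Lambda>\<close> may be exchanged for the larger ones in \<open>\<Lambda> - A\<close>,
  where \<open>v - restr A \<alpha>\<close> still agrees with \<open>v\<close>. This yields greedy
  constant 1.\<close>

lemma nrm_greedy_unit_seq_le:
  assumes v: "v \<in> spc" and L: "finite \<Lambda>" and A: "finite A" "card A = card \<Lambda>"
    and gr: "\<And>n k. n \<in> \<Lambda> \<Longrightarrow> k \<notin> \<Lambda> \<Longrightarrow> \<bar>v k\<bar> \<le> \<bar>v n\<bar>"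
  shows "nrm (restr (- \<Lambda>) v) \<le> nrm (v - restr A \<alpha>)"
proof -
  let ?w = "v - restr A \<alpha>"
  have w: "?w \<in> spc" using v A by auto
  have "modular_le (restr (- \<Lambda>) v) t" if t: "nrm ?w < t" "0 < t" for t
    unfolding modular_le_def
  proof (intro allI impI)
    fix E :: "nat set" assume E: "finite E"
    let ?f = "\<lambda>i. M (\<bar>v i\<bar> / t)"
    have nn: "0 \<le> ?f i" for i using t by (intro M_nonneg) auto
    have "(\<Sum>i\<in>E. M (\<bar>restr (- \<Lambda>) v i\<bar> / t)) = (\<Sum>i\<in>E. if i \<in> - \<Lambda> then ?f i else 0)"
      by (rule sum.cong) (auto simp: restr_def)
    also have "\<dots> = (\<Sum>i\<in>E \<inter> - \<Lambda>. ?f i)" using E by (simp add: sum.inter_restrict)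
    also have "\<dots> \<le> (\<Sum>i\<in>(E - (A \<union> \<Lambda>)) \<union> (A - \<Lambda>). ?f i)"
      using E A nn by (intro sum_mono2) auto
    also have "\<dots> = (\<Sum>i\<in>E - (A \<union> \<Lambda>). ?f i) + (\<Sum>i\<in>A - \<Lambda>. ?f i)"
      using E A by (intro sum.union_disjoint) auto
    also have "(\<Sum>i\<in>A - \<Lambda>. ?f i) \<le> (\<Sum>i\<in>\<Lambda> - A. ?f i)"
    proof -
      have "card (A - \<Lambda>) = card (\<Lambda> - A)"
        using A L by (simp add: card_Diff_subset_Int Int_commute)
      then obtain h where h: "bij_betw h (A - \<Lambda>) (\<Lambda> - A)"
        using A L by (meson finite_Diff finite_same_card_bij)
      have "(\<Sum>i\<in>A - \<Lambda>. ?f i) \<le> (\<Sum>i\<in>A - \<Lambda>. ?f (h i))"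
      proof (rule sum_mono)
        fix i assume i: "i \<in> A - \<Lambda>"
        then have "h i \<in> \<Lambda>" using h by (auto simp: bij_betw_def)
        then show "?f i \<le> ?f (h i)"
          using gr[of "h i" i] i t by (intro M_mono) (auto intro!: divide_right_mono)
      qed
      also have "\<dots> = (\<Sum>i\<in>\<Lambda> - A. ?f i)" using h by (rule sum.reindex_bij_betw)
      finally show ?thesis .
    qed
    also have "(\<Sum>i\<in>E - (A \<union> \<Lambda>). ?f i) + (\<Sum>i\<in>\<Lambda> - A. ?f i) = (\<Sum>i\<in>(E - (A \<union> \<Lambda>)) \<union> (\<Lambda> - A). ?f i)"
      using E L by (intro sum.union_disjoint[symmetric]) auto
    also have "\<dots> = (\<Sum>i\<in>(E - (A \<union> \<Lambda>)) \<union> (\<Lambda> - A). M (\<bar>?w i\<bar> / t))"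
      by (rule sum.cong) (auto simp: restr_def)
    also have "\<dots> \<le> 1"
      by (rule modular_leD[OF modular_le_nrm[OF w]]) (use E L t in auto)
    finally show "(\<Sum>i\<in>E. M (\<bar>restr (- \<Lambda>) v i\<bar> / t)) \<le> 1" by simp
  qed
  from nrm_le_lim(2)[OF this nrm_nonneg[OF w]] show ?thesis by simp
qed

lemma greedy_unit_seq: "greedy_basis spc nrm unit_seq"
  unfolding greedy_basis_def
proof (intro conjI schauder_unit_seq exI[of _ 1] ballI allI impI)
  fix v N \<Lambda> assume v: "v \<in> spc"
  assume "finite \<Lambda> \<and> card \<Lambda> = N
    \<and> (\<forall>n\<in>\<Lambda>. \<forall>k. k \<notin> \<Lambda> \<longrightarrow> \<bar>coord nrm unit_seq k v\<bar> \<le> \<bar>coord nrm unit_seq n v\<bar>)"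
  then have L: "finite \<Lambda>" "card \<Lambda> = N" and gr: "\<And>n k. n \<in> \<Lambda> \<Longrightarrow> k \<notin> \<Lambda> \<Longrightarrow> \<bar>v k\<bar> \<le> \<bar>v n\<bar>"
    using v by (auto simp: coord_unit_seq)
  have "v - (\<Sum>n\<in>\<Lambda>. coord nrm unit_seq n v *\<^sub>R unit_seq n) = restr (- \<Lambda>) v"
    using v L by (auto simp: coord_unit_seq sum_unit_seq restr_def fun_eq_iff)
  moreover have "nrm (restr (- \<Lambda>) v) \<le> best_approx_error nrm unit_seq N v"
    unfolding best_approx_error_def
  proof (rule cInf_greatest)
    show "{nrm (v - (\<Sum>n\<in>A. \<alpha> n *\<^sub>R unit_seq n)) |A \<alpha>. finite A \<and> card A = N} \<noteq> {}"
      using L by blast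
    fix r assume "r \<in> {nrm (v - (\<Sum>n\<in>A. \<alpha> n *\<^sub>R unit_seq n)) |A \<alpha>. finite A \<and> card A = N}"
    then obtain A \<alpha> where r: "r = nrm (v - (\<Sum>n\<in>A. \<alpha> n *\<^sub>R unit_seq n))" "finite A" "card A = N"
      by blast
    show "nrm (restr (- \<Lambda>) v) \<le> r"
      unfolding r(1) sum_unit_seq[OF r(2)]
      using r L gr by (intro nrm_greedy_unit_seq_le v) auto
  qed
  ultimately show "nrm (v - (\<Sum>n\<in>\<Lambda>. coord nrm unit_seq n v *\<^sub>R unit_seq n))
      \<le> 1 * best_approx_error nrm unit_seq N v" by simp
qed

lemma semi_normalized_unit_seq: "semi_normalized nrm unit_seq"
  unfolding semi_normalized_def using unit_seq_spc by (intro exI[of _ 1]) auto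

end

section \<open>Unconditional biorthogonal systems\<close>

text \<open>The matrix \<open>x\<close> lists the basis vectors and \<open>b\<close> the values \<open>b n j\<close> of the \<open>n\<close>-th
  biorthogonal functional at the \<open>j\<close>-th unit vector, so that a system can be transposed to the
  dual space without mentioning functionals.\<close>

locale uncond_system = orlicz M for M +
  fixes x b :: "nat \<Rightarrow> nat \<Rightarrow> real" and K :: real
  assumes K_ge_1: "1 \<le> K"
    and x_spc [simp, intro]: "x n \<in> orlicz_space M"
    and nrm_x: "orlicz_norm M (x n) \<le> K"
    and multiplier: "finite E \<Longrightarrow> (\<And>n. n \<in> E \<Longrightarrow> \<bar>\<theta> n\<bar> \<le> 1) \<Longrightarrow>
      orlicz_norm M (\<Sum>n\<in>E. (\<theta> n * c n) *\<^sub>R x n) \<le> K * orlicz_norm M (\<Sum>n\<in>E. c n *\<^sub>R x n)"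
    and multiplier_operator: "finite E \<Longrightarrow> finite J \<Longrightarrow> (\<And>n. n \<in> E \<Longrightarrow> \<bar>\<theta> n\<bar> \<le> 1) \<Longrightarrow>
      orlicz_norm M (\<Sum>n\<in>E. (\<theta> n * (\<Sum>j\<in>J. b n j * v j)) *\<^sub>R x n) \<le> K * orlicz_norm M (restr J v)"
    and functional_le: "finite J \<Longrightarrow> \<bar>\<Sum>j\<in>J. b n j * v j\<bar> \<le> K * orlicz_norm M (restr J v)"
    and biorthogonal: "(\<lambda>j. b m j * x n j) sums of_bool (m = n)"
    and complete: "(\<lambda>n. x n j * b n j) sums 1"
begin

lemma x_sum_spc: "(\<Sum>n\<in>E. c n *\<^sub>R x n) \<in> spc"
  by auto

lemma abs_x_le: "\<bar>x n j\<bar> \<le> K"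
  using abs_coordinate_le[OF x_spc] nrm_x order_trans by blast

lemma restr_singleton: "restr {j} (\<lambda>_. 1) = unit_seq j"
  by (auto simp: restr_def unit_seq_def)

lemma abs_b_le: "\<bar>b n j\<bar> \<le> K"
  using functional_le[of "{j}" n "\<lambda>_. 1"] by (simp add: restr_singleton unit_seq_spc)

text \<open>The multiplier operator is applied to the unit vector at \<open>j\<close>, with signs
  that make all diagonal products nonnegative, and coordinate \<open>j\<close> of the result is read
  off.\<close>

lemma sum_abs_diagonal_le:
  assumes "finite E"
  shows "(\<Sum>n\<in>E. \<bar>x n j * b n j\<bar>) \<le> K"
proof -
  define \<theta> where "\<theta> n = sgn (x n j * b n j)" for n
  let ?w = "\<Sum>n\<in>E. (\<theta> n * (\<Sum>i\<in>{j}. b n i * 1)) *\<^sub>R x n"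
  have "(\<Sum>n\<in>E. \<bar>x n j * b n j\<bar>) = ?w j"
    unfolding sum_fun_apply scaleR_fun_apply
  proof (rule sum.cong)
    fix n
    have "\<bar>x n j * b n j\<bar> = \<theta> n * (x n j * b n j)"
      unfolding \<theta>_def by (metis abs_sgn mult.commute)
    then show "\<bar>x n j * b n j\<bar> = (\<theta> n * (\<Sum>i\<in>{j}. b n i * 1)) *\<^sub>R x n j" by (simp add: mult_ac)
  qed simp
  also have "\<dots> \<le> nrm ?w" using abs_coordinate_le[of ?w j] by fastforce
  also have "\<dots> \<le> K * nrm (restr {j} (\<lambda>_. 1))"
    by (intro multiplier_operator assms) (auto simp: \<theta>_def abs_sgn_eq)
  finally show ?thesis by (simp add: restr_singleton unit_seq_spc)
qed

section \<open>Systems with a large diagonal entry in every row\<close>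

context
  fixes \<delta> :: real and h :: "nat \<Rightarrow> nat"
  assumes \<delta>: "0 < \<delta>" and h: "\<And>n. \<delta> \<le> \<bar>x n (h n) * b n (h n)\<bar>"
begin

lemma large_entries: "\<delta> / K \<le> \<bar>x n (h n)\<bar>" "\<delta> / K \<le> \<bar>b n (h n)\<bar>"
proof -
  have "\<delta> \<le> \<bar>x n (h n)\<bar> * \<bar>b n (h n)\<bar>" using h by (simp add: abs_mult)
  moreover have "\<bar>x n (h n)\<bar> * \<bar>b n (h n)\<bar> \<le> \<bar>x n (h n)\<bar> * K"
    by (intro mult_left_mono abs_b_le) auto
  moreover have "\<bar>x n (h n)\<bar> * \<bar>b n (h n)\<bar> \<le> K * \<bar>b n (h n)\<bar>"
    by (intro mult_right_mono abs_x_le) auto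
  ultimately show "\<delta> / K \<le> \<bar>x n (h n)\<bar>" "\<delta> / K \<le> \<bar>b n (h n)\<bar>"
    using K_ge_1 by (simp_all add: field_simps)
qed

lemma card_fiber_le:
  assumes "finite E"
  shows "real (card {n\<in>E. h n = j}) \<le> K / \<delta>"
proof -
  have "real (card {n\<in>E. h n = j}) * \<delta> = (\<Sum>n\<in>{n\<in>E. h n = j}. \<delta>)" by simp
  also have "\<dots> \<le> (\<Sum>n\<in>{n\<in>E. h n = j}. \<bar>x n j * b n j\<bar>)"
    using h by (intro sum_mono) auto
  also have "\<dots> \<le> K" using assms by (intro sum_abs_diagonal_le) auto
  finally show ?thesis using \<delta> by (simp add: field_simps)
qed

text \<open>After averaging over signs, \<open>c n\<close> is detected in column \<open>h n\<close>,
  where \<open>x n\<close> has modulus at least \<open>\<delta> / K\<close>. A column is chosen by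
  at most \<open>m\<close> rows, and this multiplicity is absorbed by
  \<open>m * M s \<le> M (m * s)\<close>.\<close>

lemma unit_seq_dominated:
  assumes E: "finite E"
  shows "nrm (restr E c) \<le> K * ((K / \<delta> + 1) * (K / \<delta>)) * nrm (\<Sum>n\<in>E. c n *\<^sub>R x n)"
proof -
  define m where "m = K / \<delta> + 1"
  define R where "R = K * nrm (\<Sum>n\<in>E. c n *\<^sub>R x n)"
  have m: "1 \<le> m" using \<delta> K_ge_1 by (simp add: m_def)
  have R0: "0 \<le> R" using K_ge_1 nrm_nonneg[OF x_sum_spc] by (simp add: R_def)
  have "modular_le (restr E c) t" if t: "R * (m * (K / \<delta>)) < t" "0 < t" for t
  proof (rule modular_le_restrI[OF E _ t(2)])
    define l where "l = t / (m * (K / \<delta>))"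
    have pos: "0 < m * (K / \<delta>)" using m \<delta> K_ge_1 by auto
    have l: "R < l" "0 < l" unfolding l_def using t pos by (simp_all only: pos_less_divide_eq divide_pos_pos)
    define S where "S \<theta> = (\<Sum>n\<in>E. (\<theta> n * c n) *\<^sub>R x n)" for \<theta> :: "nat \<Rightarrow> real"
    have S: "(\<Sum>j\<in>h ` E. M (\<bar>S (signs_of A) j\<bar> / l)) \<le> 1" for A
    proof (rule modular_leD[OF modular_le_nrm[of "S (signs_of A)"]])
      show "S (signs_of A) \<in> spc" unfolding S_def by (rule x_sum_spc)
      have "nrm (S (signs_of A)) \<le> R"
        unfolding S_def R_def using E by (intro multiplier) auto
      then show "nrm (S (signs_of A)) \<le> l" using l by simp
    qed (use l E in auto)
    have "(\<Sum>n\<in>E. M (m * (\<bar>c n\<bar> / t))) \<le> (\<Sum>n\<in>E. M (\<bar>c n * x n (h n)\<bar> / l))"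
    proof (intro sum_mono M_mono)
      fix n
      have "\<bar>c n\<bar> * (\<delta> / K) / l \<le> \<bar>c n\<bar> * \<bar>x n (h n)\<bar> / l"
        using l large_entries by (intro divide_right_mono mult_left_mono) auto
      moreover have "\<bar>c n\<bar> * (\<delta> / K) / l = m * (\<bar>c n\<bar> / t)"
        using K_ge_1 \<delta> m t by (simp add: l_def field_simps)
      ultimately show "m * (\<bar>c n\<bar> / t) \<le> \<bar>c n * x n (h n)\<bar> / l" by (simp add: abs_mult)
    qed (use m t in auto)
    also have "\<dots> \<le> (\<Sum>n\<in>E. sign_avg E (\<lambda>\<theta>. M (\<bar>S \<theta> (h n)\<bar> / l)))"
      using M_coordinate_le_sign_avg[OF E _ l(2), of _ "\<lambda>n. c n * x n j" for j]
      by (intro sum_mono) (simp add: S_def mult.assoc)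
    also have "\<dots> = (\<Sum>j\<in>h ` E. \<Sum>n\<in>{n\<in>E. h n = j}. sign_avg E (\<lambda>\<theta>. M (\<bar>S \<theta> (h n)\<bar> / l)))"
      by (rule sum.image_gen[OF E])
    also have "\<dots> = (\<Sum>j\<in>h ` E. real (card {n\<in>E. h n = j}) * sign_avg E (\<lambda>\<theta>. M (\<bar>S \<theta> j\<bar> / l)))"
      by (intro sum.cong) auto
    also have "\<dots> \<le> (\<Sum>j\<in>h ` E. m * sign_avg E (\<lambda>\<theta>. M (\<bar>S \<theta> j\<bar> / l)))"
    proof (intro sum_mono mult_right_mono)
      show "real (card {n\<in>E. h n = j}) \<le> m" for j using card_fiber_le[OF E, of j] by (simp add: m_def)
      show "0 \<le> sign_avg E (\<lambda>\<theta>. M (\<bar>S \<theta> j\<bar> / l))" for j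
        using E l by (intro sign_avg_ge_const) (auto intro!: M_nonneg)
    qed
    also have "\<dots> = m * sign_avg E (\<lambda>\<theta>. \<Sum>j\<in>h ` E. M (\<bar>S \<theta> j\<bar> / l))"
      by (simp add: sign_avg_sum sum_distrib_left)
    also have "\<dots> \<le> m * 1"
      using m S by (intro mult_left_mono sign_avg_le_const E) auto
    finally have "(\<Sum>n\<in>E. M (m * (\<bar>c n\<bar> / t))) \<le> m" by simp
    moreover have "(\<Sum>n\<in>E. m * M (\<bar>c n\<bar> / t)) \<le> (\<Sum>n\<in>E. M (m * (\<bar>c n\<bar> / t)))"
      using m t by (intro sum_mono M_scale_ge) auto
    ultimately have "m * (\<Sum>n\<in>E. M (\<bar>c n\<bar> / t)) \<le> m * 1" by (simp add: sum_distrib_left)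
    then show "(\<Sum>n\<in>E. M (\<bar>c n\<bar> / t)) \<le> 1" using m by simp
  qed
  moreover have "0 \<le> R * (m * (K / \<delta>))" using R0 m \<delta> K_ge_1 by simp
  ultimately have "nrm (restr E c) \<le> R * (m * (K / \<delta>))" by (rule nrm_le_lim(2))
  then show ?thesis by (simp add: R_def m_def mult_ac)
qed

text \<open>Random signs on the columns extract the entries \<open>b n (h n)\<close> of the
  coefficient operator, and a multiplier then corrects them to the prescribed coefficients. Several
  rows may share a column, so the test vector \<open>d\<close> carries the largest coefficient of
  each fiber.\<close>

lemma dominated_by_unit_seq:
  assumes E: "finite E"
  shows "nrm (\<Sum>n\<in>E. c n *\<^sub>R x n) \<le> K / \<delta> * (K * K) * nrm (restr E c)"
proof -
  define J where "J = h ` E"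
  have J: "finite J" using E by (simp add: J_def)
  have "\<forall>j\<in>J. \<exists>k\<in>E. h k = j \<and> (\<forall>n\<in>E. h n = j \<longrightarrow> \<bar>c n\<bar> \<le> \<bar>c k\<bar>)"
  proof
    fix j assume "j \<in> J"
    then have "finite {n\<in>E. h n = j}" "{n\<in>E. h n = j} \<noteq> {}" using E by (auto simp: J_def)
    then obtain k where "k \<in> {n\<in>E. h n = j}" "\<forall>n\<in>{n\<in>E. h n = j}. \<bar>c n\<bar> \<le> \<bar>c k\<bar>"
      using ex_is_arg_min_if_finite[of "{n\<in>E. h n = j}" "\<lambda>n. - \<bar>c n\<bar>"]
      by (auto simp: is_arg_min_linorder)
    then show "\<exists>k\<in>E. h k = j \<and> (\<forall>n\<in>E. h n = j \<longrightarrow> \<bar>c n\<bar> \<le> \<bar>c k\<bar>)" by blast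
  qed
  then obtain k where "\<forall>j\<in>J. k j \<in> E \<and> h (k j) = j \<and> (\<forall>n\<in>E. h n = j \<longrightarrow> \<bar>c n\<bar> \<le> \<bar>c (k j)\<bar>)"
    unfolding Bex_def bchoice_iff ..
  then have k: "\<And>j. j \<in> J \<Longrightarrow> k j \<in> E" "\<And>j. j \<in> J \<Longrightarrow> h (k j) = j"
      "\<And>j n. j \<in> J \<Longrightarrow> n \<in> E \<Longrightarrow> h n = j \<Longrightarrow> \<bar>c n\<bar> \<le> \<bar>c (k j)\<bar>"
    by auto
  define d where "d j = \<bar>c (k j)\<bar>" for j
  have nd: "nrm (restr J d) \<le> nrm (restr E c)"
  proof -
    have inj: "inj_on k J" using k(2) by (rule inj_on_inverseI)
    have "modular_le (restr J d) t" if t: "nrm (restr E c) < t" "0 < t" for t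
    proof (rule modular_le_restrI[OF J _ t(2)])
      have "(\<Sum>i\<in>J. M (\<bar>d i\<bar> / t)) = (\<Sum>i\<in>k ` J. M (\<bar>c i\<bar> / t))"
        using inj by (simp add: sum.reindex d_def)
      also have "\<dots> \<le> 1"
        by (rule modular_le_restrD[OF modular_le_nrm[of "restr E c"]]) (use t E J k(1) in auto)
      finally show "(\<Sum>i\<in>J. M (\<bar>d i\<bar> / t)) \<le> 1" .
    qed
    moreover have "0 \<le> nrm (restr E c)" using E by (intro nrm_nonneg) simp
    ultimately show ?thesis by (rule nrm_le_lim(2))
  qed
  define W where "W \<epsilon> = (\<Sum>n\<in>E. (\<epsilon> (h n) * (\<Sum>j\<in>J. b n j * (\<epsilon> j * d j))) *\<^sub>R x n)" for \<epsilon> :: "nat \<Rightarrow> real"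
  have "sign_avg J W = (\<Sum>n\<in>E. (b n (h n) * d (h n)) *\<^sub>R x n)"
  proof -
    have "sign_avg J W = (\<Sum>n\<in>E. sign_avg J (\<lambda>\<epsilon>. \<epsilon> (h n) * (\<Sum>j\<in>J. b n j * (\<epsilon> j * d j))) *\<^sub>R x n)"
      unfolding W_def by (simp only: sign_avg_sum sign_avg_scaleR)
    also have "\<dots> = (\<Sum>n\<in>E. (b n (h n) * d (h n)) *\<^sub>R x n)"
    proof (rule sum.cong)
      fix n assume "n \<in> E"
      then have "h n \<in> J" by (simp add: J_def)
      from sign_avg_coordinate[OF J this, of "\<lambda>j. b n j * d j"]
      show "sign_avg J (\<lambda>\<epsilon>. \<epsilon> (h n) * (\<Sum>j\<in>J. b n j * (\<epsilon> j * d j))) *\<^sub>R x n = (b n (h n) * d (h n)) *\<^sub>R x n"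
        by (simp add: mult.left_commute)
    qed simp
    finally show ?thesis .
  qed
  moreover have "nrm (sign_avg J W) \<le> K * nrm (restr E c)"
  proof (rule p_sign_avg_le_const[OF J])
    fix A
    show "W (signs_of A) \<in> spc" by (auto simp: W_def)
    have "\<bar>restr J (\<lambda>j. signs_of A j * d j) i\<bar> \<le> \<bar>restr J d i\<bar>" for i
      by (simp add: restr_def signs_of_def)
    from dominated(2)[of "restr J d" "restr J (\<lambda>j. signs_of A j * d j)", OF restr_spc[OF J] this]
    have "nrm (restr J (\<lambda>j. signs_of A j * d j)) \<le> nrm (restr E c)" using nd by linarith
    then have "K * nrm (restr J (\<lambda>j. signs_of A j * d j)) \<le> K * nrm (restr E c)"
      using K_ge_1 by (intro mult_left_mono) auto
    moreover have "nrm (W (signs_of A)) \<le> K * nrm (restr J (\<lambda>j. signs_of A j * d j))"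
      unfolding W_def by (intro multiplier_operator E J) auto
    ultimately show "nrm (W (signs_of A)) \<le> K * nrm (restr E c)" by (rule order_trans[rotated])
  qed
  ultimately have 1: "nrm (\<Sum>n\<in>E. (b n (h n) * d (h n)) *\<^sub>R x n) \<le> K * nrm (restr E c)" by simp
  \<comment> \<open>The factor \<open>\<delta> / K\<close> makes this multiplier admissible, because
    \<open>\<bar>b n (h n)\<bar>\<close> is at least \<open>\<delta> / K\<close> and
    \<open>d (h n)\<close> dominates \<open>\<bar>c n\<bar>\<close>. If \<open>d (h n) = 0\<close>,
    then \<open>c n = 0\<close> and division by zero gives the right value 0.\<close>
  define \<theta> where "\<theta> n = \<delta> / K * (c n / (b n (h n) * d (h n)))" for n
  have q: "0 < \<delta> / K" using \<delta> K_ge_1 by simp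
  have "nrm (\<Sum>n\<in>E. (\<theta> n * (b n (h n) * d (h n))) *\<^sub>R x n)
      \<le> K * nrm (\<Sum>n\<in>E. (b n (h n) * d (h n)) *\<^sub>R x n)"
  proof (rule multiplier[OF E])
    fix n assume n: "n \<in> E"
    then have "\<bar>c n\<bar> \<le> d (h n)" using k(3)[of "h n" n] by (simp add: J_def d_def)
    then have "\<delta> / K * \<bar>c n\<bar> \<le> \<bar>b n (h n)\<bar> * d (h n)"
      using large_entries(2)[of n] q by (intro mult_mono) auto
    moreover have "0 \<le> d (h n)" by (simp add: d_def)
    ultimately have "(\<delta> / K * \<bar>c n\<bar>) / (\<bar>b n (h n)\<bar> * d (h n)) \<le> 1"
      by (intro divide_le_eq_1[THEN iffD2]) (auto simp: less_le)
    moreover have "\<bar>\<theta> n\<bar> = (\<delta> / K * \<bar>c n\<bar>) / (\<bar>b n (h n)\<bar> * d (h n))"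
      using \<delta> K_ge_1 by (simp add: \<theta>_def abs_mult d_def)
    ultimately show "\<bar>\<theta> n\<bar> \<le> 1" by simp
  qed
  also have "(\<Sum>n\<in>E. (\<theta> n * (b n (h n) * d (h n))) *\<^sub>R x n) = (\<delta> / K) *\<^sub>R (\<Sum>n\<in>E. c n *\<^sub>R x n)"
    unfolding scaleR_sum_right
  proof (rule sum.cong)
    fix n assume n: "n \<in> E"
    then have "\<bar>c n\<bar> \<le> d (h n)" using k(3)[of "h n" n] by (simp add: J_def d_def)
    moreover have "b n (h n) \<noteq> 0" using large_entries(2)[of n] q by auto
    ultimately have "\<theta> n * (b n (h n) * d (h n)) = \<delta> / K * c n"
      by (cases "d (h n) = 0") (auto simp: \<theta>_def)
    then show "(\<theta> n * (b n (h n) * d (h n))) *\<^sub>R x n = (\<delta> / K) *\<^sub>R c n *\<^sub>R x n" by simp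
  qed simp
  also have "nrm \<dots> = \<delta> / K * nrm (\<Sum>n\<in>E. c n *\<^sub>R x n)"
    using q by (simp only: scale_spc(2)[OF x_sum_spc] abs_of_pos)
  finally have "\<delta> / K * nrm (\<Sum>n\<in>E. c n *\<^sub>R x n) \<le> K * (K * nrm (restr E c))"
    using 1 K_ge_1 by (smt (verit) mult_left_mono)
  then show ?thesis using \<delta> K_ge_1 by (simp add: field_simps)
qed

end

lemma equivalent_unit_seq:
  assumes "0 < \<delta>" "\<And>n. \<exists>j. \<delta> \<le> \<bar>x n j * b n j\<bar>"
  shows "equivalent_bases nrm x unit_seq"
proof -
  obtain h where h: "\<And>n. \<delta> \<le> \<bar>x n (h n) * b n (h n)\<bar>" using assms(2) by metis
  define C where "C = max 1 (max (K * ((K / \<delta> + 1) * (K / \<delta>))) (K / \<delta> * (K * K)))"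
  have C: "1 \<le> C" "K * ((K / \<delta> + 1) * (K / \<delta>)) \<le> C" "K / \<delta> * (K * K) \<le> C"
    by (auto simp: C_def)
  show ?thesis
    unfolding equivalent_bases_def
  proof (intro exI[of _ C] conjI allI impI C(1))
    fix a :: "nat \<Rightarrow> real" assume a: "finite {n. a n \<noteq> 0}"
    let ?E = "{n. a n \<noteq> 0}"
    have nn: "0 \<le> nrm (\<Sum>n\<in>?E. a n *\<^sub>R x n)" "0 \<le> nrm (restr ?E a)"
      using a by (auto intro!: nrm_nonneg)
    have "nrm (\<Sum>n\<in>?E. a n *\<^sub>R x n) \<le> C * nrm (restr ?E a)"
      using dominated_by_unit_seq[OF assms(1) h a, of a] mult_right_mono[OF C(3) nn(2)] by linarith
    then show "inverse C * nrm (\<Sum>n | a n \<noteq> 0. a n *\<^sub>R x n) \<le> nrm (\<Sum>n | a n \<noteq> 0. a n *\<^sub>R unit_seq n)"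
      using C(1) by (simp add: sum_unit_seq[OF a] field_simps)
    show "nrm (\<Sum>n | a n \<noteq> 0. a n *\<^sub>R unit_seq n) \<le> C * nrm (\<Sum>n | a n \<noteq> 0. a n *\<^sub>R x n)"
      using unit_seq_dominated[OF assms(1) h a, of a] mult_right_mono[OF C(2) nn(1)]
      unfolding sum_unit_seq[OF a] by linarith
  qed
qed

end

section \<open>Greedy bases as unconditional systems\<close>

context orlicz_delta2
begin

lemma greedy_basis_uncond_system:
  assumes "greedy_basis spc nrm x" "semi_normalized nrm x"
  shows "\<exists>K. uncond_system M x (\<lambda>n j. coord nrm x n (unit_seq j)) K"
proof -
  interpret g: greedy_carrier spc nrm x
    by unfold_locales (use assms in \<open>auto simp: greedy_basis_def\<close>)
  obtain K where K: "1 \<le> K" and mult: "\<forall>v\<in>spc. \<forall>A \<theta>. finite A \<longrightarrow> (\<forall>n\<in>A. \<bar>\<theta> n\<bar> \<le> 1)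
     \<longrightarrow> nrm (\<Sum>n\<in>A. (\<theta> n * g.crd n v) *\<^sub>R x n) \<le> K * nrm v"
    using g.multiplier_unconditional by blast
  obtain c C where c: "0 < c" "\<And>n. c \<le> nrm (x n)" "\<And>n. nrm (x n) \<le> C"
    using assms(2) by (auto simp: semi_normalized_def)
  \<comment> \<open>A multiplier supported on one index bounds all coordinate functionals uniformly,
    because the basis vectors are bounded away from 0.\<close>
  have crd_le: "\<bar>g.crd n v\<bar> \<le> K / c * nrm v" if v: "v \<in> spc" for n v
  proof -
    have "\<bar>g.crd n v\<bar> * c \<le> \<bar>g.crd n v\<bar> * nrm (x n)" using c by (intro mult_left_mono) auto
    also have "\<dots> = nrm (\<Sum>m\<in>{n}. (1 * g.crd m v) *\<^sub>R x m)" by (simp add: scale_spc)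
    also have "\<dots> \<le> K * nrm v" using mult[rule_format, OF v, of "{n}" "\<lambda>_. 1"] by simp
    finally show ?thesis using c by (simp add: field_simps)
  qed
  have crd_restr: "g.crd n (restr J v) = (\<Sum>j\<in>J. g.crd n (unit_seq j) * v j)" if "finite J" for n J v
    using that unit_seq_spc by (simp add: g.coord_sum g.coord_scale mult.commute flip: sum_unit_seq)
  define L where "L = max K (max (K / c) C)"
  have L: "K \<le> L" "K / c \<le> L" "C \<le> L" by (auto simp: L_def)
  have LL: "r \<le> L * nrm v" if "r \<le> k * nrm v" "k \<le> L" "v \<in> spc" for r k v
    using that mult_right_mono[of k L "nrm v"] nrm_nonneg[of v] by linarith
  have "uncond_system M x (\<lambda>n j. g.crd n (unit_seq j)) L"
  proof unfold_locales
    show "1 \<le> L" using K L by simp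
    show "x n \<in> spc" "nrm (x n) \<le> L" for n using c(3)[of n] L by auto
    show "nrm (\<Sum>n\<in>E. (\<theta> n * f n) *\<^sub>R x n) \<le> L * nrm (\<Sum>n\<in>E. f n *\<^sub>R x n)"
      if E: "finite E" and \<theta>: "\<And>n. n \<in> E \<Longrightarrow> \<bar>\<theta> n\<bar> \<le> 1" for E and \<theta> f :: "nat \<Rightarrow> real"
    proof (rule LL[OF _ L(1)])
      let ?v = "\<Sum>n\<in>E. f n *\<^sub>R x n"
      show v: "?v \<in> spc" by auto
      have "(\<Sum>n\<in>E. (\<theta> n * g.crd n ?v) *\<^sub>R x n) = (\<Sum>n\<in>E. (\<theta> n * f n) *\<^sub>R x n)"
        using E by (intro sum.cong) (auto simp: g.coord_finite_sum)
      then show "nrm (\<Sum>n\<in>E. (\<theta> n * f n) *\<^sub>R x n) \<le> K * nrm ?v"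
        using mult[rule_format, OF v E, of \<theta>] \<theta> by simp
    qed
    show "nrm (\<Sum>n\<in>E. (\<theta> n * (\<Sum>j\<in>J. g.crd n (unit_seq j) * v j)) *\<^sub>R x n) \<le> L * nrm (restr J v)"
      if "finite E" "finite J" "\<And>n. n \<in> E \<Longrightarrow> \<bar>\<theta> n\<bar> \<le> 1" for E J and \<theta> v :: "nat \<Rightarrow> real"
      using mult[rule_format, of "restr J v" E \<theta>] that
      by (intro LL[OF _ L(1)]) (auto simp flip: crd_restr)
    show "\<bar>\<Sum>j\<in>J. g.crd n (unit_seq j) * v j\<bar> \<le> L * nrm (restr J v)" if "finite J" for J n v
      using LL[OF crd_le L(2)] restr_spc[OF that] by (simp only: crd_restr[OF that, symmetric])
    show "(\<lambda>j. g.crd m (unit_seq j) * x n j) sums of_bool (m = n)" for m n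
    proof -
      have lim: "(\<lambda>N. K / c * nrm (x n - (\<Sum>j<N. x n j *\<^sub>R unit_seq j))) \<longlonglongrightarrow> 0"
        using tendsto_mult_left[OF expansion_unit_seq[of "x n", unfolded expansion_def], of "K / c"]
        by (simp only: g.x_in_V mult_zero_right)
      have "norm ((\<Sum>j<N. g.crd m (unit_seq j) * x n j) - of_bool (m = n))
          \<le> K / c * nrm (x n - (\<Sum>j<N. x n j *\<^sub>R unit_seq j))" for N
      proof -
        have "x n - restr {..<N} (x n) \<in> spc" by auto
        from crd_le[OF this, of m] show ?thesis
          by (simp add: g.coord_diff g.coord_basis_vector crd_restr sum_unit_seq abs_minus_commute)
      qed
      then have "(\<lambda>N. (\<Sum>j<N. g.crd m (unit_seq j) * x n j) - of_bool (m = n)) \<longlonglongrightarrow> 0"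
        by (intro Lim_null_comparison[OF always_eventually lim] allI)
      then show ?thesis by (simp add: sums_def LIM_zero_iff)
    qed
    show "(\<lambda>n. x n j * g.crd n (unit_seq j)) sums 1" for j
    proof -
      have lim: "(\<lambda>N. nrm (unit_seq j - (\<Sum>n<N. g.crd n (unit_seq j) *\<^sub>R x n))) \<longlonglongrightarrow> 0"
        using g.expansion_coord[OF unit_seq_spc(1)] by (simp add: expansion_def)
      have "norm ((\<Sum>n<N. x n j * g.crd n (unit_seq j)) - 1)
          \<le> nrm (unit_seq j - (\<Sum>n<N. g.crd n (unit_seq j) *\<^sub>R x n))" for N
      proof -
        have "unit_seq j - (\<Sum>n<N. g.crd n (unit_seq j) *\<^sub>R x n) \<in> spc"
          using unit_seq_spc by auto
        from abs_coordinate_le[OF this, of j] show ?thesis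
          by (simp add: abs_minus_commute mult.commute unit_seq_def[of j])
      qed
      then have "(\<lambda>N. (\<Sum>n<N. x n j * g.crd n (unit_seq j)) - 1) \<longlonglongrightarrow> 0"
        by (intro Lim_null_comparison[OF always_eventually lim] allI)
      then show ?thesis by (simp add: sums_def LIM_zero_iff)
    qed
  qed
  then show ?thesis by blast
qed

lemma greedy_basis_democratic:
  assumes "greedy_basis spc nrm x" "semi_normalized nrm x"
  shows "\<exists>D\<ge>1. \<forall>A B. finite A \<longrightarrow> finite B \<longrightarrow> card A = card B \<longrightarrow> nrm (\<Sum>n\<in>A. x n) \<le> D * nrm (\<Sum>n\<in>B. x n)"
proof -
  interpret g: greedy_carrier spc nrm x
    by unfold_locales (use assms in \<open>auto simp: greedy_basis_def\<close>)
  show ?thesis by (rule g.democratic)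
qed

end

section \<open>Systems in the space of \<^term>\<open>F21\<close>\<close>

text \<open>Dividing out the square isolates the logarithm: the quotient is
  \<open>exp (- 1) / - ln t\<close> for small \<open>t\<close> and \<open>t\<close> itself from
  \<open>exp (- 1)\<close> on. Division by zero gives 0 at the origin, which is also the limit
  there.\<close>

definition F21_quot :: "real \<Rightarrow> real" where
  "F21_quot t = F21 t / t\<^sup>2"

lemma F21_quot_large:
  assumes "exp (- 1) \<le> t"
  shows "F21_quot t = t"
proof -
  have "0 < t" using assms exp_gt_zero[of "- 1 :: real"] by linarith
  moreover have "\<not> t < 1 / exp 1" using assms by (simp add: exp_minus inverse_eq_divide)
  ultimately show ?thesis
    by (simp add: F21_quot_def F21_def power2_eq_square power3_eq_cube)
qed

lemma F21_quot_small:
  assumes "0 < t" "t \<le> exp (- 1)"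
  shows "F21_quot t = exp (- 1) / - ln t"
proof (cases "t = exp (- 1)")
  case True
  then show ?thesis using F21_quot_large[of t] by simp
next
  case False
  then show ?thesis using assms
    by (auto simp: F21_quot_def F21_def exp_minus divide_inverse)
qed

lemma minus_ln_ge_1: "0 < t \<Longrightarrow> t \<le> exp (- 1) \<Longrightarrow> 1 \<le> - ln t" for t :: real
  by (metis ln_le_cancel_iff exp_gt_zero ln_exp neg_le_iff_le minus_minus)

lemma F21_quot_mono_aux:
  assumes "0 < s" "s \<le> t"
  shows "F21_quot s \<le> F21_quot t"
proof -
  have small: "F21_quot s \<le> F21_quot t" if "0 < s" "s \<le> t" "t \<le> exp (- 1)" for s t
  proof -
    have pos: "0 < - ln s" "0 < - ln t"
      using that minus_ln_ge_1[of t] minus_ln_ge_1[of s] by linarith+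
    have "exp (- 1) / - ln s \<le> exp (- 1) / - ln t"
      by (rule divide_left_mono[OF _ _ mult_pos_pos[OF pos]]) (use that in auto)
    then show ?thesis using that by (simp only: F21_quot_small)
  qed
  consider "t \<le> exp (- 1)" | "s \<le> exp (- 1)" "exp (- 1) \<le> t" | "exp (- 1) \<le> s" by linarith
  then show ?thesis
  proof cases
    case 2
    have "F21_quot s \<le> F21_quot (exp (- 1))" using 2 assms by (intro small) auto
    then show ?thesis using 2 by (simp add: F21_quot_large)
  qed (use assms small in \<open>auto simp: F21_quot_large\<close>)
qed

lemma F21_quot_pos: "0 < t \<Longrightarrow> 0 < F21_quot t"
proof (cases "t \<le> exp (- 1)")
  case True
  assume "0 < t"
  then have "0 < - ln t" using True minus_ln_ge_1[of t] by linarith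
  then show ?thesis using True \<open>0 < t\<close>
    by (simp only: F21_quot_small) (rule divide_pos_pos[OF exp_gt_zero])
qed (auto simp: F21_quot_large)

lemma F21_quot_0 [simp]: "F21_quot 0 = 0"
  by (simp add: F21_quot_def)

lemma F21_quot_nonneg: "0 \<le> t \<Longrightarrow> 0 \<le> F21_quot t"
  using F21_quot_pos[of t] by (cases "t = 0") auto

lemma F21_quot_mono: "0 \<le> s \<Longrightarrow> s \<le> t \<Longrightarrow> F21_quot s \<le> F21_quot t"
  using F21_quot_mono_aux[of s t] F21_quot_nonneg[of t] by (cases "s = 0") auto

text \<open>A form of 4-concavity. With \<open>r = t / s\<close> and
  \<open>y = - ln t \<ge> 1\<close> the small case is \<open>y + ln r \<le> r\<^sup>2 * y\<close>, a
  consequence of \<open>ln r \<le> r - 1\<close>; the mixed case passes through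
  \<open>exp (- 1)\<close>.\<close>

lemma F21_quot_power4:
  assumes "0 < s" "s \<le> t"
  shows "F21_quot t * s\<^sup>2 \<le> F21_quot s * t\<^sup>2"
proof -
  have small: "F21_quot t * s\<^sup>2 \<le> F21_quot s * t\<^sup>2" if "0 < s" "s \<le> t" "t \<le> exp (- 1)" for s t
  proof -
    define r y where "r = t / s" and "y = - ln t"
    have r: "1 \<le> r" and t: "t = r * s" using that by (auto simp: r_def)
    have y: "1 \<le> y" using minus_ln_ge_1[of t] that by (simp add: y_def)
    have ls: "- ln s = y + ln r" using that r by (simp add: y_def r_def ln_div)
    have lr: "0 \<le> ln r" using r by simp
    have "ln r \<le> r - 1" using r by (intro ln_le_minus_one) auto
    also have "\<dots> \<le> r\<^sup>2 - 1" using r by (simp add: power2_eq_square)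
    also have "\<dots> \<le> (r\<^sup>2 - 1) * y"
      using r y mult_left_mono[of 1 y "r\<^sup>2 - 1"] by (simp add: power2_eq_square mult_ge1_I)
    finally have *: "y + ln r \<le> r\<^sup>2 * y" by (simp add: algebra_simps)
    have "F21_quot t * s\<^sup>2 = exp (- 1) * s\<^sup>2 * (1 / y)"
      using that by (simp add: F21_quot_small y_def)
    also have "\<dots> \<le> exp (- 1) * s\<^sup>2 * (r\<^sup>2 / (y + ln r))"
    proof (rule mult_left_mono)
      show "1 / y \<le> r\<^sup>2 / (y + ln r)" using * y lr by (simp add: field_simps)
    qed auto
    also have "\<dots> = F21_quot s * t\<^sup>2"
    proof -
      have "F21_quot s = exp (- 1) / (y + ln r)" using F21_quot_small[of s] that ls by simp
      then show ?thesis by (simp add: t power_mult_distrib)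
    qed
    finally show ?thesis .
  qed
  have large: "F21_quot t * s\<^sup>2 \<le> F21_quot s * t\<^sup>2" if "exp (- 1) \<le> s" "s \<le> t" for s t
  proof -
    have "0 < s" using that exp_gt_zero[of "- 1 :: real"] by linarith
    then have "(t * s) * s \<le> (t * s) * t" using that by (intro mult_left_mono) auto
    then show ?thesis using that by (simp add: F21_quot_large power2_eq_square mult_ac)
  qed
  let ?e = "exp (- 1) :: real"
  consider "t \<le> ?e" | "s \<le> ?e" "?e \<le> t" | "?e \<le> s" by linarith
  then show ?thesis
  proof cases
    case 2
    have "(F21_quot t * s\<^sup>2) * ?e\<^sup>2 = (F21_quot t * ?e\<^sup>2) * s\<^sup>2" by simp
    also have "\<dots> \<le> (F21_quot ?e * t\<^sup>2) * s\<^sup>2" using large[of ?e t] 2 by (intro mult_right_mono) auto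
    also have "\<dots> = (F21_quot ?e * s\<^sup>2) * t\<^sup>2" by simp
    also have "\<dots> \<le> (F21_quot s * ?e\<^sup>2) * t\<^sup>2" using small[of s ?e] 2 assms by (intro mult_right_mono) auto
    finally have "(F21_quot t * s\<^sup>2) * ?e\<^sup>2 \<le> (F21_quot s * t\<^sup>2) * ?e\<^sup>2" by (simp add: mult_ac)
    then show ?thesis by simp
  qed (use assms small large in auto)
qed

lemma F21_eq: "0 \<le> t \<Longrightarrow> F21 t = t\<^sup>2 * F21_quot t"
  by (cases "t = 0") (auto simp: F21_quot_def F21_def)

lemma F21_nonneg: "0 \<le> t \<Longrightarrow> 0 \<le> F21 t"
  by (simp add: F21_eq F21_quot_nonneg)

text \<open>A minorant that is affine in \<open>t\<^sup>2\<close>, so its sign average is computed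
  exactly from second moments. It is at most 0 below \<open>z / 2\<close>, and above
  \<open>z / 2\<close> the quotient has increased.\<close>

lemma F21_ge:
  assumes "0 \<le> t" "0 \<le> z"
  shows "(t\<^sup>2 - z\<^sup>2 / 4) * F21_quot (z / 2) \<le> F21 t"
proof (cases "z / 2 \<le> t")
  case True
  have "(t\<^sup>2 - z\<^sup>2 / 4) * F21_quot (z / 2) \<le> t\<^sup>2 * F21_quot (z / 2)"
    using assms by (intro mult_right_mono F21_quot_nonneg) auto
  also have "\<dots> \<le> t\<^sup>2 * F21_quot t"
    using assms True by (intro mult_left_mono F21_quot_mono) auto
  finally show ?thesis using assms by (simp add: F21_eq)
next
  case False
  then have "t\<^sup>2 \<le> (z / 2)\<^sup>2" using assms by (intro power_mono) auto
  then have "(t\<^sup>2 - z\<^sup>2 / 4) * F21_quot (z / 2) \<le> 0"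
    using assms by (intro mult_nonpos_nonneg F21_quot_nonneg) (auto simp: power_divide)
  then show ?thesis using F21_nonneg[OF assms(1)] by linarith
qed

text \<open>A majorant made of second and fourth powers, both of which average well over signs: the
  quotient increases up to \<open>T\<close> and grows at most quadratically afterwards.\<close>

lemma F21_le:
  assumes "0 \<le> t" "0 < T"
  shows "F21 t \<le> F21_quot T * (t\<^sup>2 + t ^ 4 / T\<^sup>2)"
proof (cases "t \<le> T")
  case True
  have "t\<^sup>2 * F21_quot t \<le> t\<^sup>2 * F21_quot T"
    using assms True by (intro mult_left_mono F21_quot_mono) auto
  also have "\<dots> \<le> F21_quot T * (t\<^sup>2 + t ^ 4 / T\<^sup>2)"
    using assms F21_quot_nonneg[of T] by (simp add: algebra_simps)
  finally show ?thesis using assms by (simp add: F21_eq)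
next
  case False
  then have "F21_quot t * T\<^sup>2 \<le> F21_quot T * t\<^sup>2"
    using assms by (intro F21_quot_power4) auto
  then have "F21_quot t \<le> F21_quot T * t\<^sup>2 / T\<^sup>2" using assms by (simp add: field_simps)
  then have "t\<^sup>2 * F21_quot t \<le> t\<^sup>2 * (F21_quot T * t\<^sup>2 / T\<^sup>2)" by (intro mult_left_mono) auto
  also have "\<dots> = F21_quot T * (t ^ 4 / T\<^sup>2)" by (simp add: power4_eq_xxxx power2_eq_square)
  also have "\<dots> \<le> F21_quot T * (t\<^sup>2 + t ^ 4 / T\<^sup>2)"
    using assms F21_quot_nonneg[of T] by (intro mult_left_mono) auto
  finally show ?thesis using assms by (simp add: F21_eq)
qed

lemma F21_scale_le:
  assumes "1 \<le> c" "0 \<le> t"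
  shows "F21 (c * t) \<le> c ^ 4 * F21 t"
proof (cases "t = 0")
  case False
  have "t \<le> c * t" using assms mult_right_mono[of 1 c t] by simp
  then have "F21_quot (c * t) * t\<^sup>2 \<le> F21_quot t * (c * t)\<^sup>2"
    using assms False by (intro F21_quot_power4) auto
  then have "c\<^sup>2 * (F21_quot (c * t) * t\<^sup>2) \<le> c\<^sup>2 * (F21_quot t * (c * t)\<^sup>2)"
    by (intro mult_left_mono) auto
  moreover have "F21 (c * t) = c\<^sup>2 * (F21_quot (c * t) * t\<^sup>2)"
    using assms by (subst F21_eq) (auto simp: power_mult_distrib)
  moreover have "c ^ 4 * F21 t = c\<^sup>2 * (F21_quot t * (c * t)\<^sup>2)"
    unfolding F21_eq[OF assms(2)] by algebra
  ultimately show ?thesis by (simp only:)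
qed (use assms in \<open>simp add: F21_def\<close>)

text \<open>The doubling constant is \<open>2 ^ 4\<close>, from the fourth-power scaling
  bound.\<close>

interpretation F21: orlicz_delta2 F21 16
proof unfold_locales
  show "F21 (2 * t) \<le> 16 * F21 t" if "0 \<le> t" "t \<le> 1" for t
    using F21_scale_le[of 2 t] that by simp
qed (rule convex_orlicz_function_F21)

section \<open>Square function estimates and type 2\<close>

locale F21_system = uncond_system F21 x b K for x b K
begin

text \<open>By fourth-power scaling, a vector of modular at most \<open>\<kappa>\<^sub>0\<close> at
  scale 1 has norm at most \<open>1 / (4 * K)\<close>, so each functional \<open>b n\<close> is at
  most \<open>1 / 4\<close> on it.\<close>

definition \<kappa>\<^sub>0 :: real where "\<kappa>\<^sub>0 = 1 / (4 * K) ^ 4"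

lemma kappa0_pos: "0 < \<kappa>\<^sub>0"
  using K_ge_1 by (simp add: \<kappa>\<^sub>0_def)

lemma sum_F21_le:
  assumes "finite I"
  shows "(\<Sum>i\<in>I. F21 \<bar>x n i\<bar>) \<le> K ^ 4"
proof -
  have "(\<Sum>i\<in>I. F21 \<bar>x n i\<bar>) \<le> (\<Sum>i\<in>I. K ^ 4 * F21 (\<bar>x n i\<bar> / K))"
    using K_ge_1 F21_scale_le[of K "\<bar>x n i\<bar> / K" for i] by (intro sum_mono) auto
  also have "\<dots> = K ^ 4 * (\<Sum>i\<in>I. F21 (\<bar>x n i\<bar> / K))" by (simp add: sum_distrib_left)
  also have "\<dots> \<le> K ^ 4 * 1"
    using K_ge_1 nrm_x assms by (intro mult_left_mono modular_leD[OF modular_le_nrm]) auto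
  finally show ?thesis by simp
qed

text \<open>The estimate rests on \<^term>\<open>F21_quot\<close> being increasing, a form of 2-convexity: it makes the
  average over signs of \<^term>\<open>F21\<close> comparable from below to its value at the quadratic mean.\<close>

lemma square_function_le:
  assumes E: "finite E" and I: "finite I" and l: "0 < l"
    and le: "\<And>A. A \<subseteq> E \<Longrightarrow> nrm (\<Sum>n\<in>E. (signs_of A n * c n) *\<^sub>R x n) \<le> l"
  shows "(\<Sum>n\<in>E. \<Sum>i\<in>I. (c n * x n i)\<^sup>2 * F21_quot (\<bar>c n * x n i\<bar> / (2 * l))) \<le> 4 / 3 * l\<^sup>2"
proof -
  define S where "S \<theta> i = (\<Sum>n\<in>E. \<theta> n * (c n * x n i))" for \<theta> :: "nat \<Rightarrow> real" and i
  define Z where "Z i = (\<Sum>n\<in>E. (c n * x n i)\<^sup>2)" for i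
  have Z0: "0 \<le> Z i" for i unfolding Z_def by (rule sum_nonneg) simp
  have lower: "(\<Sum>n\<in>E. 3 / 4 * ((c n * x n i)\<^sup>2 / l\<^sup>2 * F21_quot (\<bar>c n * x n i\<bar> / (2 * l))))
      \<le> sign_avg E (\<lambda>\<theta>. F21 (\<bar>S \<theta> i\<bar> / l))" for i
  proof -
    \<comment> \<open>\<open>z\<close> is the quadratic mean of the normalized sign sum, so that the
      minorant \<open>F21_ge\<close> averages to three quarters of
      \<open>z\<^sup>2 * F21_quot (z / 2)\<close>.\<close>
    define z where "z = sqrt (Z i) / l"
    have z: "0 \<le> z" "z\<^sup>2 = Z i / l\<^sup>2" using Z0[of i] l by (auto simp: z_def power_divide)
    have gz: "0 \<le> F21_quot (z / 2)" using z by (intro F21_quot_nonneg) auto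
    have "(\<Sum>n\<in>E. 3 / 4 * ((c n * x n i)\<^sup>2 / l\<^sup>2 * F21_quot (\<bar>c n * x n i\<bar> / (2 * l))))
        \<le> (\<Sum>n\<in>E. 3 / 4 * ((c n * x n i)\<^sup>2 / l\<^sup>2 * F21_quot (z / 2)))"
    proof (intro sum_mono mult_left_mono F21_quot_mono)
      fix n assume n: "n \<in> E"
      have "(c n * x n i)\<^sup>2 \<le> Z i" unfolding Z_def using n E by (intro member_le_sum) auto
      then have "sqrt ((c n * x n i)\<^sup>2) \<le> sqrt (Z i)" by (rule real_sqrt_le_mono)
      then have "\<bar>c n * x n i\<bar> \<le> sqrt (Z i)" by simp
      then have "\<bar>c n * x n i\<bar> / (2 * l) \<le> sqrt (Z i) / (2 * l)"
        using l by (intro divide_right_mono) auto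
      then show "\<bar>c n * x n i\<bar> / (2 * l) \<le> z / 2" by (simp add: z_def mult.commute)
    qed (use l in auto)
    also have "\<dots> = (3 / 4 * z\<^sup>2) * F21_quot (z / 2)"
      unfolding z(2) Z_def by (simp add: sum_distrib_left sum_distrib_right sum_divide_distrib mult_ac)
    also have "\<dots> = sign_avg E (\<lambda>\<theta>. F21_quot (z / 2) / l\<^sup>2 * (S \<theta> i)\<^sup>2 + - (z\<^sup>2 / 4 * F21_quot (z / 2)))"
    proof -
      have "sign_avg E (\<lambda>\<theta>. (S \<theta> i)\<^sup>2) = Z i"
        unfolding S_def Z_def by (rule sign_avg_square[OF E])
      then show ?thesis
        by (simp only: sign_avg_add sign_avg_cmult sign_avg_const[OF E]) (simp add: z(2) algebra_simps)
    qed
    also have "\<dots> \<le> sign_avg E (\<lambda>\<theta>. F21 (\<bar>S \<theta> i\<bar> / l))"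
    proof (rule sign_avg_mono)
      fix A
      have "((\<bar>S (signs_of A) i\<bar> / l)\<^sup>2 - z\<^sup>2 / 4) * F21_quot (z / 2) \<le> F21 (\<bar>S (signs_of A) i\<bar> / l)"
        using l z by (intro F21_ge) auto
      moreover have "((\<bar>S (signs_of A) i\<bar> / l)\<^sup>2 - z\<^sup>2 / 4) * F21_quot (z / 2)
        = F21_quot (z / 2) / l\<^sup>2 * (S (signs_of A) i)\<^sup>2 + - (z\<^sup>2 / 4 * F21_quot (z / 2))"
        by (simp add: power_divide algebra_simps)
      ultimately show "F21_quot (z / 2) / l\<^sup>2 * (S (signs_of A) i)\<^sup>2 + - (z\<^sup>2 / 4 * F21_quot (z / 2))
          \<le> F21 (\<bar>S (signs_of A) i\<bar> / l)" by simp
    qed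
    finally show ?thesis .
  qed
  have "(\<Sum>i\<in>I. \<Sum>n\<in>E. 3 / 4 * ((c n * x n i)\<^sup>2 / l\<^sup>2 * F21_quot (\<bar>c n * x n i\<bar> / (2 * l))))
      \<le> (\<Sum>i\<in>I. sign_avg E (\<lambda>\<theta>. F21 (\<bar>S \<theta> i\<bar> / l)))"
    by (intro sum_mono lower)
  also have "\<dots> = sign_avg E (\<lambda>\<theta>. \<Sum>i\<in>I. F21 (\<bar>S \<theta> i\<bar> / l))" by (simp add: sign_avg_sum)
  also have "\<dots> \<le> 1"
  proof (rule sign_avg_le_const[OF E])
    fix A assume "A \<subseteq> E"
    from modular_leD[OF modular_le_nrm[OF x_sum_spc le[OF this] l] I]
    show "(\<Sum>i\<in>I. F21 (\<bar>S (signs_of A) i\<bar> / l)) \<le> 1" by (simp add: S_def mult.assoc)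
  qed
  finally have "3 / 4 / l\<^sup>2 * (\<Sum>i\<in>I. \<Sum>n\<in>E. (c n * x n i)\<^sup>2 * F21_quot (\<bar>c n * x n i\<bar> / (2 * l))) \<le> 1"
    by (simp add: sum_distrib_left)
  then have "(\<Sum>i\<in>I. \<Sum>n\<in>E. (c n * x n i)\<^sup>2 * F21_quot (\<bar>c n * x n i\<bar> / (2 * l))) \<le> 4 / 3 * l\<^sup>2"
    using l by (simp add: field_simps)
  then show ?thesis by (subst sum.swap)
qed

text \<open>Both sides are compared with \<open>h\<^sup>2 * F21_quot (h / 2)\<close>,
  \<open>h\<close> being the quadratic mean of the sum. The second and fourth moments in
  \<open>F21_le\<close> give the factor \<open>1 + 3\<close>, halving the argument of the quotient
  costs another 4, and since the weights \<open>(c n)\<^sup>2\<close> sum to 1 the minorant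
  \<open>F21_ge\<close> leaves the factor \<open>3 / 4\<close>; together this is
  \<open>64 / 3\<close>.\<close>

lemma sign_avg_F21_le:
  fixes z :: "nat \<Rightarrow> real"
  assumes "finite E" "(\<Sum>n\<in>E. (c n)\<^sup>2) = 1"
  shows "sign_avg E (\<lambda>\<theta>. F21 \<bar>\<Sum>n\<in>E. \<theta> n * (c n * z n)\<bar>) \<le> 64 / 3 * (\<Sum>n\<in>E. (c n)\<^sup>2 * F21 \<bar>z n\<bar>)"
proof -
  define H where "H = (\<Sum>n\<in>E. (c n * z n)\<^sup>2)"
  define h where "h = sqrt H"
  have H0: "0 \<le> H" unfolding H_def by (rule sum_nonneg) simp
  then have h: "0 \<le> h" "h\<^sup>2 = H" by (auto simp: h_def)
  show ?thesis
  proof (cases "H = 0")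
    case True
    then have "\<forall>n\<in>E. (c n * z n)\<^sup>2 = 0"
      unfolding H_def using assms(1) by (subst (asm) sum_nonneg_eq_0_iff) auto
    then have "(\<Sum>n\<in>E. \<theta> n * (c n * z n)) = 0" for \<theta> by (intro sum.neutral) auto
    then have "sign_avg E (\<lambda>\<theta>. F21 \<bar>\<Sum>n\<in>E. \<theta> n * (c n * z n)\<bar>) = 0"
      using assms(1) by (simp add: sign_avg_const F21_def del: mult_eq_0_iff)
    moreover have "0 \<le> 64 / 3 * (\<Sum>n\<in>E. (c n)\<^sup>2 * F21 \<bar>z n\<bar>)"
      by (intro mult_nonneg_nonneg sum_nonneg F21_nonneg) auto
    ultimately show ?thesis by simp
  next
    case False
    then have hp: "0 < h" using h H0 by (auto simp: h_def)
    let ?S = "\<lambda>\<theta>. \<Sum>n\<in>E. \<theta> n * (c n * z n)"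
    have "sign_avg E (\<lambda>\<theta>. F21 \<bar>?S \<theta>\<bar>)
        \<le> sign_avg E (\<lambda>\<theta>. F21_quot h * (?S \<theta>)\<^sup>2 + (F21_quot h / h\<^sup>2) * (?S \<theta>) ^ 4)"
    proof (rule sign_avg_mono)
      fix A
      show "F21 \<bar>?S (signs_of A)\<bar> \<le> F21_quot h * (?S (signs_of A))\<^sup>2 + (F21_quot h / h\<^sup>2) * (?S (signs_of A)) ^ 4"
        using F21_le[OF abs_ge_zero hp, of "?S (signs_of A)"] by (simp add: algebra_simps)
    qed
    also have "\<dots> = F21_quot h * sign_avg E (\<lambda>\<theta>. (?S \<theta>)\<^sup>2)
        + (F21_quot h / h\<^sup>2) * sign_avg E (\<lambda>\<theta>. (?S \<theta>) ^ 4)"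
      by (simp only: sign_avg_add sign_avg_cmult)
    also have "\<dots> \<le> F21_quot h * H + (F21_quot h / h\<^sup>2) * (3 * H\<^sup>2)"
      unfolding sign_avg_square[OF assms(1)] H_def[symmetric]
      using sign_avg_fourth_power[OF assms(1), of "\<lambda>n. c n * z n"] F21_quot_nonneg[OF h(1)]
      by (intro add_left_mono mult_left_mono) (auto simp: H_def)
    also have "\<dots> = 4 * (F21_quot h * H)"
      using False h(2) by (simp add: power2_eq_square)
    also have "\<dots> \<le> 4 * (4 * F21_quot (h / 2) * H)"
    proof -
      have "F21_quot h * (h / 2)\<^sup>2 \<le> F21_quot (h / 2) * h\<^sup>2" using hp by (intro F21_quot_power4) auto
      then have "F21_quot h \<le> 4 * F21_quot (h / 2)" using hp by (simp add: power_divide field_simps)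
      then show ?thesis using H0 by (intro mult_left_mono mult_right_mono) auto
    qed
    also have "\<dots> = 64 / 3 * (3 / 4 * H * F21_quot (h / 2))" by simp
    also have "3 / 4 * H * F21_quot (h / 2) = (\<Sum>n\<in>E. (c n)\<^sup>2 * (((z n)\<^sup>2 - h\<^sup>2 / 4) * F21_quot (h / 2)))"
    proof -
      have "(\<Sum>n\<in>E. (c n)\<^sup>2 * (((z n)\<^sup>2 - h\<^sup>2 / 4) * F21_quot (h / 2)))
          = ((\<Sum>n\<in>E. (c n * z n)\<^sup>2) - (\<Sum>n\<in>E. (c n)\<^sup>2) * (h\<^sup>2 / 4)) * F21_quot (h / 2)"
        unfolding sum_distrib_right sum_subtractf[symmetric]
        by (intro sum.cong) (auto simp: algebra_simps power_mult_distrib)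
      then show ?thesis by (simp add: assms(2) h(2) flip: H_def)
    qed
    also have "\<dots> \<le> (\<Sum>n\<in>E. (c n)\<^sup>2 * F21 \<bar>z n\<bar>)"
      using F21_ge[OF abs_ge_zero h(1)] by (intro sum_mono mult_left_mono) auto
    finally show ?thesis by simp
  qed
qed

text \<open>The constant 23 rounds up \<open>1 + 64 / 3\<close>. One factor \<open>K\<close> is the
  scale at which every \<open>x n\<close> has modular at most 1, the other is the price of removing
  the random signs.\<close>

lemma type_2_normalized:
  assumes E: "finite E" and c: "(\<Sum>n\<in>E. (c n)\<^sup>2) = 1"
  shows "nrm (\<Sum>n\<in>E. c n *\<^sub>R x n) \<le> 23 * K\<^sup>2"
proof -
  define W where "W \<theta> = (\<Sum>n\<in>E. (\<theta> n * c n) *\<^sub>R x n)" for \<theta> :: "nat \<Rightarrow> real"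
  have W: "W \<theta> \<in> spc" for \<theta> unfolding W_def by (rule x_sum_spc)
  have "sign_avg E (\<lambda>\<theta>. \<Sum>i\<in>I. F21 (\<bar>W \<theta> i\<bar> / K)) \<le> 64 / 3" if I: "finite I" for I
  proof -
    have *: "\<bar>W \<theta> i\<bar> / K = \<bar>\<Sum>n\<in>E. \<theta> n * (c n * (x n i / K))\<bar>" for \<theta> i
    proof -
      have "(\<Sum>n\<in>E. \<theta> n * (c n * (x n i / K))) = W \<theta> i / K"
        by (simp add: W_def sum_divide_distrib mult.assoc)
      then show ?thesis using K_ge_1 by simp
    qed
    have "sign_avg E (\<lambda>\<theta>. \<Sum>i\<in>I. F21 (\<bar>W \<theta> i\<bar> / K))
        \<le> (\<Sum>i\<in>I. 64 / 3 * (\<Sum>n\<in>E. (c n)\<^sup>2 * F21 \<bar>x n i / K\<bar>))"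
      unfolding * sign_avg_sum by (intro sum_mono sign_avg_F21_le E c)
    also have "\<dots> = 64 / 3 * (\<Sum>n\<in>E. (c n)\<^sup>2 * (\<Sum>i\<in>I. F21 (\<bar>x n i\<bar> / K)))"
      unfolding sum_distrib_left
      by (subst sum.swap) (use K_ge_1 in simp)
    also have "\<dots> \<le> 64 / 3 * (\<Sum>n\<in>E. (c n)\<^sup>2 * 1)"
      using K_ge_1 nrm_x I by (intro mult_left_mono sum_mono modular_leD[OF modular_le_nrm]) auto
    finally show ?thesis using c by simp
  qed
  then have "sign_avg E (\<lambda>\<theta>. nrm (W \<theta>)) \<le> K * (1 + 64 / 3)"
    using W K_ge_1 by (intro sign_avg_nrm_le E) auto
  moreover have "nrm (\<Sum>n\<in>E. c n *\<^sub>R x n) / K \<le> sign_avg E (\<lambda>\<theta>. nrm (W \<theta>))"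
  proof (rule sign_avg_ge_const[OF E])
    fix A
    have "nrm (\<Sum>n\<in>E. (signs_of A n * (signs_of A n * c n)) *\<^sub>R x n) \<le> K * nrm (W (signs_of A))"
      unfolding W_def using E by (intro multiplier) auto
    then show "nrm (\<Sum>n\<in>E. c n *\<^sub>R x n) / K \<le> nrm (W (signs_of A))"
      using K_ge_1 by (simp add: field_simps flip: mult.assoc)
  qed
  moreover have "K * (1 + 64 / 3) \<le> 23 * K" using K_ge_1 by simp
  ultimately have "nrm (\<Sum>n\<in>E. c n *\<^sub>R x n) / K \<le> 23 * K" by (blast intro: order_trans)
  then show ?thesis using K_ge_1 by (simp add: field_simps power2_eq_square)
qed

lemma type_2:
  assumes E: "finite E"
  shows "nrm (\<Sum>n\<in>E. c n *\<^sub>R x n) \<le> 23 * K\<^sup>2 * sqrt (\<Sum>n\<in>E. (c n)\<^sup>2)"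
proof -
  define s where "s = sqrt (\<Sum>n\<in>E. (c n)\<^sup>2)"
  have s2: "s\<^sup>2 = (\<Sum>n\<in>E. (c n)\<^sup>2)" "0 \<le> s" unfolding s_def by (simp_all add: sum_nonneg)
  show ?thesis
  proof (cases "s = 0")
    case True
    then have "\<forall>n\<in>E. (c n)\<^sup>2 = 0" using s2 E by (simp add: sum_nonneg_eq_0_iff)
    then have "(\<Sum>n\<in>E. c n *\<^sub>R x n) = 0" by (intro sum.neutral) auto
    then show ?thesis using True by (simp flip: s_def)
  next
    case False
    have "(\<Sum>n\<in>E. (c n / s)\<^sup>2) = 1"
      using False by (simp add: power_divide s2(1)[symmetric] flip: sum_divide_distrib)
    from type_2_normalized[OF E this] have "nrm (\<Sum>n\<in>E. (c n / s) *\<^sub>R x n) \<le> 23 * K\<^sup>2" .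
    moreover have "(\<Sum>n\<in>E. (c n / s) *\<^sub>R x n) = inverse s *\<^sub>R (\<Sum>n\<in>E. c n *\<^sub>R x n)"
      by (simp add: scaleR_sum_right divide_inverse mult.commute)
    moreover have "nrm (inverse s *\<^sub>R (\<Sum>n\<in>E. c n *\<^sub>R x n)) = \<bar>inverse s\<bar> * nrm (\<Sum>n\<in>E. c n *\<^sub>R x n)"
      by (rule scale_spc(2)[OF x_sum_spc])
    ultimately have "inverse s * nrm (\<Sum>n\<in>E. c n *\<^sub>R x n) \<le> 23 * K\<^sup>2" using s2(2) by simp
    then have "s * (inverse s * nrm (\<Sum>n\<in>E. c n *\<^sub>R x n)) \<le> s * (23 * K\<^sup>2)"
      using s2(2) by (rule mult_left_mono)
    moreover have "s * (inverse s * nrm (\<Sum>n\<in>E. c n *\<^sub>R x n)) = nrm (\<Sum>n\<in>E. c n *\<^sub>R x n)"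
      using False by simp
    ultimately show ?thesis unfolding s_def[symmetric] by (simp only: mult.commute[of s])
  qed
qed

text \<open>Type 2 is tested with the column itself as coefficients: coordinate \<open>i\<close> of
  the resulting vector is the square sum, while the norm is bounded by its square root.\<close>

lemma column_square_sum_le:
  assumes E: "finite E"
  shows "(\<Sum>n\<in>E. (x n i)\<^sup>2) \<le> (23 * K\<^sup>2)\<^sup>2"
proof -
  define s where "s = sqrt (\<Sum>n\<in>E. (x n i)\<^sup>2)"
  have s: "s\<^sup>2 = (\<Sum>n\<in>E. (x n i)\<^sup>2)" "0 \<le> s" unfolding s_def by (simp_all add: sum_nonneg)
  have "s\<^sup>2 = (\<Sum>n\<in>E. x n i *\<^sub>R x n) i" unfolding s(1) by (simp add: power2_eq_square)
  also have "\<dots> \<le> nrm (\<Sum>n\<in>E. x n i *\<^sub>R x n)"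
    using abs_coordinate_le[OF x_sum_spc[of "\<lambda>n. x n i" E], of i] by linarith
  also have "\<dots> \<le> 23 * K\<^sup>2 * s" unfolding s_def by (rule type_2[OF E])
  finally have "s * s \<le> 23 * K\<^sup>2 * s" by (simp add: power2_eq_square)
  then have "s \<le> 23 * K\<^sup>2" using s(2) by (cases "s = 0") auto
  then show ?thesis unfolding s(1)[symmetric] using s(2) by (intro power_mono) auto
qed

end

section \<open>Size of the entries and lower square estimates\<close>

context F21_system
begin

text \<open>The entries of modulus at most \<open>\<tau>\<close> carry negligible modular: up to a
  small remainder, \<open>x n\<close> lives on entries larger than \<open>\<tau>\<close>.\<close>

definition light :: "nat \<Rightarrow> real \<Rightarrow> bool" where
  "light n \<tau> \<longleftrightarrow> (\<forall>I. finite I \<longrightarrow> (\<Sum>i\<in>I. if \<bar>x n i\<bar> \<le> \<tau> then F21 \<bar>x n i\<bar> else 0) \<le> \<kappa>\<^sub>0)"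

text \<open>The small entries form a vector on which \<open>b n\<close> is at most
  \<open>1 / 4\<close>. The biorthogonal series sums to 1, so some partial sum exceeds
  \<open>3 / 4\<close>, and at least one half must come from the large entries.\<close>

lemma light_imp_heavy_coordinates:
  assumes "light n \<tau>" "0 \<le> \<tau>"
  shows "\<exists>J. finite J \<and> (\<forall>i\<in>J. \<tau> < \<bar>x n i\<bar>) \<and> 1 / 2 \<le> \<bar>\<Sum>i\<in>J. b n i * x n i\<bar>"
proof -
  define r where "r i = (if \<bar>x n i\<bar> \<le> \<tau> then x n i else 0)" for i
  have "modular_le r (1 / (4 * K))"
    unfolding modular_le_def
  proof (intro allI impI)
    fix I :: "nat set" assume I: "finite I"
    have "(\<Sum>i\<in>I. F21 (\<bar>r i\<bar> / (1 / (4 * K)))) = (\<Sum>i\<in>I. F21 (4 * K * \<bar>r i\<bar>))"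
      by (simp add: mult.commute)
    also have "\<dots> \<le> (\<Sum>i\<in>I. (4 * K) ^ 4 * F21 \<bar>r i\<bar>)"
      using K_ge_1 by (intro sum_mono F21_scale_le) auto
    also have "\<dots> = (4 * K) ^ 4 * (\<Sum>i\<in>I. if \<bar>x n i\<bar> \<le> \<tau> then F21 \<bar>x n i\<bar> else 0)"
      unfolding sum_distrib_left by (rule sum.cong) (auto simp: r_def)
    also have "\<dots> \<le> (4 * K) ^ 4 * \<kappa>\<^sub>0"
      using assms(1) I K_ge_1 by (intro mult_left_mono) (auto simp: light_def)
    also have "\<dots> = 1" using K_ge_1 by (simp add: \<kappa>\<^sub>0_def)
    finally show "(\<Sum>i\<in>I. F21 (\<bar>r i\<bar> / (1 / (4 * K)))) \<le> 1" .
  qed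
  then have r: "r \<in> spc" "nrm r \<le> 1 / (4 * K)"
    using K_ge_1 spc_nrm_leI[of r "1 / (4 * K)"] by auto
  have "(\<lambda>N. \<Sum>j<N. b n j * x n j) \<longlonglongrightarrow> 1"
    using biorthogonal[of n n] by (simp add: sums_def)
  then have "\<forall>\<^sub>F N in sequentially. 3 / 4 < (\<Sum>j<N. b n j * x n j)"
    by (rule order_tendstoD) simp
  then obtain N where N: "3 / 4 < (\<Sum>j<N. b n j * x n j)"
    by (auto simp: eventually_sequentially)
  define J where "J = {j. j < N \<and> \<tau> < \<bar>x n j\<bar>}"
  have J: "finite J" by (simp add: J_def)
  have "(\<Sum>j<N. b n j * x n j) = (\<Sum>j\<in>J. b n j * x n j) + (\<Sum>j<N. b n j * r j)"
  proof -
    have "(\<Sum>j\<in>J. b n j * x n j) = (\<Sum>j<N. if \<tau> < \<bar>x n j\<bar> then b n j * x n j else 0)"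
      unfolding J_def by (subst sum.If_cases) (auto intro!: sum.cong)
    then show ?thesis
      unfolding sum.distrib[symmetric] by (auto simp: r_def sum.distrib[symmetric] intro!: sum.cong)
  qed
  moreover have "\<bar>\<Sum>j<N. b n j * r j\<bar> \<le> 1 / 4"
  proof -
    have "nrm (restr {..<N} r) \<le> nrm r"
      by (rule dominated(2)[of r "restr {..<N} r"]) (use r in \<open>auto simp: restr_def\<close>)
    then have "K * nrm (restr {..<N} r) \<le> K * (1 / (4 * K))"
      using r K_ge_1 by (intro mult_left_mono) auto
    then show ?thesis using functional_le[of "{..<N}" n r] K_ge_1 by simp
  qed
  ultimately have "1 / 2 \<le> \<bar>\<Sum>j\<in>J. b n j * x n j\<bar>" using N by linarith
  then show ?thesis using J by (intro exI[of _ J]) (auto simp: J_def)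
qed

text \<open>Every row has a nonzero diagonal product, because these products sum to 1. If only
  finitely many rows were flat, a threshold below one such product of each of them would admit no
  flat row at all.\<close>

lemma infinite_flat:
  assumes flat: "\<And>\<delta>. 0 < \<delta> \<Longrightarrow> \<exists>n. \<forall>j. \<bar>x n j * b n j\<bar> < \<delta>" and "0 < \<delta>"
  shows "infinite {n. \<forall>j. \<bar>x n j * b n j\<bar> < \<delta>}" (is "infinite ?F")
proof
  assume fin: "finite ?F"
  have "\<exists>j. x n j * b n j \<noteq> 0" for n
  proof (rule ccontr)
    assume "\<not> (\<exists>j. x n j * b n j \<noteq> 0)"
    then have "(\<lambda>j. b n j * x n j) = (\<lambda>_. 0)" by (auto simp: fun_eq_iff)
    then show False using biorthogonal[of n n] sums_unique2[OF sums_zero, of "1 :: real"] by auto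
  qed
  then obtain h where h: "\<And>n. x n (h n) * b n (h n) \<noteq> 0" by metis
  define \<epsilon> where "\<epsilon> = Min (insert \<delta> ((\<lambda>n. \<bar>x n (h n) * b n (h n)\<bar>) ` ?F))"
  have \<epsilon>: "0 < \<epsilon>" "\<epsilon> \<le> \<delta>" "\<And>n. n \<in> ?F \<Longrightarrow> \<epsilon> \<le> \<bar>x n (h n) * b n (h n)\<bar>"
    using fin h assms(2) by (auto simp: \<epsilon>_def Min_gr_iff simp del: mult_eq_0_iff abs_mult)
  obtain n where n: "\<forall>j. \<bar>x n j * b n j\<bar> < \<epsilon>" using flat[OF \<epsilon>(1)] by blast
  then have "n \<in> ?F" using \<epsilon>(2) by (auto intro: less_le_trans)
  then show False using \<epsilon>(3)[of n] n by (meson not_le)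
qed

text \<open>At most \<open>K ^ 4 / F21 \<tau>\<close> entries of a row exceed \<open>\<tau>\<close>,
  so products this small add up to at most \<open>1 / 4\<close> there, less than the half that a
  light vector would have.\<close>

lemma flat_imp_not_light:
  assumes \<tau>: "0 < \<tau>" and flat: "\<forall>j. \<bar>x n j * b n j\<bar> < F21 \<tau> / (4 * K ^ 4)"
  shows "\<not> light n \<tau>"
proof
  have F\<tau>: "0 < F21 \<tau>" using \<tau> F21_quot_pos[OF \<tau>] by (simp add: F21_eq)
  assume "light n \<tau>"
  then obtain J where J: "finite J" "\<forall>i\<in>J. \<tau> < \<bar>x n i\<bar>" "1 / 2 \<le> \<bar>\<Sum>i\<in>J. b n i * x n i\<bar>"
    using light_imp_heavy_coordinates[of n \<tau>] \<tau> by auto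
  have "real (card J) * F21 \<tau> = (\<Sum>i\<in>J. F21 \<tau>)" by simp
  also have "\<dots> \<le> (\<Sum>i\<in>J. F21 \<bar>x n i\<bar>)" using J(2) \<tau> by (intro sum_mono M_mono) auto
  also have "\<dots> \<le> K ^ 4" by (rule sum_F21_le[OF J(1)])
  finally have card: "real (card J) * F21 \<tau> \<le> K ^ 4" .
  have "\<bar>\<Sum>i\<in>J. b n i * x n i\<bar> \<le> (\<Sum>i\<in>J. \<bar>b n i * x n i\<bar>)" by (rule sum_abs)
  also have "\<dots> \<le> (\<Sum>i\<in>J. F21 \<tau> / (4 * K ^ 4))"
    using flat by (intro sum_mono less_imp_le) (metis mult.commute)
  also have "\<dots> = (real (card J) * F21 \<tau>) / (4 * K ^ 4)" by simp
  also have "\<dots> \<le> K ^ 4 / (4 * K ^ 4)" using card K_ge_1 by (intro divide_right_mono) auto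
  also have "\<dots> = 1 / 4" using K_ge_1 by simp
  finally show False using J(3) by linarith
qed

lemma not_light_witness:
  assumes "finite B" "\<And>n. n \<in> B \<Longrightarrow> \<not> light n (\<tau> n)"
  shows "\<exists>I. finite I \<and> (\<forall>n\<in>B. \<kappa>\<^sub>0 < (\<Sum>i\<in>I. if \<bar>x n i\<bar> \<le> \<tau> n then F21 \<bar>x n i\<bar> else 0))"
proof -
  let ?s = "\<lambda>n I. \<Sum>i\<in>I. if \<bar>x n i\<bar> \<le> \<tau> n then F21 \<bar>x n i\<bar> else 0"
  have "\<forall>n\<in>B. \<exists>I. finite I \<and> \<kappa>\<^sub>0 < ?s n I"
    using assms(2) by (auto simp: light_def not_le)
  then obtain I where I: "\<forall>n\<in>B. finite (I n) \<and> \<kappa>\<^sub>0 < ?s n (I n)"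
    unfolding bchoice_iff ..
  have "\<kappa>\<^sub>0 < ?s n (\<Union>n\<in>B. I n)" if n: "n \<in> B" for n
  proof -
    have "?s n (I n) \<le> ?s n (\<Union>n\<in>B. I n)"
      using assms(1) I n by (intro sum_mono2) (auto intro!: M_nonneg)
    then show ?thesis using I n by fastforce
  qed
  then show ?thesis using assms(1) I by (intro exI[of _ "\<Union>n\<in>B. I n"]) auto
qed

text \<open>Flat vectors keep a fixed share of modular on arbitrarily small entries. When the
  entries are small compared with the coefficients, the scaled product
  \<open>\<bar>c n * x n i\<bar> / (2 * l)\<close> is at least \<open>(x n i)\<^sup>2\<close>, where
  the quotient is still half of its value at \<open>\<bar>x n i\<bar>\<close>; the square function
  therefore sees the square sum of the coefficients.\<close>

lemma flat_imp_lower_l2: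
  assumes flat: "\<And>\<delta>. 0 < \<delta> \<Longrightarrow> \<exists>n. \<forall>j. \<bar>x n j * b n j\<bar> < \<delta>"
  shows "\<exists>\<kappa>>0. \<forall>N. \<exists>B. finite B \<and> card B = N
    \<and> (\<forall>c. \<kappa> * sqrt (\<Sum>n\<in>B. (c n)\<^sup>2) \<le> nrm (\<Sum>n\<in>B. c n *\<^sub>R x n))"
proof -
  \<comment> \<open>The bound \<open>\<rho>\<^sup>2 \<le> 9 / 32 * \<kappa>\<^sub>0\<close> is
    \<open>4 / 3 * \<rho>\<^sup>2 \<le> 3 / 4 * (1 / 2 * \<kappa>\<^sub>0)\<close>, the comparison
    of upper and lower square function estimates.\<close>
  define \<rho> where "\<rho> = min 1 (sqrt (9 / 32 * \<kappa>\<^sub>0))"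
  have \<rho>: "0 < \<rho>" "\<rho> \<le> 1" "\<rho>\<^sup>2 \<le> 9 / 32 * \<kappa>\<^sub>0"
  proof -
    show p: "0 < \<rho>" "\<rho> \<le> 1" using kappa0_pos by (auto simp: \<rho>_def)
    have "\<rho>\<^sup>2 \<le> (sqrt (9 / 32 * \<kappa>\<^sub>0))\<^sup>2" using p by (intro power_mono) (auto simp: \<rho>_def)
    then show "\<rho>\<^sup>2 \<le> 9 / 32 * \<kappa>\<^sub>0" using kappa0_pos by simp
  qed
  have "\<exists>B. finite B \<and> card B = N
    \<and> (\<forall>c. \<rho> / K * sqrt (\<Sum>n\<in>B. (c n)\<^sup>2) \<le> nrm (\<Sum>n\<in>B. c n *\<^sub>R x n))" for N
  proof -
    \<comment> \<open>Coefficients below \<open>r\<close> carry at most a quarter of the square sum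
      over \<open>N\<close> indices; the choice \<open>\<tau> = r / 2\<close> puts the relevant
      entries below half of any other coefficient.\<close>
    define r where "r = 1 / (2 * sqrt (real N + 1))"
    have r: "0 < r" "r \<le> 1 / 2" "real N * r\<^sup>2 \<le> 1 / 4"
      by (auto simp: r_def power_divide power_mult_distrib field_simps)
    define \<tau> where "\<tau> = r / 2"
    have e4: "exp 1 \<le> (3::real)" using exp_le by simp
    have "(1::real) / 4 \<le> exp (- 1)" using e4 by (simp add: exp_minus field_simps)
    then have \<tau>: "0 < \<tau>" "\<tau> \<le> exp (- 1)" using r by (auto simp: \<tau>_def)
    have "0 < F21 \<tau> / (4 * K ^ 4)" using K_ge_1 \<tau> F21_quot_pos[OF \<tau>(1)] by (simp add: F21_eq)
    from infinite_arbitrarily_large[OF infinite_flat[OF flat this], of N]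
    obtain B where B: "finite B" "card B = N"
      and fl: "\<And>n. n \<in> B \<Longrightarrow> \<forall>j. \<bar>x n j * b n j\<bar> < F21 \<tau> / (4 * K ^ 4)" by blast
    have "\<exists>I. finite I \<and> (\<forall>n\<in>B. \<kappa>\<^sub>0 < (\<Sum>i\<in>I. if \<bar>x n i\<bar> \<le> \<tau> then F21 \<bar>x n i\<bar> else 0))"
      using flat_imp_not_light[OF \<tau>(1) fl] by (intro not_light_witness B(1))
    then obtain I where I: "finite I"
      "\<And>n. n \<in> B \<Longrightarrow> \<kappa>\<^sub>0 < (\<Sum>i\<in>I. if \<bar>x n i\<bar> \<le> \<tau> then F21 \<bar>x n i\<bar> else 0)" by blast
    have normalized: "\<rho> / K \<le> nrm (\<Sum>n\<in>B. c n *\<^sub>R x n)" if c: "(\<Sum>n\<in>B. (c n)\<^sup>2) = 1" for c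
    proof (rule ccontr)
      assume "\<not> \<rho> / K \<le> nrm (\<Sum>n\<in>B. c n *\<^sub>R x n)"
      then have small: "K * nrm (\<Sum>n\<in>B. c n *\<^sub>R x n) < \<rho>" using K_ge_1 by (simp add: field_simps)
      \<comment> \<open>The maximum with \<open>\<rho> / 2\<close> keeps the scale positive while it
        stays below \<open>\<rho>\<close>.\<close>
      define l where "l = max (K * nrm (\<Sum>n\<in>B. c n *\<^sub>R x n)) (\<rho> / 2)"
      have l: "0 < l" "l < \<rho>" using small \<rho> by (auto simp: l_def)
      define Bp where "Bp = {n\<in>B. r \<le> \<bar>c n\<bar>}"
      have Bp: "3 / 4 \<le> (\<Sum>n\<in>Bp. (c n)\<^sup>2)"
      proof -
        have "(\<Sum>n\<in>B - Bp. (c n)\<^sup>2) \<le> (\<Sum>n\<in>B - Bp. r\<^sup>2)"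
        proof (rule sum_mono)
          fix n assume "n \<in> B - Bp"
          then have "\<bar>c n\<bar>\<^sup>2 \<le> r\<^sup>2" by (intro power_mono) (auto simp: Bp_def)
          then show "(c n)\<^sup>2 \<le> r\<^sup>2" by simp
        qed
        also have "\<dots> \<le> (\<Sum>n\<in>B. r\<^sup>2)" using B by (intro sum_mono2) auto
        also have "\<dots> \<le> 1 / 4" using B r by simp
        finally have "(\<Sum>n\<in>B - Bp. (c n)\<^sup>2) \<le> 1 / 4" .
        moreover have "(\<Sum>n\<in>B. (c n)\<^sup>2) = (\<Sum>n\<in>B - Bp. (c n)\<^sup>2) + (\<Sum>n\<in>Bp. (c n)\<^sup>2)"
          using B by (intro sum.subset_diff) (auto simp: Bp_def)
        ultimately show ?thesis using c by linarith
      qed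
      have "(\<Sum>n\<in>B. \<Sum>i\<in>I. (c n * x n i)\<^sup>2 * F21_quot (\<bar>c n * x n i\<bar> / (2 * l))) \<le> 4 / 3 * l\<^sup>2"
      proof (rule square_function_le[OF B(1) I(1) l(1)])
        fix A
        have "nrm (\<Sum>n\<in>B. (signs_of A n * c n) *\<^sub>R x n) \<le> K * nrm (\<Sum>n\<in>B. c n *\<^sub>R x n)"
          using B by (intro multiplier) auto
        then show "nrm (\<Sum>n\<in>B. (signs_of A n * c n) *\<^sub>R x n) \<le> l" by (simp add: l_def)
      qed
      moreover have "(\<Sum>n\<in>Bp. (c n)\<^sup>2 * (1 / 2 * \<kappa>\<^sub>0))
          \<le> (\<Sum>n\<in>B. \<Sum>i\<in>I. (c n * x n i)\<^sup>2 * F21_quot (\<bar>c n * x n i\<bar> / (2 * l)))"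
      proof -
        have nn: "0 \<le> (c n * x n i)\<^sup>2 * F21_quot (\<bar>c n * x n i\<bar> / (2 * l))" for n i
          using l by (intro mult_nonneg_nonneg F21_quot_nonneg) auto
        have "(c n)\<^sup>2 * (1 / 2 * \<kappa>\<^sub>0) \<le> (\<Sum>i\<in>I. (c n * x n i)\<^sup>2 * F21_quot (\<bar>c n * x n i\<bar> / (2 * l)))"
          if n: "n \<in> Bp" for n
        proof -
          have cn: "r \<le> \<bar>c n\<bar>" "n \<in> B" using n by (auto simp: Bp_def)
          have "(c n)\<^sup>2 * (1 / 2 * \<kappa>\<^sub>0)
              \<le> (c n)\<^sup>2 * (1 / 2 * (\<Sum>i\<in>I. if \<bar>x n i\<bar> \<le> \<tau> then F21 \<bar>x n i\<bar> else 0))"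
            using I(2)[OF cn(2)] by (intro mult_left_mono) auto
          also have "\<dots> = (\<Sum>i\<in>I. (c n)\<^sup>2 * (1 / 2 * (if \<bar>x n i\<bar> \<le> \<tau> then F21 \<bar>x n i\<bar> else 0)))"
            by (simp only: sum_distrib_left)
          also have "\<dots> \<le> (\<Sum>i\<in>I. (c n * x n i)\<^sup>2 * F21_quot (\<bar>c n * x n i\<bar> / (2 * l)))"
          proof (rule sum_mono)
            fix i
            show "(c n)\<^sup>2 * (1 / 2 * (if \<bar>x n i\<bar> \<le> \<tau> then F21 \<bar>x n i\<bar> else 0))
              \<le> (c n * x n i)\<^sup>2 * F21_quot (\<bar>c n * x n i\<bar> / (2 * l))"
            proof (cases "\<bar>x n i\<bar> \<le> \<tau> \<and> x n i \<noteq> 0")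
              case True
              then have a: "0 < \<bar>x n i\<bar>" "\<bar>x n i\<bar> \<le> \<tau>" "\<bar>x n i\<bar> \<le> exp (- 1)" using \<tau> by auto
              have a2: "0 < \<bar>x n i\<bar>\<^sup>2" "\<bar>x n i\<bar>\<^sup>2 \<le> exp (- 1)"
              proof -
                have "\<bar>x n i\<bar> * \<bar>x n i\<bar> \<le> \<bar>x n i\<bar> * 1"
                  using a r by (intro mult_left_mono) (auto simp: \<tau>_def)
                then show "\<bar>x n i\<bar>\<^sup>2 \<le> exp (- 1)" using a(3) unfolding power2_eq_square by linarith
              qed (use a in simp)
              have "\<bar>x n i\<bar> \<le> \<bar>c n\<bar> / 2" using a(2) cn by (simp add: \<tau>_def)
              also have "\<dots> \<le> \<bar>c n\<bar> / (2 * l)"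
                using l \<rho> by (intro divide_left_mono) auto
              finally have "\<bar>x n i\<bar> * \<bar>x n i\<bar> \<le> \<bar>c n\<bar> / (2 * l) * \<bar>x n i\<bar>"
                by (intro mult_right_mono) auto
              then have "\<bar>x n i\<bar>\<^sup>2 \<le> \<bar>c n * x n i\<bar> / (2 * l)"
                by (simp add: power2_eq_square abs_mult)
              then have "F21_quot (\<bar>x n i\<bar>\<^sup>2) \<le> F21_quot (\<bar>c n * x n i\<bar> / (2 * l))"
                by (intro F21_quot_mono) auto
              \<comment> \<open>Here the logarithm acts: squaring a small argument halves the
                quotient.\<close>
              moreover have "F21_quot (\<bar>x n i\<bar>\<^sup>2) = 1 / 2 * F21_quot \<bar>x n i\<bar>"
                unfolding F21_quot_small[OF a2] F21_quot_small[OF a(1,3)] ln_realpow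
                by simp
              ultimately have "(c n * x n i)\<^sup>2 * (1 / 2 * F21_quot \<bar>x n i\<bar>)
                  \<le> (c n * x n i)\<^sup>2 * F21_quot (\<bar>c n * x n i\<bar> / (2 * l))"
                by (intro mult_left_mono) auto
              moreover have "(c n)\<^sup>2 * (1 / 2 * F21 \<bar>x n i\<bar>) = (c n * x n i)\<^sup>2 * (1 / 2 * F21_quot \<bar>x n i\<bar>)"
                by (simp add: F21_eq power_mult_distrib)
              ultimately show ?thesis using True by simp
            next
              case False
              then have "(c n)\<^sup>2 * (1 / 2 * (if \<bar>x n i\<bar> \<le> \<tau> then F21 \<bar>x n i\<bar> else 0)) = 0" by auto
              then show ?thesis using nn[of n i] by (simp only:)
            qed
          qed
          finally show ?thesis .
        qed
        then have "(\<Sum>n\<in>Bp. (c n)\<^sup>2 * (1 / 2 * \<kappa>\<^sub>0))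
          \<le> (\<Sum>n\<in>Bp. \<Sum>i\<in>I. (c n * x n i)\<^sup>2 * F21_quot (\<bar>c n * x n i\<bar> / (2 * l)))"
          by (rule sum_mono)
        also have "\<dots> \<le> (\<Sum>n\<in>B. \<Sum>i\<in>I. (c n * x n i)\<^sup>2 * F21_quot (\<bar>c n * x n i\<bar> / (2 * l)))"
          using B nn by (intro sum_mono2 sum_nonneg) (auto simp: Bp_def)
        finally show ?thesis .
      qed
      moreover have "3 / 4 * (1 / 2 * \<kappa>\<^sub>0) \<le> (\<Sum>n\<in>Bp. (c n)\<^sup>2 * (1 / 2 * \<kappa>\<^sub>0))"
        unfolding sum_distrib_right[symmetric] using Bp kappa0_pos by (intro mult_right_mono) auto
      moreover have "l\<^sup>2 < \<rho>\<^sup>2" using l by (intro power_strict_mono) auto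
      ultimately show False using \<rho>(3) by linarith
    qed
    have "\<rho> / K * sqrt (\<Sum>n\<in>B. (c n)\<^sup>2) \<le> nrm (\<Sum>n\<in>B. c n *\<^sub>R x n)" for c
    proof -
      define s where "s = sqrt (\<Sum>n\<in>B. (c n)\<^sup>2)"
      have s: "s\<^sup>2 = (\<Sum>n\<in>B. (c n)\<^sup>2)" "0 \<le> s" unfolding s_def by (simp_all add: sum_nonneg)
      show ?thesis
      proof (cases "s = 0")
        case True
        then show ?thesis using nrm_nonneg[OF x_sum_spc] by (simp flip: s_def)
      next
        case False
        have "(\<Sum>n\<in>B. (c n / s)\<^sup>2) = 1"
          using False by (simp add: power_divide s(1)[symmetric] flip: sum_divide_distrib)
        from normalized[OF this] have "\<rho> / K \<le> nrm (\<Sum>n\<in>B. (c n / s) *\<^sub>R x n)" .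
        moreover have "(\<Sum>n\<in>B. (c n / s) *\<^sub>R x n) = inverse s *\<^sub>R (\<Sum>n\<in>B. c n *\<^sub>R x n)"
          by (simp add: scaleR_sum_right divide_inverse mult.commute)
        moreover have "nrm (inverse s *\<^sub>R (\<Sum>n\<in>B. c n *\<^sub>R x n)) = \<bar>inverse s\<bar> * nrm (\<Sum>n\<in>B. c n *\<^sub>R x n)"
          by (rule scale_spc(2)[OF x_sum_spc])
        ultimately have "\<rho> / K \<le> inverse s * nrm (\<Sum>n\<in>B. c n *\<^sub>R x n)" using s(2) by simp
        then have "s * (\<rho> / K) \<le> s * (inverse s * nrm (\<Sum>n\<in>B. c n *\<^sub>R x n))"
          using s(2) by (rule mult_left_mono)
        moreover have "s * (inverse s * nrm (\<Sum>n\<in>B. c n *\<^sub>R x n)) = nrm (\<Sum>n\<in>B. c n *\<^sub>R x n)"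
          using False by simp
        ultimately show ?thesis unfolding s_def[symmetric] by (simp only: mult.commute[of s])
      qed
    qed
    then show ?thesis using B by blast
  qed
  moreover have "0 < \<rho> / K" using \<rho> K_ge_1 by simp
  ultimately show ?thesis by blast
qed

text \<open>On entries above \<open>exp (- L)\<close> squares exceed \<open>F21\<close> by a factor
  of order \<open>L\<close> at most, so the square functions of the vectors truncated to these
  entries have total size of order \<open>L * card B\<close>. At scale \<open>l\<close> of order
  \<open>sqrt (card B)\<close> the quotient gains \<open>1 / ln l\<close>; if \<open>ln l\<close> is
  large compared with \<open>L\<close>, a random sign sum of the truncations has mean norm at most
  \<open>2 * l\<close>. Diagonal extraction carries this over to the sum of the \<open>x n\<close>
  themselves, which contradicts the assumed lower bound.\<close>

lemma card_light_le:
  assumes \<kappa>: "0 < \<kappa>" and sqrt_le: "\<And>E. finite E \<Longrightarrow> \<kappa> * sqrt (real (card E)) \<le> nrm (\<Sum>n\<in>E. x n)"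
  shows "\<exists>C\<ge>1. \<forall>L\<ge>2. \<forall>B. finite B \<longrightarrow> (\<forall>n\<in>B. light n (exp (- L))) \<longrightarrow> real (card B) \<le> exp (C * L)"
proof -
  \<comment> \<open>The argument ends with \<open>\<kappa> * D \<le> 4 * K\<^sup>2\<close>, which
    this \<open>D\<close> violates. \<open>A\<close> collects the constants of the modular estimate,
    and \<open>C\<close> is arranged so that \<open>card B > exp (C * L)\<close> forces
    \<open>ln l \<ge> A * L\<close>.\<close>
  define D where "D = 8 * K\<^sup>2 / \<kappa> + 1"
  define C\<^sub>1 where "C\<^sub>1 = (23 * K\<^sup>2)\<^sup>2"
  define A where "A = K ^ 4 * D\<^sup>2 * (1 + 3 * C\<^sub>1)"
  define C where "C = 2 * A + 2 * ln D"
  have D: "1 \<le> D" using \<kappa> by (simp add: D_def)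
  have C1: "0 \<le> C\<^sub>1" by (simp add: C\<^sub>1_def)
  have A: "1 \<le> A"
  proof -
    have "1 * 1 * 1 \<le> K ^ 4 * D\<^sup>2 * (1 + 3 * C\<^sub>1)"
      using K_ge_1 D C1 by (intro mult_mono one_le_power) auto
    then show ?thesis by (simp add: A_def)
  qed
  have "1 \<le> C" using A D ln_ge_zero[of D] unfolding C_def by linarith
  moreover have "real (card B) \<le> exp (C * L)"
    if L: "2 \<le> L" and B: "finite B" "\<And>n. n \<in> B \<Longrightarrow> light n (exp (- L))" for L B
  proof (rule ccontr)
    assume "\<not> real (card B) \<le> exp (C * L)"
    then have M: "exp (C * L) < real (card B)" by simp
    define l where "l = sqrt (real (card B)) / D"
    have "0 < sqrt (real (card B))" using M exp_gt_zero[of "C * L"] by (simp del: exp_gt_zero)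
    then have l0: "0 < l" using D by (simp add: l_def)
    have l2: "l\<^sup>2 = real (card B) / D\<^sup>2" by (simp add: l_def power_divide)
    have "A * L \<le> ln l"
    proof -
      have "exp (A * L + ln D) \<le> sqrt (real (card B))"
      proof (rule real_le_rsqrt)
        have "(exp (A * L + ln D))\<^sup>2 = exp (2 * (A * L + ln D))"
          by (simp only: exp_double)
        also have "\<dots> \<le> exp (C * L)"
        proof -
          have "2 * ln D * 1 \<le> 2 * ln D * L" using D L by (intro mult_left_mono) auto
          then show ?thesis unfolding C_def by (simp add: algebra_simps)
        qed
        finally show "(exp (A * L + ln D))\<^sup>2 \<le> real (card B)" using M by linarith
      qed
      then have "exp (A * L) * D \<le> sqrt (real (card B))" using D by (simp add: exp_add)
      then have "exp (A * L) \<le> l" using D by (simp add: l_def field_simps)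
      then show ?thesis using l0 ln_mono[of "exp (A * L)" l] by simp
    qed
    have AL: "2 \<le> A * L" using mult_mono[of 1 A 2 L] A L by simp
    have quot_l: "F21_quot (1 / l) = exp (- 1) / ln l"
    proof -
      have "exp 1 \<le> l"
        using \<open>A * L \<le> ln l\<close> AL l0 by (intro ln_ge_iff[THEN iffD1]) auto
      then have "1 / l \<le> exp (- 1)" using l0 by (simp add: exp_minus inverse_eq_divide frac_le)
      then show ?thesis using l0 F21_quot_small[of "1 / l"] by (simp add: ln_div)
    qed
    have quot_L: "F21_quot (exp (- L)) = exp (- 1) / L" using F21_quot_small[of "exp (- L)"] L by simp
    have "\<forall>n\<in>B. \<exists>J. finite J \<and> (\<forall>i\<in>J. exp (- L) < \<bar>x n i\<bar>) \<and> 1 / 2 \<le> \<bar>\<Sum>i\<in>J. b n i * x n i\<bar>"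
      using B(2) by (intro ballI light_imp_heavy_coordinates) auto
    then obtain J where "\<forall>n\<in>B. finite (J n) \<and> (\<forall>i\<in>J n. exp (- L) < \<bar>x n i\<bar>)
        \<and> 1 / 2 \<le> \<bar>\<Sum>i\<in>J n. b n i * x n i\<bar>" unfolding bchoice_iff ..
    then have J: "\<And>n. n \<in> B \<Longrightarrow> finite (J n)" "\<And>n i. n \<in> B \<Longrightarrow> i \<in> J n \<Longrightarrow> exp (- L) < \<bar>x n i\<bar>"
      "\<And>n. n \<in> B \<Longrightarrow> 1 / 2 \<le> \<bar>\<Sum>i\<in>J n. b n i * x n i\<bar>" by auto
    define U where "U = (\<Union>n\<in>B. J n)"
    have U: "finite U" using B J by (simp add: U_def)
    define y where "y n i = (if i \<in> J n then x n i else 0)" for n i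
    define Y where "Y \<theta> i = (\<Sum>n\<in>B. \<theta> n * y n i)" for \<theta> :: "nat \<Rightarrow> real" and i
    have Y_restr: "restr U (Y \<theta>) = Y \<theta>" for \<theta>
    proof
      fix i show "restr U (Y \<theta>) i = Y \<theta> i"
        by (auto simp: restr_def Y_def y_def U_def intro!: sum.neutral)
    qed
    have Y_spc: "Y \<theta> \<in> spc" for \<theta> using restr_spc[OF U, of "Y \<theta>"] by (simp only: Y_restr)
    define H where "H i = (\<Sum>n\<in>B. (y n i)\<^sup>2)" for i
    have H: "0 \<le> H i" "H i \<le> C\<^sub>1" for i
    proof -
      show "0 \<le> H i" unfolding H_def by (rule sum_nonneg) simp
      have "H i \<le> (\<Sum>n\<in>B. (x n i)\<^sup>2)" unfolding H_def by (rule sum_mono) (simp add: y_def)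
      then show "H i \<le> C\<^sub>1" using column_square_sum_le[OF B(1), of i] by (simp add: C\<^sub>1_def)
    qed
    have H_sum: "(\<Sum>i\<in>I. H i) \<le> real (card B) * (K ^ 4 * (exp 1 * L))" if I: "finite I" for I
    proof -
      \<comment> \<open>Above \<open>exp (- L)\<close> the quotient is at least
        \<open>exp (- 1) / L\<close>, so a square is recovered from \<open>F21\<close> at the cost
        of \<open>exp 1 * L\<close>.\<close>
      have sq: "(y n i)\<^sup>2 \<le> exp 1 * L * F21 \<bar>x n i\<bar>" if n: "n \<in> B" for n i
      proof (cases "i \<in> J n")
        case True
        have "exp (- 1) / L \<le> F21_quot \<bar>x n i\<bar>"
          unfolding quot_L[symmetric] using J(2)[OF n True] by (intro F21_quot_mono) auto
        then have "(x n i)\<^sup>2 * (exp (- 1) / L) \<le> (x n i)\<^sup>2 * F21_quot \<bar>x n i\<bar>"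
          by (intro mult_left_mono) auto
        then have "exp 1 * L * ((x n i)\<^sup>2 * (exp (- 1) / L)) \<le> exp 1 * L * F21 \<bar>x n i\<bar>"
          using L by (intro mult_left_mono) (auto simp: F21_eq)
        moreover have "exp 1 * L * ((x n i)\<^sup>2 * (exp (- 1) / L)) = (x n i)\<^sup>2"
          using L by (simp add: exp_minus)
        ultimately show ?thesis using True by (simp add: y_def)
      qed (use L in \<open>auto simp: y_def intro!: mult_nonneg_nonneg F21_nonneg\<close>)
      have "(\<Sum>i\<in>I. H i) = (\<Sum>n\<in>B. \<Sum>i\<in>I. (y n i)\<^sup>2)" unfolding H_def by (rule sum.swap)
      also have "\<dots> \<le> (\<Sum>n\<in>B. \<Sum>i\<in>I. exp 1 * L * F21 \<bar>x n i\<bar>)" by (intro sum_mono sq)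
      also have "\<dots> = (\<Sum>n\<in>B. exp 1 * L * (\<Sum>i\<in>I. F21 \<bar>x n i\<bar>))" by (simp only: sum_distrib_left)
      also have "\<dots> \<le> (\<Sum>n\<in>B. exp 1 * L * K ^ 4)"
        using L I by (intro sum_mono mult_left_mono sum_F21_le) auto
      finally show ?thesis by (simp add: mult_ac)
    qed
    have "sign_avg B (\<lambda>\<theta>. \<Sum>i\<in>I. F21 (\<bar>Y \<theta> i\<bar> / l)) \<le> 1" if I: "finite I" for I
    proof -
      have "sign_avg B (\<lambda>\<theta>. F21 (\<bar>Y \<theta> i\<bar> / l)) \<le> F21_quot (1 / l) / l\<^sup>2 * (1 + 3 * C\<^sub>1) * H i" for i
      proof -
        have q: "0 \<le> F21_quot (1 / l) / l\<^sup>2" using l0 by (intro divide_nonneg_nonneg F21_quot_nonneg) auto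
        have "sign_avg B (\<lambda>\<theta>. F21 (\<bar>Y \<theta> i\<bar> / l))
          \<le> sign_avg B (\<lambda>\<theta>. F21_quot (1 / l) / l\<^sup>2 * (Y \<theta> i)\<^sup>2 + F21_quot (1 / l) / l\<^sup>2 * (Y \<theta> i) ^ 4)"
        proof (rule sign_avg_mono)
          fix A
          let ?t = "Y (signs_of A) i"
          have "F21 (\<bar>?t\<bar> / l) \<le> F21_quot (1 / l) * ((\<bar>?t\<bar> / l)\<^sup>2 + (\<bar>?t\<bar> / l) ^ 4 / (1 / l)\<^sup>2)"
            using l0 by (intro F21_le) auto
          also have "(\<bar>?t\<bar> / l)\<^sup>2 + (\<bar>?t\<bar> / l) ^ 4 / (1 / l)\<^sup>2 = ?t\<^sup>2 / l\<^sup>2 + ?t ^ 4 / l\<^sup>2"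
            using l0 by (simp add: power_divide power4_eq_xxxx power2_eq_square)
          finally show "F21 (\<bar>?t\<bar> / l)
              \<le> F21_quot (1 / l) / l\<^sup>2 * ?t\<^sup>2 + F21_quot (1 / l) / l\<^sup>2 * ?t ^ 4"
            by (simp add: algebra_simps)
        qed
        also have "\<dots> = F21_quot (1 / l) / l\<^sup>2 * sign_avg B (\<lambda>\<theta>. (Y \<theta> i)\<^sup>2)
            + F21_quot (1 / l) / l\<^sup>2 * sign_avg B (\<lambda>\<theta>. (Y \<theta> i) ^ 4)"
          by (simp only: sign_avg_add sign_avg_cmult)
        also have "\<dots> \<le> F21_quot (1 / l) / l\<^sup>2 * H i + F21_quot (1 / l) / l\<^sup>2 * (3 * (H i)\<^sup>2)"
          unfolding Y_def sign_avg_square[OF B(1)] H_def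
          by (intro add_left_mono mult_left_mono sign_avg_fourth_power q B(1))
        \<comment> \<open>The uniform column bound makes the fourth-moment term linear in
          \<open>H i\<close>, so that it can be summed over the coordinates like the second
          moment.\<close>
        also have "\<dots> \<le> F21_quot (1 / l) / l\<^sup>2 * H i + F21_quot (1 / l) / l\<^sup>2 * (3 * (C\<^sub>1 * H i))"
          unfolding power2_eq_square[of "H i"] using H q
          by (intro add_left_mono mult_left_mono mult_right_mono) auto
        also have "\<dots> = F21_quot (1 / l) / l\<^sup>2 * (1 + 3 * C\<^sub>1) * H i" by (simp only: distrib_left distrib_right mult_ac mult_1)
        finally show ?thesis .
      qed
      then have "sign_avg B (\<lambda>\<theta>. \<Sum>i\<in>I. F21 (\<bar>Y \<theta> i\<bar> / l))
          \<le> (\<Sum>i\<in>I. F21_quot (1 / l) / l\<^sup>2 * (1 + 3 * C\<^sub>1) * H i)"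
        unfolding sign_avg_sum by (rule sum_mono)
      also have "\<dots> = F21_quot (1 / l) / l\<^sup>2 * (1 + 3 * C\<^sub>1) * (\<Sum>i\<in>I. H i)"
        by (simp only: sum_distrib_left)
      also have "\<dots> \<le> F21_quot (1 / l) / l\<^sup>2 * (1 + 3 * C\<^sub>1) * (real (card B) * (K ^ 4 * (exp 1 * L)))"
        using l0 C1 by (intro mult_left_mono H_sum I mult_nonneg_nonneg divide_nonneg_nonneg F21_quot_nonneg) auto
      also have "\<dots> = A * L / ln l"
      proof -
        have "real (card B) / l\<^sup>2 = D\<^sup>2" using \<open>0 < sqrt (real (card B))\<close> D by (simp add: l2)
        moreover have "F21_quot (1 / l) / l\<^sup>2 * (1 + 3 * C\<^sub>1) * (real (card B) * (K ^ 4 * (exp 1 * L)))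
            = (exp (- 1) * exp 1) * (K ^ 4 * (real (card B) / l\<^sup>2) * (1 + 3 * C\<^sub>1)) * L / ln l"
          unfolding quot_l by (simp add: field_simps)
        ultimately show ?thesis by (simp add: A_def flip: exp_add)
      qed
      also have "\<dots> \<le> 1" using \<open>A * L \<le> ln l\<close> AL by (simp add: divide_le_eq_1)
      finally show ?thesis .
    qed
    then have avg_Y: "sign_avg B (\<lambda>\<theta>. nrm (Y \<theta>)) \<le> l * (1 + 1)"
      using Y_spc l0 by (intro sign_avg_nrm_le B(1)) auto
    define \<beta> where "\<beta> n = (\<Sum>j\<in>U. b n j * y n j)" for n
    have \<beta>: "1 / 2 \<le> \<bar>\<beta> n\<bar>" if n: "n \<in> B" for n
    proof -
      have "\<beta> n = (\<Sum>j\<in>U. if j \<in> J n then b n j * x n j else 0)"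
        unfolding \<beta>_def by (rule sum.cong) (auto simp: y_def)
      also have "\<dots> = (\<Sum>j\<in>U \<inter> J n. b n j * x n j)" using U by (simp add: sum.inter_restrict)
      also have "U \<inter> J n = J n" using n by (auto simp: U_def)
      finally show ?thesis using J(3)[OF n] by simp
    qed
    \<comment> \<open>Averaging \<open>W\<close> keeps only the diagonal pairings
      \<open>\<beta> n\<close> of \<open>b n\<close> with its own truncation, each of modulus at
      least \<open>1 / 2\<close>.\<close>
    define W where "W \<theta> = (\<Sum>n\<in>B. (\<theta> n * (\<Sum>j\<in>U. b n j * Y \<theta> j)) *\<^sub>R x n)" for \<theta> :: "nat \<Rightarrow> real"
    have "sign_avg B W = (\<Sum>n\<in>B. \<beta> n *\<^sub>R x n)"
    proof -
      have "sign_avg B W = (\<Sum>n\<in>B. sign_avg B (\<lambda>\<theta>. \<theta> n * (\<Sum>j\<in>U. b n j * Y \<theta> j)) *\<^sub>R x n)"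
        unfolding W_def by (simp only: sign_avg_sum sign_avg_scaleR)
      also have "\<dots> = (\<Sum>n\<in>B. \<beta> n *\<^sub>R x n)"
      proof (rule sum.cong)
        fix n assume n: "n \<in> B"
        have "(\<Sum>j\<in>U. b n j * Y \<theta> j) = (\<Sum>m\<in>B. \<theta> m * (\<Sum>j\<in>U. b n j * y m j))" for \<theta> :: "nat \<Rightarrow> real"
          unfolding Y_def sum_distrib_left by (subst sum.swap) (simp add: mult_ac)
        then show "sign_avg B (\<lambda>\<theta>. \<theta> n * (\<Sum>j\<in>U. b n j * Y \<theta> j)) *\<^sub>R x n = \<beta> n *\<^sub>R x n"
          using sign_avg_coordinate[OF B(1) n, of "\<lambda>m. \<Sum>j\<in>U. b n j * y m j"] by (simp add: \<beta>_def)
      qed simp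
      finally show ?thesis .
    qed
    moreover have "nrm (sign_avg B W) \<le> sign_avg B (\<lambda>\<theta>. nrm (W \<theta>))"
      by (rule p_sign_avg_le(1)) (simp only: W_def x_sum_spc)
    moreover have "sign_avg B (\<lambda>\<theta>. nrm (W \<theta>)) \<le> sign_avg B (\<lambda>\<theta>. K * nrm (Y \<theta>))"
    proof (rule sign_avg_mono)
      fix A
      have "nrm (W (signs_of A)) \<le> K * nrm (restr U (Y (signs_of A)))"
        unfolding W_def using B U by (intro multiplier_operator) auto
      then show "nrm (W (signs_of A)) \<le> K * nrm (Y (signs_of A))" by (simp only: Y_restr)
    qed
    moreover have "sign_avg B (\<lambda>\<theta>. K * nrm (Y \<theta>)) \<le> K * (l * (1 + 1))"
      unfolding sign_avg_cmult using avg_Y K_ge_1 by (intro mult_left_mono) auto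
    ultimately have n\<beta>: "nrm (\<Sum>n\<in>B. \<beta> n *\<^sub>R x n) \<le> 2 * K * l" by simp
    \<comment> \<open>Since \<open>\<bar>2 * \<beta> n\<bar> \<ge> 1\<close>, the reciprocals are
      admissible multipliers and turn the coefficients into 1.\<close>
    have "nrm (\<Sum>n\<in>B. (1 / (2 * \<beta> n) * (2 * \<beta> n)) *\<^sub>R x n) \<le> K * nrm (\<Sum>n\<in>B. (2 * \<beta> n) *\<^sub>R x n)"
    proof (rule multiplier[OF B(1)])
      fix n assume n: "n \<in> B"
      have "1 / \<bar>2 * \<beta> n\<bar> \<le> 1" using \<beta>[OF n] by (auto simp: divide_le_eq_1 abs_mult)
      then show "\<bar>1 / (2 * \<beta> n)\<bar> \<le> 1" by simp
    qed
    also have "(\<Sum>n\<in>B. (1 / (2 * \<beta> n) * (2 * \<beta> n)) *\<^sub>R x n) = (\<Sum>n\<in>B. x n)"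
    proof (rule sum.cong)
      fix n assume n: "n \<in> B"
      then have "\<beta> n \<noteq> 0" using \<beta>[OF n] by auto
      then show "(1 / (2 * \<beta> n) * (2 * \<beta> n)) *\<^sub>R x n = x n" by simp
    qed simp
    also have "(\<Sum>n\<in>B. (2 * \<beta> n) *\<^sub>R x n) = 2 *\<^sub>R (\<Sum>n\<in>B. \<beta> n *\<^sub>R x n)"
      by (simp add: scaleR_sum_right)
    also have "nrm \<dots> = 2 * nrm (\<Sum>n\<in>B. \<beta> n *\<^sub>R x n)"
      by (simp only: scale_spc(2)[OF x_sum_spc] abs_numeral)
    finally have "\<kappa> * sqrt (real (card B)) \<le> K * (2 * nrm (\<Sum>n\<in>B. \<beta> n *\<^sub>R x n))"
      using sqrt_le[OF B(1)] by linarith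
    also have "\<dots> \<le> K * (2 * (2 * K * l))"
      using n\<beta> K_ge_1 by (intro mult_left_mono) auto
    also have "\<dots> = 4 * K\<^sup>2 / D * sqrt (real (card B))"
      by (simp add: l_def power2_eq_square)
    finally have "\<kappa> \<le> 4 * K\<^sup>2 / D" using \<open>0 < sqrt (real (card B))\<close>
      by (rule mult_right_le_imp_le)
    then have "\<kappa> * D \<le> 4 * K\<^sup>2" using D by (simp add: field_simps)
    moreover have "\<kappa> * D = 8 * K\<^sup>2 + \<kappa>" using \<kappa> by (simp add: D_def field_simps)
    ultimately show False using \<kappa> by simp (smt (verit) zero_le_power2)
  qed
  ultimately show ?thesis by blast
qed

end

lemma sum_half_powers_le:
  assumes "finite S" "0 \<notin> S"
  shows "(\<Sum>k\<in>S. (1 / 2) ^ k) \<le> (1 :: real)"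
proof -
  have half: "(\<Sum>k\<in>{1..m}. (1 / 2) ^ k) = 1 - (1 / 2 :: real) ^ m" for m
    by (induction m) auto
  have "k \<in> {1..Max S}" if "k \<in> S" for k
    using assms that by (cases "k = 0") auto
  then have "(\<Sum>k\<in>S. (1 / 2) ^ k) \<le> (\<Sum>k\<in>{1..Max S}. (1 / 2 :: real) ^ k)"
    by (intro sum_mono2) auto
  moreover have "0 \<le> (1 / 2 :: real) ^ Max S" by simp
  ultimately show ?thesis unfolding half by linarith
qed

section \<open>Impossibility of a square-root lower bound\<close>

context F21_system
begin

lemma nrm_restr_le_sqrt_card:
  assumes J: "finite J" and v: "\<And>j. j \<in> J \<Longrightarrow> \<bar>v j\<bar> \<le> 1"
  shows "nrm (restr J v) \<le> sqrt (real (card J))"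
proof (cases "J = {}")
  case True
  then have "restr J v = 0" by (simp add: restr_def fun_eq_iff)
  then show ?thesis by (simp add: zero_spc)
next
  case False
  then have c: "1 \<le> real (card J)" using J by (simp add: Suc_leI card_gt_0_iff)
  let ?s = "sqrt (real (card J))"
  have s: "1 \<le> ?s" using c by simp
  have "modular_le (restr J v) ?s"
  proof (rule modular_le_restrI[OF J])
    have "(\<Sum>i\<in>J. F21 (\<bar>v i\<bar> / ?s)) \<le> (\<Sum>i\<in>J. F21 (1 / ?s))"
      using v s by (intro sum_mono M_mono divide_right_mono) auto
    also have "\<dots> = real (card J) * F21 (1 / ?s)" by simp
    also have "\<dots> = F21_quot (1 / ?s)" using c by (simp add: F21_eq power_divide)
    also have "\<dots> \<le> F21_quot 1" using s by (intro F21_quot_mono) auto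
    also have "\<dots> = 1" by (simp add: F21_quot_large)
    finally show "(\<Sum>i\<in>J. F21 (\<bar>v i\<bar> / ?s)) \<le> 1" .
  qed (use s in auto)
  then show ?thesis using s by (intro nrm_le) auto
qed

text \<open>At the scale \<open>l = 2 * sqrt (N / ln N)\<close> one has
  \<open>ln l \<ge> ln N / 4\<close>, because \<open>ln (ln N) \<le> ln N / 2\<close>; the quotient
  \<open>exp (- 1) / ln l\<close> then compensates \<open>N / l\<^sup>2 = ln N / 4\<close>.\<close>

lemma nrm_restr_le_log:
  assumes J: "finite J" and v: "\<And>j. j \<in> J \<Longrightarrow> \<bar>v j\<bar> \<le> 1" and ln4: "4 \<le> ln (real (card J))"
  shows "nrm (restr J v) \<le> 2 * sqrt (real (card J) / ln (real (card J)))"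
proof -
  define N where "N = real (card J)"
  define l where "l = 2 * sqrt (N / ln N)"
  have N: "0 < N" "4 \<le> ln N" using ln4 by (auto simp: N_def intro: ccontr)
  have "0 < ln N" using N by linarith
  with N(1) have q: "0 < N / ln N" by (rule divide_pos_pos)
  then have l: "0 < l" "l\<^sup>2 = 4 * (N / ln N)"
    unfolding l_def power_mult_distrib real_sqrt_pow2[OF less_imp_le[OF q]] by simp_all
  have "ln (l\<^sup>2) = ln (4 * N) - ln (ln N)"
    unfolding l(2) times_divide_eq_right using N(1) \<open>0 < ln N\<close> by (intro ln_divide_pos) auto
  moreover have "ln (l\<^sup>2) = 2 * ln l" by (simp only: ln_realpow of_nat_numeral)
  moreover have "ln N \<le> ln (4 * N)" using N by simp
  moreover have "ln (ln N) \<le> ln N / 2"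
  proof -
    have "ln (ln N / 2) \<le> ln N / 2 - 1" using \<open>0 < ln N\<close> by (intro ln_le_minus_one) simp
    moreover have "ln (ln N / 2) = ln (ln N) - ln 2" using \<open>0 < ln N\<close> by (rule ln_divide_pos) simp
    moreover have "ln 2 \<le> (1::real)" using ln_le_minus_one[of "2::real"] by simp
    ultimately show ?thesis by linarith
  qed
  ultimately have lnl: "ln N / 4 \<le> ln l" by linarith
  then have "1 \<le> ln l" using N by linarith
  then have "exp 1 \<le> l" using l by (intro ln_ge_iff[THEN iffD1]) auto
  then have small: "1 / l \<le> exp (- 1)" using l by (simp add: exp_minus inverse_eq_divide frac_le)
  have "modular_le (restr J v) l"
  proof (rule modular_le_restrI[OF J _ l(1)])
    have "(\<Sum>i\<in>J. F21 (\<bar>v i\<bar> / l)) \<le> (\<Sum>i\<in>J. F21 (1 / l))"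
      using v l by (intro sum_mono M_mono divide_right_mono) auto
    also have "\<dots> = N * F21 (1 / l)" by (simp add: N_def)
    also have "\<dots> = (N / l\<^sup>2) * F21_quot (1 / l)" using l by (simp add: F21_eq power_divide)
    also have "\<dots> = (ln N / 4) * (exp (- 1) / ln l)"
      using l N small F21_quot_small[of "1 / l"] by (simp add: ln_div)
    also have "\<dots> \<le> ln l * (exp (- 1) / ln l)"
      using lnl \<open>1 \<le> ln l\<close> by (intro mult_right_mono) auto
    also have "\<dots> \<le> 1" using \<open>1 \<le> ln l\<close> by simp
    finally show "(\<Sum>i\<in>J. F21 (\<bar>v i\<bar> / l)) \<le> 1" .
  qed
  then show ?thesis using l nrm_le[of "restr J v" l] by (simp add: l_def N_def)
qed

text \<open>On a suitable sign vector carried by \<open>J\<close> the functional is at least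
  \<open>\<epsilon> * card J\<close>, while the norm of that vector is at most
  \<open>sqrt (card J)\<close>.\<close>

lemma finite_large_functional_values:
  assumes \<epsilon>: "0 < \<epsilon>"
  shows "finite {j. \<epsilon> \<le> \<bar>b n j\<bar>}"
proof -
  have "card J \<le> nat \<lfloor>(K / \<epsilon>)\<^sup>2\<rfloor>" if J: "J \<subseteq> {j. \<epsilon> \<le> \<bar>b n j\<bar>}" "finite J" for J
  proof -
    define m where "m = sqrt (real (card J))"
    have m: "0 \<le> m" "m * m = real (card J)" by (auto simp: m_def)
    have "m * m * \<epsilon> = (\<Sum>j\<in>J. \<epsilon>)" by (simp add: m)
    also have "\<dots> \<le> (\<Sum>j\<in>J. \<bar>b n j\<bar>)" using J by (intro sum_mono) auto
    also have "\<dots> = (\<Sum>j\<in>J. b n j * sgn (b n j))" by (simp add: abs_sgn)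
    also have "\<dots> \<le> K * nrm (restr J (\<lambda>j. sgn (b n j)))"
      using functional_le[OF J(2), of n "\<lambda>j. sgn (b n j)"] by linarith
    also have "\<dots> \<le> K * m"
      unfolding m_def using K_ge_1 J(2)
      by (intro mult_left_mono nrm_restr_le_sqrt_card) (auto simp: abs_sgn_eq)
    finally have "m * (m * \<epsilon>) \<le> m * K" by (simp add: mult_ac)
    then have "m * \<epsilon> \<le> K" using m(1) K_ge_1 by (cases "m = 0") auto
    then have "m \<le> K / \<epsilon>" using \<epsilon> by (simp add: field_simps)
    then have "m\<^sup>2 \<le> (K / \<epsilon>)\<^sup>2" using m(1) by (intro power_mono) auto
    then have "real (card J) \<le> (K / \<epsilon>)\<^sup>2" using m(2) by (simp add: power2_eq_square)
    then show ?thesis by linarith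
  qed
  then show ?thesis using finite_if_finite_subsets_card_bdd by blast
qed

text \<open>If a block of unit vectors far out had its coefficient vector \<open>c\<close> carried by vectors
  \<open>x n\<close> living at scale \<open>exp (- k)\<close>, then \<open>square_function_le\<close> would make the block larger than
  \<open>sqrt (N / ln N)\<close> unless \<open>c n\<close> is at most \<open>N\<close> to the power \<open>- k / k\<^sub>0\<close>; by \<open>card_light_le\<close> there
  are too few vectors at each scale for such small coefficients.\<close>

lemma not_sqrt_lower:
  assumes \<kappa>: "0 < \<kappa>" and sqrt_le: "\<And>E. finite E \<Longrightarrow> \<kappa> * sqrt (real (card E)) \<le> nrm (\<Sum>n\<in>E. x n)"
  shows False
proof -
  obtain C where C: "1 \<le> C" and card_light: "\<And>L B. 2 \<le> L \<Longrightarrow> finite B \<Longrightarrow> (\<forall>n\<in>B. light n (exp (- L)))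
      \<Longrightarrow> real (card B) \<le> exp (C * L)"
    using card_light_le[OF assms] by blast
  \<comment> \<open>A lower bound for the square sum of a column of \<open>b\<close>: a partial sum
    of the completeness series exceeds \<open>1 / 2\<close>, and Cauchy-Schwarz divides its square
    by the square sum of the column of \<open>x\<close>.\<close>
  define c\<^sub>2 where "c\<^sub>2 = 1 / (4 * (23 * K\<^sup>2)\<^sup>2)"
  have c2: "0 < c\<^sub>2" using K_ge_1 by (simp add: c\<^sub>2_def)
  \<comment> \<open>\<open>k\<^sub>0\<close> limits the share of \<open>E\<^sub>1\<close> to a
    quarter of the total; it is fixed before \<open>N\<close>, which must be large relative to
    \<open>exp (k\<^sub>0 * (C + 1))\<close>.\<close>
  obtain k\<^sub>0 :: nat where "max 2 (64 * K\<^sup>2 / (\<kappa>\<^sub>0 * c\<^sub>2)) \<le> real k\<^sub>0" using real_arch_simple by blast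
  then have k0: "2 \<le> real k\<^sub>0" "64 * K\<^sup>2 / (\<kappa>\<^sub>0 * c\<^sub>2) \<le> real k\<^sub>0" by auto
  obtain N :: nat where "max (max (exp (real k\<^sub>0 * (C + 1))) (exp 4)) (max (16 * K\<^sup>2) (4 / c\<^sub>2)) \<le> real N"
    using real_arch_simple by blast
  then have N: "exp (real k\<^sub>0 * (C + 1)) \<le> real N" "exp 4 \<le> real N" "16 * K\<^sup>2 \<le> real N" "4 / c\<^sub>2 \<le> real N"
    by auto
  have N0: "0 < real N" using N(2) exp_gt_zero[of "4::real"] by linarith
  \<comment> \<open>With this \<open>t\<close>, the number \<open>exp (- k * t)\<close> is
    \<open>N\<close> to the power \<open>- k / k\<^sub>0\<close>.\<close>
  define t where "t = ln (real N) / real k\<^sub>0"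
  have ln_N: "real k\<^sub>0 * (C + 1) \<le> ln (real N)" "4 \<le> ln (real N)"
    using N(1,2) N0 by (simp_all add: ln_ge_iff)
  have t: "C + 1 \<le> t" "ln (real N) = real k\<^sub>0 * t"
    using ln_N k0 by (auto simp: t_def field_simps)
  \<comment> \<open>These vectors, light already at the coarsest scale, are finitely many; the block
    \<open>A\<close> is placed where their functionals are nearly 0.\<close>
  define P where "P = {n. light n (exp (- real k\<^sub>0))}"
  have finP: "finite P"
  proof -
    have "card B \<le> nat \<lfloor>exp (C * real k\<^sub>0)\<rfloor>" if "B \<subseteq> P" "finite B" for B
    proof -
      have "real (card B) \<le> exp (C * real k\<^sub>0)" using that k0 by (intro card_light) (auto simp: P_def)
      then show ?thesis by linarith
    qed
    then show ?thesis using finite_if_finite_subsets_card_bdd by blast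
  qed
  \<comment> \<open>Summing \<open>\<epsilon>\<close> over the \<open>N\<close> columns of the block
    leaves \<open>1 / (card P + 1)\<close> per coefficient, so the squares over \<open>P\<close>
    contribute at most 1.\<close>
  define \<epsilon> where "\<epsilon> = 1 / (real N * (real (card P) + 1))"
  have \<epsilon>: "0 < \<epsilon>" using N0 by (simp add: \<epsilon>_def add_nonneg_pos)
  have "finite (\<Union>n\<in>P. {j. \<epsilon> \<le> \<bar>b n j\<bar>})" using finP finite_large_functional_values[OF \<epsilon>] by auto
  then have "infinite (- (\<Union>n\<in>P. {j. \<epsilon> \<le> \<bar>b n j\<bar>}))" by (simp add: Compl_eq_Diff_UNIV Diff_infinite_finite)
  from infinite_arbitrarily_large[OF this, of N]
  obtain A where A: "finite A" "card A = N" "A \<subseteq> - (\<Union>n\<in>P. {j. \<epsilon> \<le> \<bar>b n j\<bar>})" by blast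
  have far: "\<bar>b n j\<bar> \<le> \<epsilon>" if "n \<in> P" "j \<in> A" for n j using A(3) that by fastforce
  have "\<forall>\<^sub>F m in sequentially. \<forall>j\<in>A. 1 / 2 < (\<Sum>n<m. x n j * b n j)"
  proof (rule eventually_ball_finite[OF A(1)], rule ballI)
    fix j
    have "(\<lambda>m. \<Sum>n<m. x n j * b n j) \<longlonglongrightarrow> 1" using complete[of j] by (simp add: sums_def)
    then show "\<forall>\<^sub>F m in sequentially. 1 / 2 < (\<Sum>n<m. x n j * b n j)"
      by (rule order_tendstoD) simp
  qed
  then obtain m where m: "\<And>j. j \<in> A \<Longrightarrow> 1 / 2 < (\<Sum>n<m. x n j * b n j)"
    by (auto simp: eventually_sequentially)
  define E where "E = {..<m}"
  have E: "finite E" by (simp add: E_def)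
  have b_l2: "c\<^sub>2 \<le> (\<Sum>n\<in>E. (b n j)\<^sup>2)" if j: "j \<in> A" for j
  proof -
    have "(1 / 2)\<^sup>2 \<le> (\<Sum>n\<in>E. x n j * b n j)\<^sup>2"
      using m[OF j] unfolding E_def by (intro power_mono) auto
    also have "\<dots> \<le> (\<Sum>n\<in>E. (x n j)\<^sup>2) * (\<Sum>n\<in>E. (b n j)\<^sup>2)" by (rule Cauchy_Schwarz_ineq_sum)
    also have "\<dots> \<le> (23 * K\<^sup>2)\<^sup>2 * (\<Sum>n\<in>E. (b n j)\<^sup>2)"
      by (intro mult_right_mono column_square_sum_le E sum_nonneg) auto
    finally have "1 / 4 \<le> (23 * K\<^sup>2)\<^sup>2 * (\<Sum>n\<in>E. (b n j)\<^sup>2)" by (simp add: power_divide)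
    moreover have "0 < (23 * K\<^sup>2)\<^sup>2" using K_ge_1 by simp
    ultimately show ?thesis unfolding c\<^sub>2_def by (simp add: divide_le_eq mult_ac)
  qed
  \<comment> \<open>The mean square sum of the coefficients of a signed block is the sum of the
    column square sums; some choice of signs reaches this mean.\<close>
  have "c\<^sub>2 * real N \<le> sign_avg A (\<lambda>\<theta>. \<Sum>n\<in>E. (\<Sum>j\<in>A. \<theta> j * b n j)\<^sup>2)"
  proof -
    have "c\<^sub>2 * real N = (\<Sum>j\<in>A. c\<^sub>2)" using A by simp
    also have "\<dots> \<le> (\<Sum>j\<in>A. \<Sum>n\<in>E. (b n j)\<^sup>2)" by (intro sum_mono b_l2)
    also have "\<dots> = (\<Sum>n\<in>E. \<Sum>j\<in>A. (b n j)\<^sup>2)" by (rule sum.swap)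
    also have "\<dots> = sign_avg A (\<lambda>\<theta>. \<Sum>n\<in>E. (\<Sum>j\<in>A. \<theta> j * b n j)\<^sup>2)"
      unfolding sign_avg_sum by (simp add: sign_avg_square[OF A(1)])
    finally show ?thesis .
  qed
  from sign_avg_attained[OF A(1) this]
  obtain S where S: "c\<^sub>2 * real N \<le> (\<Sum>n\<in>E. (\<Sum>j\<in>A. signs_of S j * b n j)\<^sup>2)" by blast
  define c where "c n = (\<Sum>j\<in>A. b n j * signs_of S j)" for n
  have total: "c\<^sub>2 * real N \<le> (\<Sum>n\<in>E. (c n)\<^sup>2)" using S by (simp add: c_def mult.commute)
  define l where "l = K * (2 * sqrt (real N / ln (real N)))"
  have l: "0 < l" "l\<^sup>2 = 4 * K\<^sup>2 * real N / ln (real N)"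
  proof -
    have "0 < ln (real N)" using ln_N by linarith
    with N0 have q: "0 < real N / ln (real N)" by (rule divide_pos_pos)
    then have "0 < sqrt (real N / ln (real N))" by simp
    then show "0 < l" using K_ge_1 unfolding l_def by (intro mult_pos_pos) auto
    show "l\<^sup>2 = 4 * K\<^sup>2 * real N / ln (real N)"
      unfolding l_def power_mult_distrib real_sqrt_pow2[OF less_imp_le[OF q]] by simp
  qed
  have nl: "K * nrm (restr A (signs_of S)) \<le> l"
    unfolding l_def using nrm_restr_le_log[of A "signs_of S"] A ln_N K_ge_1
    by (intro mult_left_mono) auto
  have c_le: "\<bar>c n\<bar> \<le> l" for n
    using functional_le[OF A(1), of n "signs_of S"] nl by (simp add: c_def)
  have l_N: "2 * l \<le> real N"
  proof -
    have "l\<^sup>2 \<le> 4 * K\<^sup>2 * real N / 4"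
    proof -
      have "0 < 4 * ln (real N)" using ln_N by linarith
      then show ?thesis unfolding l(2) using ln_N(2) N0
        by (intro divide_left_mono) (auto simp: mult.commute)
    qed
    then have "(2 * l)\<^sup>2 \<le> 4 * K\<^sup>2 * real N" by (simp add: power_mult_distrib)
    also have "\<dots> \<le> (real N)\<^sup>2" using N(3) N0 by (simp add: power2_eq_square)
    finally show ?thesis by (rule power2_le_imp_le) simp
  qed
  \<comment> \<open>\<open>E\<^sub>0\<close> holds the exceptional vectors, \<open>E\<^sub>1\<close>
    those with a coefficient of at least \<open>exp (- k * t)\<close> at some scale where they still
    have mass, and \<open>E\<^sub>2\<close> those whose coefficients fall below the threshold at
    every such scale.\<close>
  define E\<^sub>0 where "E\<^sub>0 = E \<inter> P"
  define E\<^sub>1 where "E\<^sub>1 = {n \<in> E - P. \<exists>k\<ge>k\<^sub>0. \<not> light n (exp (- real k)) \<and> exp (- real k * t) \<le> \<bar>c n\<bar>}"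
  define E\<^sub>2 where "E\<^sub>2 = E - P - E\<^sub>1"
  have sum0: "(\<Sum>n\<in>E\<^sub>0. (c n)\<^sup>2) \<le> 1"
  proof -
    let ?r = "1 / (real (card P) + 1)"
    have "(c n)\<^sup>2 \<le> ?r" if n: "n \<in> E\<^sub>0" for n
    proof -
      have "\<bar>c n\<bar> \<le> (\<Sum>j\<in>A. \<bar>b n j * signs_of S j\<bar>)" unfolding c_def by (rule sum_abs)
      also have "\<dots> \<le> (\<Sum>j\<in>A. \<epsilon>)" using far n by (intro sum_mono) (auto simp: E\<^sub>0_def abs_mult)
      also have "\<dots> = ?r" using A N0 by (simp add: \<epsilon>_def)
      finally have r: "\<bar>c n\<bar> \<le> ?r" .
      moreover have "?r \<le> 1" by simp
      ultimately have "\<bar>c n\<bar> \<le> 1" by (rule order_trans)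
      with r have "\<bar>c n\<bar> * \<bar>c n\<bar> \<le> ?r * 1" by (rule mult_mono) simp_all
      then show ?thesis by (simp add: power2_eq_square)
    qed
    then have "(\<Sum>n\<in>E\<^sub>0. (c n)\<^sup>2) \<le> (\<Sum>n\<in>E\<^sub>0. ?r)" by (rule sum_mono)
    also have "\<dots> \<le> (\<Sum>n\<in>P. ?r)" using finP by (intro sum_mono2) (auto simp: E\<^sub>0_def)
    also have "\<dots> \<le> 1" by simp
    finally show ?thesis .
  qed
  have sum1: "(\<Sum>n\<in>E\<^sub>1. (c n)\<^sup>2) \<le> c\<^sub>2 * real N / 4"
  proof -
    have "\<forall>n\<in>E\<^sub>1. \<exists>k. k\<^sub>0 \<le> k \<and> \<not> light n (exp (- real k)) \<and> exp (- real k * t) \<le> \<bar>c n\<bar>"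
      by (auto simp: E\<^sub>1_def)
    then obtain k where k: "\<forall>n\<in>E\<^sub>1. k\<^sub>0 \<le> k n \<and> \<not> light n (exp (- real (k n))) \<and> exp (- real (k n) * t) \<le> \<bar>c n\<bar>"
      unfolding bchoice_iff ..
    have E1: "finite E\<^sub>1" "E\<^sub>1 \<subseteq> E" using E by (auto simp: E\<^sub>1_def)
    have "\<exists>I. finite I \<and> (\<forall>n\<in>E\<^sub>1. \<kappa>\<^sub>0 < (\<Sum>i\<in>I. if \<bar>x n i\<bar> \<le> exp (- real (k n)) then F21 \<bar>x n i\<bar> else 0))"
      using k by (intro not_light_witness E1) auto
    then obtain I where I: "finite I"
      "\<And>n. n \<in> E\<^sub>1 \<Longrightarrow> \<kappa>\<^sub>0 < (\<Sum>i\<in>I. if \<bar>x n i\<bar> \<le> exp (- real (k n)) then F21 \<bar>x n i\<bar> else 0)"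
      by blast
    \<comment> \<open>For an entry \<open>a \<le> exp (- k n)\<close>, both
      \<open>ln (2 * l) \<le> k\<^sub>0 * t\<close> and
      \<open>- ln \<bar>c n\<bar> \<le> k n * t\<close> are at most \<open>t * (- ln a)\<close>.
      Passing from \<open>a\<close> to \<open>w\<close> therefore multiplies the logarithm by at
      most \<open>1 + 2 * t\<close>.\<close>
    define Q where "Q = 1 + 2 * t"
    have Q: "0 < Q" using t C by (simp add: Q_def)
    have sq: "(\<Sum>n\<in>E. \<Sum>i\<in>I. (c n * x n i)\<^sup>2 * F21_quot (\<bar>c n * x n i\<bar> / (2 * l))) \<le> 4 / 3 * l\<^sup>2"
    proof (rule square_function_le[OF E I(1) l(1)])
      fix B
      have "nrm (\<Sum>n\<in>E. (signs_of B n * c n) *\<^sub>R x n) \<le> K * nrm (restr A (signs_of S))"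
        unfolding c_def using E A by (intro multiplier_operator) auto
      then show "nrm (\<Sum>n\<in>E. (signs_of B n * c n) *\<^sub>R x n) \<le> l" using nl by linarith
    qed
    have nn: "0 \<le> (c n * x n i)\<^sup>2 * F21_quot (\<bar>c n * x n i\<bar> / (2 * l))" for n i
      using l by (intro mult_nonneg_nonneg F21_quot_nonneg) auto
    have "(c n)\<^sup>2 * (\<kappa>\<^sub>0 / Q) \<le> (\<Sum>i\<in>I. (c n * x n i)\<^sup>2 * F21_quot (\<bar>c n * x n i\<bar> / (2 * l)))"
      if n: "n \<in> E\<^sub>1" for n
    proof -
      have kn: "real k\<^sub>0 \<le> real (k n)" "exp (- real (k n) * t) \<le> \<bar>c n\<bar>" using k n by auto
      then have cn: "0 < \<bar>c n\<bar>" using exp_gt_zero[of "- real (k n) * t"] by linarith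
      have "(c n)\<^sup>2 * (\<kappa>\<^sub>0 / Q)
          \<le> (c n)\<^sup>2 * ((\<Sum>i\<in>I. if \<bar>x n i\<bar> \<le> exp (- real (k n)) then F21 \<bar>x n i\<bar> else 0) / Q)"
        using I(2)[OF n] Q by (intro mult_left_mono divide_right_mono) auto
      also have "\<dots> = (\<Sum>i\<in>I. (c n)\<^sup>2 * ((if \<bar>x n i\<bar> \<le> exp (- real (k n)) then F21 \<bar>x n i\<bar> else 0) / Q))"
        by (simp only: sum_distrib_left sum_divide_distrib)
      also have "\<dots> \<le> (\<Sum>i\<in>I. (c n * x n i)\<^sup>2 * F21_quot (\<bar>c n * x n i\<bar> / (2 * l)))"
      proof (rule sum_mono)
        fix i
        show "(c n)\<^sup>2 * ((if \<bar>x n i\<bar> \<le> exp (- real (k n)) then F21 \<bar>x n i\<bar> else 0) / Q)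
          \<le> (c n * x n i)\<^sup>2 * F21_quot (\<bar>c n * x n i\<bar> / (2 * l))"
        proof (cases "\<bar>x n i\<bar> \<le> exp (- real (k n)) \<and> x n i \<noteq> 0")
          case True
          define a where "a = \<bar>x n i\<bar>"
          define w where "w = \<bar>c n\<bar> * a / (2 * l)"
          have a: "0 < a" "a \<le> exp (- real (k n))" using True by (auto simp: a_def)
          have y: "real (k n) \<le> - ln a"
          proof -
            have "ln a \<le> ln (exp (- real (k n)))" using a by (subst ln_le_cancel_iff) auto
            then show ?thesis by simp
          qed
          have a1: "a \<le> exp (- 1)" using a(2) kn k0 by (intro order_trans[OF a(2)]) auto
          have w0: "0 < w" using cn a l by (simp add: w_def)
          have "\<bar>c n\<bar> / (2 * l) \<le> 1" using c_le[of n] l by (simp add: divide_le_eq_1)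
          then have "\<bar>c n\<bar> / (2 * l) * a \<le> 1 * a" using a by (intro mult_right_mono) auto
          then have w1: "w \<le> exp (- 1)" using a1 by (simp add: w_def)
          have "ln w = ln \<bar>c n\<bar> + ln a - ln (2 * l)"
            using cn a l by (simp add: w_def ln_div ln_mult)
          moreover have "- real (k n) * t \<le> ln \<bar>c n\<bar>"
            using kn(2) cn by (intro ln_ge_iff[THEN iffD2]) auto
          moreover have "ln (2 * l) \<le> ln (real N)" using l_N l by (subst ln_le_cancel_iff) (use N0 in auto)
          ultimately have "- ln w \<le> - ln a + real k\<^sub>0 * t + real (k n) * t" using t(2) by simp
          also have "\<dots> \<le> - ln a + (- ln a) * t + (- ln a) * t"
            using y kn t C by (intro add_mono mult_right_mono) auto
          finally have lw: "- ln w \<le> (- ln a) * Q" by (simp add: Q_def algebra_simps)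
          have pos: "0 < - ln w" "0 < - ln a"
            using minus_ln_ge_1[OF w0 w1] minus_ln_ge_1[OF a(1) a1] by linarith+
          have "F21_quot a / Q = exp (- 1) / ((- ln a) * Q)"
            unfolding F21_quot_small[OF a(1) a1] by simp
          also have "\<dots> \<le> exp (- 1) / (- ln w)"
            by (rule divide_left_mono[OF lw _ mult_pos_pos[OF mult_pos_pos[OF pos(2) Q] pos(1)]]) simp
          also have "\<dots> = F21_quot w" by (rule F21_quot_small[OF w0 w1, symmetric])
          finally have "(c n * x n i)\<^sup>2 * (F21_quot a / Q) \<le> (c n * x n i)\<^sup>2 * F21_quot w"
            by (intro mult_left_mono) auto
          moreover have "(c n)\<^sup>2 * (F21 \<bar>x n i\<bar> / Q) = (c n * x n i)\<^sup>2 * (F21_quot a / Q)"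
            by (simp add: F21_eq a_def power_mult_distrib)
          moreover have "\<bar>c n * x n i\<bar> / (2 * l) = w" by (simp add: w_def a_def abs_mult)
          ultimately show ?thesis using True by (simp only: if_True)
        next
          case False
          then have "(c n)\<^sup>2 * ((if \<bar>x n i\<bar> \<le> exp (- real (k n)) then F21 \<bar>x n i\<bar> else 0) / Q) = 0" by auto
          then show ?thesis using nn[of n i] by (simp only:)
        qed
      qed
      finally show ?thesis .
    qed
    then have "(\<Sum>n\<in>E\<^sub>1. (c n)\<^sup>2 * (\<kappa>\<^sub>0 / Q))
        \<le> (\<Sum>n\<in>E\<^sub>1. \<Sum>i\<in>I. (c n * x n i)\<^sup>2 * F21_quot (\<bar>c n * x n i\<bar> / (2 * l)))"
      by (rule sum_mono)
    also have "\<dots> \<le> (\<Sum>n\<in>E. \<Sum>i\<in>I. (c n * x n i)\<^sup>2 * F21_quot (\<bar>c n * x n i\<bar> / (2 * l)))"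
      using E E1 nn by (intro sum_mono2 sum_nonneg) auto
    finally have "(\<Sum>n\<in>E\<^sub>1. (c n)\<^sup>2) * (\<kappa>\<^sub>0 / Q) \<le> 4 / 3 * l\<^sup>2"
      using sq unfolding sum_distrib_right by linarith
    then have "(\<Sum>n\<in>E\<^sub>1. (c n)\<^sup>2) \<le> 4 / 3 * l\<^sup>2 * Q / \<kappa>\<^sub>0"
      using Q kappa0_pos by (simp add: field_simps)
    also have "\<dots> \<le> 4 / 3 * l\<^sup>2 * (3 * t) / \<kappa>\<^sub>0"
      using t C kappa0_pos by (intro divide_right_mono mult_left_mono) (auto simp: Q_def)
    also have "\<dots> = 16 * K\<^sup>2 * real N / (\<kappa>\<^sub>0 * real k\<^sub>0)"
      using t C k0 by (simp add: l(2) field_simps)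
    also have "\<dots> \<le> c\<^sub>2 * real N / 4"
    proof -
      have "64 * K\<^sup>2 \<le> real k\<^sub>0 * (\<kappa>\<^sub>0 * c\<^sub>2)" using k0(2) kappa0_pos c2 by (simp add: pos_divide_le_eq)
      then have "64 * K\<^sup>2 * real N \<le> real k\<^sub>0 * (\<kappa>\<^sub>0 * c\<^sub>2) * real N" using N0 by (intro mult_right_mono) auto
      moreover have "0 < \<kappa>\<^sub>0 * real k\<^sub>0" using kappa0_pos k0 by simp
      ultimately show ?thesis by (simp add: pos_divide_le_eq mult_ac)
    qed
    finally show ?thesis .
  qed
  have sum2: "(\<Sum>n\<in>E\<^sub>2. (c n)\<^sup>2) \<le> 1"
  proof -
    define G where "G = {n\<in>E\<^sub>2. c n \<noteq> 0}"
    have G: "finite G" using E by (simp add: G_def E\<^sub>2_def)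
    \<comment> \<open>The first scale at which \<open>x n\<close> is light. It cannot be
      \<open>k\<^sub>0\<close>, as \<open>n\<close> lies outside \<open>P\<close>; hence the
      preceding scale is still at least \<open>k\<^sub>0\<close>, is not light, and yields the bound
      on \<open>c n\<close>.\<close>
    define k where "k n = (LEAST k. k\<^sub>0 \<le> k \<and> light n (exp (- real k)))" for n
    have kn: "k\<^sub>0 < k n \<and> light n (exp (- real (k n))) \<and> (c n)\<^sup>2 \<le> exp (- (C + 1) * real (k n))"
      if n: "n \<in> G" for n
    proof -
      have small: "\<bar>c n\<bar> < exp (- real j * t)" if "k\<^sub>0 \<le> j" "\<not> light n (exp (- real j))" for j
      proof (rule ccontr)
        assume "\<not> \<bar>c n\<bar> < exp (- real j * t)"
        then have "exp (- real j * t) \<le> \<bar>c n\<bar>" by simp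
        moreover have "n \<in> E - P" using n by (auto simp: G_def E\<^sub>2_def)
        ultimately have "n \<in> E\<^sub>1" using that unfolding E\<^sub>1_def by blast
        then show False using n by (auto simp: G_def E\<^sub>2_def)
      qed
      have c0: "0 < \<bar>c n\<bar>" using n by (simp add: G_def)
      \<comment> \<open>A vector light at no scale would have its coefficient below
        \<open>exp (- j * t)\<close> for all \<open>j \<ge> k\<^sub>0\<close>, hence equal to 0;
        such indices were left out of \<open>G\<close>.\<close>
      have "\<exists>j. k\<^sub>0 \<le> j \<and> light n (exp (- real j))"
      proof (rule ccontr)
        assume none: "\<not> (\<exists>j. k\<^sub>0 \<le> j \<and> light n (exp (- real j)))"
        obtain j :: nat where j: "max (real k\<^sub>0) (- ln \<bar>c n\<bar>) \<le> real j" using real_arch_simple by blast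
        then have "\<bar>c n\<bar> < exp (- real j * t)" using none by (intro small) auto
        then have "ln \<bar>c n\<bar> < - real j * t" using c0 by (metis exp_less_cancel_iff exp_ln)
        moreover have "real j * 1 \<le> real j * t" using t C by (intro mult_left_mono) auto
        ultimately show False using j by simp
      qed
      from LeastI_ex[OF this] have k1: "k\<^sub>0 \<le> k n" "light n (exp (- real (k n)))" by (auto simp: k_def)
      have "k n \<noteq> k\<^sub>0" using n k1(2) by (auto simp: G_def E\<^sub>2_def P_def)
      then have k2: "k\<^sub>0 < k n" using k1 by simp
      have "\<not> (k\<^sub>0 \<le> k n - 1 \<and> light n (exp (- real (k n - 1))))"
        using k2 unfolding k_def by (intro not_less_Least) (simp add: k_def[symmetric])
      then have "\<bar>c n\<bar> < exp (- real (k n - 1) * t)" using k2 by (intro small) auto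
      then have "\<bar>c n\<bar>\<^sup>2 \<le> (exp (- real (k n - 1) * t))\<^sup>2" by (intro power_mono) auto
      also have "\<dots> = exp (2 * (- real (k n - 1) * t))" by (simp only: exp_double)
      also have "\<dots> \<le> exp (- (C + 1) * real (k n))"
      proof -
        have "real (k n) \<le> 2 * real (k n - 1)" using k2 k0 by (simp add: of_nat_diff)
        then have "(C + 1) * real (k n) \<le> t * (2 * real (k n - 1))"
          using t C by (intro mult_mono) auto
        moreover have "2 * (- real (k n - 1) * t) = - (t * (2 * real (k n - 1)))" by algebra
        moreover have "- (C + 1) * real (k n) = - ((C + 1) * real (k n))" by (rule mult_minus_left)
        ultimately show ?thesis unfolding exp_le_cancel_iff by linarith
      qed
      finally show ?thesis using k1 k2 by simp
    qed
    have "(\<Sum>n\<in>E\<^sub>2. (c n)\<^sup>2) = (\<Sum>n\<in>G. (c n)\<^sup>2)"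
      using E by (intro sum.mono_neutral_right) (auto simp: G_def E\<^sub>2_def)
    also have "\<dots> \<le> (\<Sum>n\<in>G. exp (- (C + 1) * real (k n)))" using kn by (intro sum_mono) auto
    also have "\<dots> = (\<Sum>j\<in>k ` G. \<Sum>n\<in>{n\<in>G. k n = j}. exp (- (C + 1) * real (k n)))"
      by (rule sum.image_gen[OF G])
    also have "\<dots> \<le> (\<Sum>j\<in>k ` G. (1 / 2) ^ j)"
    proof (rule sum_mono)
      fix j assume "j \<in> k ` G"
      then have j: "2 \<le> real j" using kn k0 by force
      have "(\<Sum>n\<in>{n\<in>G. k n = j}. exp (- (C + 1) * real (k n)))
          = real (card {n\<in>G. k n = j}) * exp (- (C + 1) * real j)" by simp
      \<comment> \<open>The exponent \<open>C + 1\<close> beats the number of vectors at scale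
        \<open>j\<close> by a factor \<open>exp (- j)\<close>, which is summable.\<close>
      also have "\<dots> \<le> exp (C * real j) * exp (- (C + 1) * real j)"
        using kn G j by (intro mult_right_mono card_light) auto
      also have "\<dots> = exp (- 1) ^ j"
        by (simp add: algebra_simps flip: exp_add exp_of_nat_mult)
      also have "\<dots> \<le> (1 / 2) ^ j"
      proof (rule power_mono)
        have "2 \<le> exp (1::real)" using exp_ge_add_one_self[of 1] by simp
        then show "exp (- 1) \<le> (1 / 2 :: real)" by (simp add: exp_minus field_simps)
      qed auto
      finally show "(\<Sum>n\<in>{n\<in>G. k n = j}. exp (- (C + 1) * real (k n))) \<le> (1 / 2) ^ j" .
    qed
    also have "\<dots> \<le> 1" using G kn k0 by (intro sum_half_powers_le) force+
    finally show ?thesis .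
  qed
  have "(\<Sum>n\<in>E. (c n)\<^sup>2) = (\<Sum>n\<in>E\<^sub>0. (c n)\<^sup>2) + ((\<Sum>n\<in>E\<^sub>1. (c n)\<^sup>2) + (\<Sum>n\<in>E\<^sub>2. (c n)\<^sup>2))"
  proof -
    have "E = E\<^sub>0 \<union> (E\<^sub>1 \<union> E\<^sub>2)" "E\<^sub>0 \<inter> (E\<^sub>1 \<union> E\<^sub>2) = {}" "E\<^sub>1 \<inter> E\<^sub>2 = {}"
      by (auto simp: E\<^sub>0_def E\<^sub>1_def E\<^sub>2_def)
    then show ?thesis using E by (metis finite_Un sum.union_disjoint)
  qed
  then have "c\<^sub>2 * real N \<le> 1 + (c\<^sub>2 * real N / 4 + 1)" using total sum0 sum1 sum2 by linarith
  moreover have "4 \<le> c\<^sub>2 * real N" using N(4) c2 by (simp add: field_simps)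
  ultimately show False by linarith
qed

end

section \<open>Duality\<close>

text \<open>With \<open>q = \<bar>f\<bar> / t\<close> and \<open>t\<close> the norm of a finite
  part, the test vector \<open>M q / q\<close> with the signs of \<open>f\<close> plays the role of
  the derivative of \<open>M\<close>. The hypothesis on \<open>G\<close> bounds its norm by
  \<open>C\<close>, and its pairing with \<open>f\<close> is \<open>t\<close> times the modular.
  This modular is at least \<open>1 / D\<close>, because at half the scale it exceeds 1.\<close>

lemma (in orlicz_delta2) dual_norm_le:
  assumes "orlicz G" and C: "1 \<le> C" and R: "0 \<le> R"
    and G_le: "\<And>q. 0 \<le> q \<Longrightarrow> q \<le> 1 \<Longrightarrow> G (M q / q) \<le> C * M q"
    and pair: "\<And>J w. finite J \<Longrightarrow> \<bar>\<Sum>j\<in>J. f j * w j\<bar> \<le> R * orlicz_norm G (restr J w)"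
  shows "f \<in> spc" "nrm f \<le> D * C * R"
proof -
  interpret G: orlicz G by fact
  have finite_part: "nrm (restr J f) \<le> D * C * R" if J: "finite J" for J
  proof (cases "nrm (restr J f) = 0")
    case True
    then show ?thesis using D_ge_1 C R by simp
  next
    case False
    define t where "t = nrm (restr J f)"
    have t: "0 < t" using False nrm_nonneg[OF restr_spc[OF J]] by (simp add: t_def less_le)
    define q where "q j = \<bar>f j\<bar> / t" for j
    have q: "0 \<le> q j" for j using t by (simp add: q_def)
    have q1: "q j \<le> 1" if "j \<in> J" for j
      using abs_coordinate_le[OF restr_spc[OF J], of f j] that t by (simp add: q_def t_def restr_def)
    have le1: "(\<Sum>j\<in>J. M (q j)) \<le> 1"
      using modular_le_restrD[OF modular_le_nrm[OF restr_spc[OF J] _ t] J] by (simp add: t_def q_def)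
    have "\<not> (\<Sum>j\<in>J. M (\<bar>f j\<bar> / (t / 2))) \<le> 1"
    proof
      assume "(\<Sum>j\<in>J. M (\<bar>f j\<bar> / (t / 2))) \<le> 1"
      then have "modular_le (restr J f) (t / 2)" using J t by (intro modular_le_restrI) auto
      then have "nrm (restr J f) \<le> t / 2" using t by (intro nrm_le) auto
      then show False using t by (simp add: t_def)
    qed
    then have "1 < (\<Sum>j\<in>J. M (2 * q j))" by (simp add: q_def mult.commute)
    also have "\<dots> \<le> (\<Sum>j\<in>J. D * M (q j))" using q q1 by (intro sum_mono delta2) auto
    also have "\<dots> = D * (\<Sum>j\<in>J. M (q j))" by (simp only: sum_distrib_left)
    finally have ge: "1 \<le> D * (\<Sum>j\<in>J. M (q j))" by simp
    define w where "w j = sgn (f j) * (M (q j) / q j)" for j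
    have abs_w: "\<bar>w j\<bar> \<le> M (q j) / q j" for j
      using M_nonneg[OF q] q by (auto simp: w_def abs_mult abs_sgn_eq)
    have "G.modular_le (restr J w) C"
    proof (rule G.modular_le_restrI[OF J])
      have "(\<Sum>j\<in>J. G (\<bar>w j\<bar> / C)) \<le> (\<Sum>j\<in>J. M (q j))"
      proof (rule sum_mono)
        fix j assume j: "j \<in> J"
        have "G (\<bar>w j\<bar> / C) \<le> G (M (q j) / q j / C)"
          using abs_w C by (intro G.M_mono divide_right_mono) auto
        also have "\<dots> = G (inverse C * (M (q j) / q j))" by (simp add: field_simps)
        also have "\<dots> \<le> inverse C * G (M (q j) / q j)"
          using C M_nonneg[OF q] q by (intro G.M_scale_le) (auto simp: inverse_le_1_iff)
        also have "\<dots> \<le> inverse C * (C * M (q j))"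
          using C q q1[OF j] by (intro mult_left_mono G_le) auto
        also have "\<dots> = M (q j)" using C by simp
        finally show "G (\<bar>w j\<bar> / C) \<le> M (q j)" .
      qed
      then show "(\<Sum>j\<in>J. G (\<bar>w j\<bar> / C)) \<le> 1" using le1 by linarith
    qed (use C in auto)
    then have nw: "G.nrm (restr J w) \<le> C" using C by (intro G.nrm_le) auto
    have "t * (\<Sum>j\<in>J. M (q j)) = (\<Sum>j\<in>J. f j * w j)"
      unfolding sum_distrib_left
    proof (rule sum.cong)
      fix j
      have "f j * w j = \<bar>f j\<bar> * (M (q j) / q j)" by (simp add: w_def abs_sgn mult.assoc)
      also have "\<bar>f j\<bar> = t * q j" using t by (simp add: q_def)
      also have "t * q j * (M (q j) / q j) = t * M (q j)" by (cases "q j = 0") auto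
      finally show "t * M (q j) = f j * w j" by simp
    qed simp
    also have "\<dots> \<le> R * G.nrm (restr J w)" using pair[OF J, of w] by linarith
    also have "\<dots> \<le> R * C" using nw R by (rule mult_left_mono)
    finally have "D * (t * (\<Sum>j\<in>J. M (q j))) \<le> D * (R * C)" using D_ge_1 by (intro mult_left_mono) auto
    moreover have "t * 1 \<le> t * (D * (\<Sum>j\<in>J. M (q j)))" using ge t by (intro mult_left_mono) auto
    ultimately show ?thesis by (simp add: t_def mult_ac)
  qed
  have "modular_le f t" if t: "D * C * R < t" "0 < t" for t
    unfolding modular_le_def
  proof (intro allI impI)
    fix E :: "nat set" assume E: "finite E"
    show "(\<Sum>i\<in>E. M (\<bar>f i\<bar> / t)) \<le> 1"
      by (rule modular_le_restrD[OF modular_le_nrm[OF restr_spc[OF E]] E])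
        (use finite_part[OF E] t in auto)
  qed
  note lim = nrm_le_lim[of "D * C * R" f, OF this]
  have "0 \<le> D * C * R" using D_ge_1 C R by simp
  then show "f \<in> spc" "nrm f \<le> D * C * R" using lim by auto
qed

text \<open>An encoding of convex conjugacy up to constants: Young's inequality for the Hoelder
  bound, and its near equality at the points \<open>F q / q\<close> and \<open>G q / q\<close> for
  the norming vectors. The unit interval suffices since normalized coordinates have modulus at most
  1.\<close>

locale orlicz_dual_pair = F: orlicz_delta2 F D + G: orlicz_delta2 G D' for F D G D' +
  fixes C :: real
  assumes C_ge_1: "1 \<le> C"
    and young: "0 \<le> s \<Longrightarrow> s \<le> 1 \<Longrightarrow> 0 \<le> t \<Longrightarrow> t \<le> 1 \<Longrightarrow> s * t \<le> C * (F s + G t)"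
    and G_dual_le: "0 \<le> q \<Longrightarrow> q \<le> 1 \<Longrightarrow> G (F q / q) \<le> C * F q"
    and F_dual_le: "0 \<le> q \<Longrightarrow> q \<le> 1 \<Longrightarrow> F (G q / q) \<le> C * G q"
begin

lemma holder:
  assumes f: "f \<in> F.spc" and w: "w \<in> G.spc" and J: "finite J"
  shows "\<bar>\<Sum>j\<in>J. f j * w j\<bar> \<le> 2 * C * F.nrm f * G.nrm w"
proof (cases "F.nrm f = 0 \<or> G.nrm w = 0")
  case True
  then have "f = 0 \<or> w = 0" using F.p_eq_0_iff[OF f] G.p_eq_0_iff[OF w] by auto
  then have "(\<Sum>j\<in>J. f j * w j) = 0" by (auto intro: sum.neutral)
  then show ?thesis using True by auto
next
  case False
  let ?s = "F.nrm f" and ?t = "G.nrm w"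
  have pos: "0 < ?s" "0 < ?t" using False F.nrm_nonneg[OF f] G.nrm_nonneg[OF w] by (auto simp: less_le)
  have "\<bar>\<Sum>j\<in>J. f j * w j\<bar> \<le> (\<Sum>j\<in>J. \<bar>f j * w j\<bar>)" by (rule sum_abs)
  also have "\<dots> \<le> (\<Sum>j\<in>J. ?s * ?t * (C * (F (\<bar>f j\<bar> / ?s) + G (\<bar>w j\<bar> / ?t))))"
  proof (rule sum_mono)
    fix j
    have "\<bar>f j\<bar> / ?s * (\<bar>w j\<bar> / ?t) \<le> C * (F (\<bar>f j\<bar> / ?s) + G (\<bar>w j\<bar> / ?t))"
      using pos F.abs_coordinate_le[OF f, of j] G.abs_coordinate_le[OF w, of j]
      by (intro young) (auto simp: divide_le_eq_1)
    then have "?s * ?t * (\<bar>f j\<bar> / ?s * (\<bar>w j\<bar> / ?t)) \<le> ?s * ?t * (C * (F (\<bar>f j\<bar> / ?s) + G (\<bar>w j\<bar> / ?t)))"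
      using pos by (intro mult_left_mono) auto
    then show "\<bar>f j * w j\<bar> \<le> ?s * ?t * (C * (F (\<bar>f j\<bar> / ?s) + G (\<bar>w j\<bar> / ?t)))"
      using pos by (simp add: abs_mult)
  qed
  also have "\<dots> = ?s * ?t * (C * ((\<Sum>j\<in>J. F (\<bar>f j\<bar> / ?s)) + (\<Sum>j\<in>J. G (\<bar>w j\<bar> / ?t))))"
    by (simp add: sum.distrib flip: sum_distrib_left)
  also have "\<dots> \<le> ?s * ?t * (C * (1 + 1))"
    using pos C_ge_1 F.modular_leD[OF F.modular_le_nrm[OF f order_refl pos(1)] J]
      G.modular_leD[OF G.modular_le_nrm[OF w order_refl pos(2)] J]
    by (intro mult_left_mono add_mono) auto
  finally show ?thesis by (simp add: mult_ac)
qed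

lemma dual_norm_F:
  assumes "0 \<le> R" "\<And>J w. finite J \<Longrightarrow> \<bar>\<Sum>j\<in>J. f j * w j\<bar> \<le> R * G.nrm (restr J w)"
  shows "f \<in> F.spc" "F.nrm f \<le> D * C * R"
  using F.dual_norm_le[OF G.orlicz_axioms C_ge_1 assms(1) G_dual_le assms(2)] by auto

lemma dual_norm_G:
  assumes "0 \<le> R" "\<And>J w. finite J \<Longrightarrow> \<bar>\<Sum>j\<in>J. f j * w j\<bar> \<le> R * F.nrm (restr J w)"
  shows "f \<in> G.spc" "G.nrm f \<le> D' * C * R"
  using G.dual_norm_le[OF F.orlicz_axioms C_ge_1 assms(1) F_dual_le assms(2)] by auto

text \<open>Biorthogonality identifies the pairing of coefficients with the coordinatewise pairing
  of the two sums, whose partial sums obey the Hoelder bound.\<close>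

lemma biorthogonal_pairing_le:
  assumes "uncond_system G x b K" and E: "finite E" and f: "(\<Sum>n\<in>E. c n *\<^sub>R b n) \<in> F.spc"
  shows "\<bar>\<Sum>n\<in>E. c n * a n\<bar> \<le> 2 * C * F.nrm (\<Sum>n\<in>E. c n *\<^sub>R b n) * G.nrm (\<Sum>n\<in>E. a n *\<^sub>R x n)"
proof -
  interpret S: uncond_system G x b K by fact
  let ?f = "\<Sum>n\<in>E. c n *\<^sub>R b n" and ?w = "\<Sum>n\<in>E. a n *\<^sub>R x n"
  have "(\<lambda>j. \<Sum>m\<in>E. \<Sum>n\<in>E. c m * a n * (b m j * x n j)) sums (\<Sum>m\<in>E. \<Sum>n\<in>E. c m * a n * of_bool (m = n))"
    by (intro sums_sum sums_mult S.biorthogonal)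
  moreover have "(\<Sum>m\<in>E. \<Sum>n\<in>E. c m * a n * of_bool (m = n)) = (\<Sum>n\<in>E. c n * a n)"
  proof (rule sum.cong)
    fix m assume "m \<in> E"
    have "(\<Sum>n\<in>E. c m * a n * of_bool (m = n)) = (\<Sum>n\<in>E. if m = n then c m * a n else 0)"
      by (rule sum.cong) auto
    then show "(\<Sum>n\<in>E. c m * a n * of_bool (m = n)) = c m * a m"
      using E \<open>m \<in> E\<close> by (simp add: sum.delta)
  qed simp
  moreover have "(\<Sum>m\<in>E. \<Sum>n\<in>E. c m * a n * (b m j * x n j)) = ?f j * ?w j" for j
  proof -
    have "?f j * ?w j = (\<Sum>m\<in>E. c m * b m j) * (\<Sum>n\<in>E. a n * x n j)" by simp
    also have "\<dots> = (\<Sum>m\<in>E. \<Sum>n\<in>E. c m * a n * (b m j * x n j))"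
      unfolding sum_product by (simp only: mult_ac)
    finally show ?thesis by simp
  qed
  ultimately have "(\<lambda>j. ?f j * ?w j) sums (\<Sum>n\<in>E. c n * a n)" by simp
  then have "(\<lambda>N. \<bar>\<Sum>j<N. ?f j * ?w j\<bar>) \<longlonglongrightarrow> \<bar>\<Sum>n\<in>E. c n * a n\<bar>"
    unfolding sums_def by (rule tendsto_rabs)
  then show ?thesis
    by (rule LIMSEQ_le_const2) (use holder[OF f S.x_sum_spc] in blast)
qed

text \<open>Every norm of a combination of the \<open>b n\<close> is tested on finitely supported
  vectors \<open>w\<close>. There the multiplier moves to the other side of the pairing and acts on
  a combination of the \<open>x n\<close>, which is controlled by the given system.\<close>

lemma transposed_system:
  assumes "uncond_system G x b K"
  shows "\<exists>K'. uncond_system F b x K'"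
proof -
  interpret S: uncond_system G x b K by fact
  have b: "b n \<in> F.spc" "F.nrm (b n) \<le> D * C * K" for n
    using dual_norm_F[of K "b n"] S.functional_le S.K_ge_1 by auto
  have b_sum: "(\<Sum>n\<in>E. c n *\<^sub>R b n) \<in> F.spc" for c E using b by auto
  define K' where "K' = D * C * (2 * C * K)"
  have DC: "1 \<le> D * C" using F.D_ge_1 C_ge_1 mult_mono[of 1 D 1 C] by simp
  have CK: "1 \<le> C * K" using S.K_ge_1 C_ge_1 mult_mono[of 1 C 1 K] by simp
  have K': "K \<le> 2 * C * K" "2 * C * K \<le> K'" "D * C * K \<le> K'" "1 \<le> K'"
  proof -
    show 1: "K \<le> 2 * C * K" using mult_right_mono[OF C_ge_1, of K] S.K_ge_1 by simp
    show 2: "2 * C * K \<le> K'" using mult_right_mono[OF DC, of "2 * C * K"] CK by (simp add: K'_def mult_ac)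
    show "D * C * K \<le> K'" unfolding K'_def using 1 DC by (intro mult_left_mono) auto
    show "1 \<le> K'" using 2 CK by simp
  qed
  have test_vector: "G.nrm (\<Sum>n\<in>E. (\<theta> n * (\<Sum>j\<in>J. b n j * w j)) *\<^sub>R x n) \<le> K * G.nrm (restr J w)"
    if "finite E" "finite J" "\<And>n. n \<in> E \<Longrightarrow> \<bar>\<theta> n\<bar> \<le> 1" for E J and \<theta> w :: "nat \<Rightarrow> real"
    using that by (rule S.multiplier_operator)
  have "uncond_system F b x K'"
  proof unfold_locales
    show "1 \<le> K'" by (rule K'(4))
    show "b n \<in> F.spc" "F.nrm (b n) \<le> K'" for n using b[of n] K' by auto
    show "F.nrm (\<Sum>n\<in>E. (\<theta> n * c n) *\<^sub>R b n) \<le> K' * F.nrm (\<Sum>n\<in>E. c n *\<^sub>R b n)"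
      if E: "finite E" and \<theta>: "\<And>n. n \<in> E \<Longrightarrow> \<bar>\<theta> n\<bar> \<le> 1" for E and \<theta> c :: "nat \<Rightarrow> real"
    proof -
      let ?g = "\<Sum>n\<in>E. c n *\<^sub>R b n"
      have g0: "0 \<le> F.nrm ?g" by (rule F.nrm_nonneg[OF b_sum])
      have "\<bar>\<Sum>j\<in>J. (\<Sum>n\<in>E. (\<theta> n * c n) *\<^sub>R b n) j * w j\<bar> \<le> (2 * C * K * F.nrm ?g) * G.nrm (restr J w)"
        if J: "finite J" for J w
      proof -
        let ?\<beta> = "\<lambda>n. \<Sum>j\<in>J. b n j * w j"
        have "(\<Sum>j\<in>J. (\<Sum>n\<in>E. (\<theta> n * c n) *\<^sub>R b n) j * w j) = (\<Sum>j\<in>J. \<Sum>n\<in>E. c n * (\<theta> n * (b n j * w j)))"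
          by (simp add: sum_distrib_left sum_distrib_right mult_ac)
        also have "\<dots> = (\<Sum>n\<in>E. \<Sum>j\<in>J. c n * (\<theta> n * (b n j * w j)))" by (rule sum.swap)
        also have "\<dots> = (\<Sum>n\<in>E. c n * (\<theta> n * ?\<beta> n))" by (simp only: sum_distrib_left)
        finally have "\<bar>\<Sum>j\<in>J. (\<Sum>n\<in>E. (\<theta> n * c n) *\<^sub>R b n) j * w j\<bar>
            \<le> 2 * C * F.nrm ?g * G.nrm (\<Sum>n\<in>E. (\<theta> n * ?\<beta> n) *\<^sub>R x n)"
          using biorthogonal_pairing_le[OF assms E b_sum, of c "\<lambda>n. \<theta> n * ?\<beta> n"] by simp
        also have "\<dots> \<le> 2 * C * F.nrm ?g * (K * G.nrm (restr J w))"
          using g0 C_ge_1 E J \<theta> by (intro mult_left_mono test_vector) auto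
        finally show ?thesis by (simp add: mult_ac)
      qed
      then have "F.nrm (\<Sum>n\<in>E. (\<theta> n * c n) *\<^sub>R b n) \<le> D * C * (2 * C * K * F.nrm ?g)"
        using g0 CK by (intro dual_norm_F(2)) auto
      then show ?thesis by (simp add: K'_def mult_ac)
    qed
    show "F.nrm (\<Sum>n\<in>E. (\<theta> n * (\<Sum>j\<in>J. x n j * v j)) *\<^sub>R b n) \<le> K' * F.nrm (restr J v)"
      if E: "finite E" and J: "finite J" and \<theta>: "\<And>n. n \<in> E \<Longrightarrow> \<bar>\<theta> n\<bar> \<le> 1"
      for E J and \<theta> v :: "nat \<Rightarrow> real"
    proof -
      let ?\<xi> = "\<lambda>n. \<Sum>j\<in>J. x n j * v j"
      have v0: "0 \<le> F.nrm (restr J v)" by (rule F.nrm_nonneg[OF F.restr_spc[OF J]])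
      have "\<bar>\<Sum>i\<in>I. (\<Sum>n\<in>E. (\<theta> n * ?\<xi> n) *\<^sub>R b n) i * w i\<bar> \<le> (2 * C * K * F.nrm (restr J v)) * G.nrm (restr I w)"
        if I: "finite I" for I w
      proof -
        let ?\<beta> = "\<lambda>n. \<Sum>i\<in>I. b n i * w i"
        let ?w = "\<Sum>n\<in>E. (\<theta> n * ?\<beta> n) *\<^sub>R x n"
        have "(\<Sum>i\<in>I. (\<Sum>n\<in>E. (\<theta> n * ?\<xi> n) *\<^sub>R b n) i * w i)
            = (\<Sum>i\<in>I. \<Sum>n\<in>E. (\<theta> n * ?\<xi> n) * (b n i * w i))"
          by (simp add: sum_distrib_right mult.assoc)
        also have "\<dots> = (\<Sum>n\<in>E. \<Sum>i\<in>I. (\<theta> n * ?\<xi> n) * (b n i * w i))" by (rule sum.swap)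
        also have "\<dots> = (\<Sum>n\<in>E. (\<theta> n * ?\<xi> n) * ?\<beta> n)" by (simp only: sum_distrib_left)
        also have "\<dots> = (\<Sum>n\<in>E. (\<theta> n * ?\<beta> n) * ?\<xi> n)" by (simp only: mult_ac)
        also have "\<dots> = (\<Sum>n\<in>E. \<Sum>j\<in>J. (\<theta> n * ?\<beta> n) * (x n j * v j))" by (simp only: sum_distrib_left)
        also have "\<dots> = (\<Sum>j\<in>J. \<Sum>n\<in>E. (\<theta> n * ?\<beta> n) * (x n j * v j))" by (rule sum.swap)
        also have "\<dots> = (\<Sum>j\<in>J. restr J v j * ?w j)"
          by (rule sum.cong) (simp_all add: restr_def sum_distrib_left mult_ac)
        finally have "\<bar>\<Sum>i\<in>I. (\<Sum>n\<in>E. (\<theta> n * ?\<xi> n) *\<^sub>R b n) i * w i\<bar>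
            \<le> 2 * C * F.nrm (restr J v) * G.nrm ?w"
          using holder[OF F.restr_spc[OF J] S.x_sum_spc J] by (simp only:)
        also have "\<dots> \<le> 2 * C * F.nrm (restr J v) * (K * G.nrm (restr I w))"
          using v0 C_ge_1 E I \<theta> by (intro mult_left_mono test_vector) auto
        finally show ?thesis by (simp add: mult_ac)
      qed
      then have "F.nrm (\<Sum>n\<in>E. (\<theta> n * ?\<xi> n) *\<^sub>R b n) \<le> D * C * (2 * C * K * F.nrm (restr J v))"
        using v0 CK by (intro dual_norm_F(2)) auto
      then show ?thesis by (simp add: K'_def mult_ac)
    qed
    show "\<bar>\<Sum>j\<in>J. x n j * v j\<bar> \<le> K' * F.nrm (restr J v)" if J: "finite J" for J n v
    proof -
      have v0: "0 \<le> F.nrm (restr J v)" by (rule F.nrm_nonneg[OF F.restr_spc[OF J]])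
      have "(\<Sum>j\<in>J. x n j * v j) = (\<Sum>j\<in>J. restr J v j * x n j)"
        by (rule sum.cong) (auto simp: restr_def)
      then have "\<bar>\<Sum>j\<in>J. x n j * v j\<bar> \<le> 2 * C * F.nrm (restr J v) * G.nrm (x n)"
        using holder[OF F.restr_spc[OF J] S.x_spc J] by (simp only:)
      also have "\<dots> \<le> 2 * C * F.nrm (restr J v) * K"
        using v0 C_ge_1 S.nrm_x by (intro mult_left_mono) auto
      also have "\<dots> = (2 * C * K) * F.nrm (restr J v)" by (simp add: mult_ac)
      also have "\<dots> \<le> K' * F.nrm (restr J v)" using K'(2) v0 by (rule mult_right_mono)
      finally show ?thesis .
    qed
    show "(\<lambda>j. x m j * b n j) sums of_bool (m = n)" for m n
      using S.biorthogonal[of n m] by (simp add: mult.commute eq_commute)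
    show "(\<lambda>n. b n j * x n j) sums 1" for j
      using S.complete[of j] by (simp add: mult.commute)
  qed
  then show ?thesis by blast
qed

end


section \<open>Uniqueness of the greedy basis\<close>

lemma (in orlicz_delta2) has_unique_greedy_basisI:
  assumes "\<And>x. greedy_basis spc nrm x \<Longrightarrow> semi_normalized nrm x \<Longrightarrow> equivalent_bases nrm x unit_seq"
  shows "has_unique_greedy_basis spc nrm"
  unfolding has_unique_greedy_basis_def
  using assms banach_space_on_spc greedy_unit_seq semi_normalized_unit_seq by blast

lemma has_unique_greedy_basis_F21: "has_unique_greedy_basis (orlicz_space F21) (orlicz_norm F21)"
proof (rule F21.has_unique_greedy_basisI)
  fix x assume x: "greedy_basis F21.spc F21.nrm x" "semi_normalized F21.nrm x"
  define b where "b n j = coord F21.nrm x n (unit_seq j)" for n j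
  obtain K where "uncond_system F21 x b K"
    using F21.greedy_basis_uncond_system[OF x] unfolding b_def by blast
  then interpret F21_system x b K by (simp add: F21_system_def)
  show "equivalent_bases F21.nrm x unit_seq"
  proof (cases "\<exists>\<delta>>0. \<forall>n. \<exists>j. \<delta> \<le> \<bar>x n j * b n j\<bar>")
    case True
    then show ?thesis using equivalent_unit_seq by blast
  next
    case False
    then have "\<And>\<delta>. 0 < \<delta> \<Longrightarrow> \<exists>n. \<forall>j. \<bar>x n j * b n j\<bar> < \<delta>" by (meson not_le)
    from flat_imp_lower_l2[OF this] obtain \<kappa> where \<kappa>: "0 < \<kappa>"
      "\<forall>N. \<exists>B. finite B \<and> card B = N \<and> (\<forall>c. \<kappa> * sqrt (\<Sum>n\<in>B. (c n)\<^sup>2) \<le> F21.nrm (\<Sum>n\<in>B. c n *\<^sub>R x n))"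
      by blast
    obtain d where d: "1 \<le> d"
      "\<forall>A B. finite A \<longrightarrow> finite B \<longrightarrow> card A = card B \<longrightarrow> F21.nrm (\<Sum>n\<in>A. x n) \<le> d * F21.nrm (\<Sum>n\<in>B. x n)"
      using F21.greedy_basis_democratic[OF x] by blast
    have False
    proof (rule not_sqrt_lower)
      show "0 < \<kappa> / d" using \<kappa> d by simp
      fix E :: "nat set" assume E: "finite E"
      obtain B where B: "finite B" "card B = card E"
        "\<forall>c. \<kappa> * sqrt (\<Sum>n\<in>B. (c n)\<^sup>2) \<le> F21.nrm (\<Sum>n\<in>B. c n *\<^sub>R x n)" using \<kappa>(2) by blast
      have "\<kappa> * sqrt (real (card E)) \<le> F21.nrm (\<Sum>n\<in>B. x n)" using B(3)[rule_format, of "\<lambda>_. 1"] B(2) by simp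
      also have "\<dots> \<le> d * F21.nrm (\<Sum>n\<in>E. x n)" using d B E by blast
      finally show "\<kappa> / d * sqrt (real (card E)) \<le> F21.nrm (\<Sum>n\<in>E. x n)" using d by (simp add: field_simps)
    qed
    then show ?thesis ..
  qed
qed

text \<open>A greedy basis of the space of \<open>G\<close> is treated through its transposed system in the space of
  \<^term>\<open>F21\<close>: lower \<open>l\<^sub>2\<close>-estimates there are upper estimates here, and democracy spreads them
  to all finite sets.\<close>

lemma has_unique_greedy_basis_dual:
  assumes "orlicz_dual_pair F21 16 G D C"
  shows "has_unique_greedy_basis (orlicz_space G) (orlicz_norm G)"
proof -
  interpret P: orlicz_dual_pair F21 16 G D C by fact
  show ?thesis
  proof (rule P.G.has_unique_greedy_basisI)
    fix x assume x: "greedy_basis P.G.spc P.G.nrm x" "semi_normalized P.G.nrm x"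
    define b where "b n j = coord P.G.nrm x n (unit_seq j)" for n j
    obtain K where sys: "uncond_system G x b K"
      using P.G.greedy_basis_uncond_system[OF x] unfolding b_def by blast
    then interpret S: uncond_system G x b K .
    obtain K' where "uncond_system F21 b x K'" using P.transposed_system[OF sys] by blast
    then interpret T: F21_system b x K' by (simp add: F21_system_def)
    show "equivalent_bases P.G.nrm x unit_seq"
    proof (cases "\<exists>\<delta>>0. \<forall>n. \<exists>j. \<delta> \<le> \<bar>x n j * b n j\<bar>")
      case True
      then show ?thesis using S.equivalent_unit_seq by blast
    next
      case False
      then have "\<And>\<delta>. 0 < \<delta> \<Longrightarrow> \<exists>n. \<forall>j. \<bar>b n j * x n j\<bar> < \<delta>" by (metis not_le mult.commute)
      from T.flat_imp_lower_l2[OF this] obtain \<kappa> where \<kappa>: "0 < \<kappa>"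
        "\<forall>N. \<exists>B. finite B \<and> card B = N \<and> (\<forall>c. \<kappa> * sqrt (\<Sum>n\<in>B. (c n)\<^sup>2) \<le> F21.nrm (\<Sum>n\<in>B. c n *\<^sub>R b n))"
        by blast
      obtain d where d: "1 \<le> d"
        "\<forall>A B. finite A \<longrightarrow> finite B \<longrightarrow> card A = card B \<longrightarrow> P.G.nrm (\<Sum>n\<in>A. x n) \<le> d * P.G.nrm (\<Sum>n\<in>B. x n)"
        using P.G.greedy_basis_democratic[OF x] by blast
      define T' where "T' = d * (D * C * (K' / \<kappa>))"
      have T': "0 < T'"
        using d P.G.D_ge_1 P.C_ge_1 T.K_ge_1 \<kappa> unfolding T'_def by (intro mult_pos_pos divide_pos_pos) auto
      have upper: "P.G.nrm (\<Sum>n\<in>E. x n) \<le> T' * sqrt (real (card E))" if E: "finite E" for E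
      proof -
        obtain B where B: "finite B" "card B = card E"
          "\<forall>c. \<kappa> * sqrt (\<Sum>n\<in>B. (c n)\<^sup>2) \<le> F21.nrm (\<Sum>n\<in>B. c n *\<^sub>R b n)" using \<kappa>(2) by blast
        let ?r = "sqrt (real (card E))"
        have "\<bar>\<Sum>j\<in>J. (\<Sum>n\<in>B. x n) j * w j\<bar> \<le> (K' / \<kappa> * ?r) * F21.nrm (restr J w)"
          if J: "finite J" for J w
        proof -
          \<comment> \<open>The lower estimate for the \<open>b n\<close> bounds the square sum of
            these coefficients by the norm of the test vector; Cauchy-Schwarz against the constant 1
            then gives the square root of the cardinality.\<close>
          define \<xi> where "\<xi> n = (\<Sum>j\<in>J. x n j * w j)" for n
          have "(\<Sum>j\<in>J. (\<Sum>n\<in>B. x n) j * w j) = (\<Sum>n\<in>B. \<xi> n)"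
            unfolding \<xi>_def by (subst sum.swap) (simp add: sum_distrib_right)
          also have "\<bar>\<dots>\<bar> = sqrt ((\<Sum>n\<in>B. 1 * \<xi> n)\<^sup>2)" by simp
          also have "\<dots> \<le> sqrt ((\<Sum>n\<in>B. 1\<^sup>2) * (\<Sum>n\<in>B. (\<xi> n)\<^sup>2))"
            by (intro real_sqrt_le_mono Cauchy_Schwarz_ineq_sum)
          also have "\<dots> = ?r * sqrt (\<Sum>n\<in>B. (\<xi> n)\<^sup>2)" by (simp add: real_sqrt_mult B(2))
          also have "\<dots> \<le> ?r * (K' * F21.nrm (restr J w) / \<kappa>)"
          proof (rule mult_left_mono)
            have "\<kappa> * sqrt (\<Sum>n\<in>B. (\<xi> n)\<^sup>2) \<le> F21.nrm (\<Sum>n\<in>B. (1 * \<xi> n) *\<^sub>R b n)" using B(3) by simp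
            also have "\<dots> \<le> K' * F21.nrm (restr J w)"
              unfolding \<xi>_def using B(1) J by (intro T.multiplier_operator) auto
            finally show "sqrt (\<Sum>n\<in>B. (\<xi> n)\<^sup>2) \<le> K' * F21.nrm (restr J w) / \<kappa>"
              using \<kappa> by (simp add: field_simps)
          qed simp
          finally show ?thesis by (simp add: mult_ac)
        qed
        then have "P.G.nrm (\<Sum>n\<in>B. x n) \<le> D * C * (K' / \<kappa> * ?r)"
          using \<kappa> T.K_ge_1 by (intro P.dual_norm_G(2)) auto
        then have "d * P.G.nrm (\<Sum>n\<in>B. x n) \<le> d * (D * C * (K' / \<kappa> * ?r))"
          using d by (intro mult_left_mono) auto
        moreover have "P.G.nrm (\<Sum>n\<in>E. x n) \<le> d * P.G.nrm (\<Sum>n\<in>B. x n)" using d B E by metis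
        ultimately show ?thesis by (simp add: T'_def mult_ac)
      qed
      have False
      proof (rule T.not_sqrt_lower)
        show "0 < 1 / (2 * C * T')" using T' P.C_ge_1 by simp
        fix E :: "nat set" assume E: "finite E"
        let ?r = "sqrt (real (card E))"
        have n0: "0 \<le> F21.nrm (\<Sum>n\<in>E. b n)" using T.x_sum_spc[of "\<lambda>_. 1" E] by (intro F21.nrm_nonneg) simp
        \<comment> \<open>The pairing of the two sums is exactly \<open>card E\<close>, so an upper
          square-root bound for the \<open>x n\<close> becomes a lower one for the
          \<open>b n\<close>.\<close>
        have "?r * ?r = \<bar>\<Sum>n\<in>E. 1 * 1\<bar>" by simp
        also have "\<dots> \<le> 2 * C * F21.nrm (\<Sum>n\<in>E. 1 *\<^sub>R b n) * P.G.nrm (\<Sum>n\<in>E. 1 *\<^sub>R x n)"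
          by (rule P.biorthogonal_pairing_le[OF sys E T.x_sum_spc])
        also have "\<dots> = 2 * C * F21.nrm (\<Sum>n\<in>E. b n) * P.G.nrm (\<Sum>n\<in>E. x n)" by simp
        also have "\<dots> \<le> 2 * C * F21.nrm (\<Sum>n\<in>E. b n) * (T' * ?r)"
          using n0 P.C_ge_1 by (intro mult_left_mono upper E) auto
        finally have "?r * ?r \<le> (2 * C * T' * F21.nrm (\<Sum>n\<in>E. b n)) * ?r" by (simp add: mult_ac)
        then have "?r \<le> 2 * C * T' * F21.nrm (\<Sum>n\<in>E. b n)"
        proof (cases "?r = 0")
          case True
          then show ?thesis using n0 T' P.C_ge_1 by (auto intro!: mult_nonneg_nonneg)
        next
          case False
          then have "0 < ?r" by simp
          with \<open>?r * ?r \<le> _\<close> show ?thesis by (rule mult_right_le_imp_le)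
        qed
        then show "1 / (2 * C * T') * ?r \<le> F21.nrm (\<Sum>n\<in>E. b n)"
          using T' P.C_ge_1 by (simp add: field_simps)
      qed
      then show ?thesis ..
    qed
  qed
qed

text \<open>For small \<open>q\<close> put \<open>v = F21 q / q\<close> and
  \<open>y = - ln q\<close>. Then \<open>- ln v = 1 + y + ln y\<close> lies between \<open>y\<close>
  and \<open>2 * y\<close>, so \<open>G v = v\<^sup>2 * (- ln v)\<close> is comparable with
  \<open>F21 q\<close>. Larger arguments cost only constants; 18 is dictated by the bound
  \<open>G (exp (- 3 / 2)) \<ge> 1 / 18\<close>.\<close>

lemma orlicz_dual_pair_F21:
  assumes "convex_orlicz_function G"
    and G: "\<And>t. 0 < t \<Longrightarrow> t \<le> exp (- 3 / 2) \<Longrightarrow> G t = t\<^sup>2 * (- ln t)"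
  shows "\<exists>D. orlicz_dual_pair F21 16 G D 18"
proof -
  interpret G: orlicz G by unfold_locales fact
  have e3: "exp 1 \<le> (3::real)" using exp_le by simp
  have e13: "(1::real) / 3 \<le> exp (- 1)" using e3 by (simp add: exp_minus field_simps)
  have e2: "exp (- 2) = exp (- 1) * exp (- 1 :: real)" by (simp flip: exp_add)
  define t\<^sub>0 :: real where "t\<^sub>0 = exp (- 3 / 2) / 2"
  have t0: "0 < t\<^sub>0" "t\<^sub>0 \<le> exp (- 3 / 2)" by (auto simp: t\<^sub>0_def)
  have "ln t\<^sub>0 < 0"
  proof -
    have "exp (- 3 / 2) \<le> (1::real)" by simp
    then have "t\<^sub>0 < 1" using t0(1) unfolding t\<^sub>0_def by linarith
    then show ?thesis using t0 by simp
  qed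
  then have Gt0: "0 < G t\<^sub>0" using G[OF t0] t0 by (simp add: mult_pos_neg)
  \<comment> \<open>The explicit formula gives the factor 4 as long as \<open>2 * t\<close> stays in
    its range; beyond \<open>t\<^sub>0\<close>, \<open>G\<close> lies between the positive number
    \<open>G t\<^sub>0\<close> and \<open>G 2\<close>.\<close>
  define D where "D = max 4 (G 2 / G t\<^sub>0)"
  interpret G: orlicz_delta2 G D
  proof unfold_locales
    fix t :: real assume t: "0 \<le> t" "t \<le> 1"
    consider "t = 0" | "0 < t" "t \<le> t\<^sub>0" | "t\<^sub>0 < t" using t by linarith
    then show "G (2 * t) \<le> D * G t"
    proof cases
      case 2
      have "G (2 * t) = (2 * t)\<^sup>2 * (- ln (2 * t))" using 2 by (intro G) (auto simp: t\<^sub>0_def)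
      also have "\<dots> \<le> (2 * t)\<^sup>2 * (- ln t)" using 2 by (intro mult_left_mono) auto
      also have "\<dots> = 4 * G t" using G[of t] 2 t0 by (simp add: power_mult_distrib)
      also have "\<dots> \<le> D * G t" using t by (intro mult_right_mono G.M_nonneg) (auto simp: D_def)
      finally show ?thesis .
    next
      case 3
      have "G (2 * t) \<le> G 2" using t by (intro G.M_mono) auto
      also have "\<dots> = G 2 / G t\<^sub>0 * G t\<^sub>0" using Gt0 by simp
      also have "\<dots> \<le> D * G t"
        using 3 t0 Gt0 by (intro mult_mono G.M_mono) (auto simp: D_def)
      finally show ?thesis .
    qed simp
  qed
  have F_over: "F21 q / q = q * F21_quot q" if "0 < q" for q
    using that by (simp add: F21_eq power2_eq_square)
  have small: "0 < q * F21_quot q" "q * F21_quot q \<le> exp (- 2)" "q * F21_quot q \<le> exp (- 3 / 2)"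
    "- ln (q * F21_quot q) = 1 - ln q + ln (- ln q)"
    if q: "0 < q" "q \<le> exp (- 1)" for q
  proof -
    show "0 < q * F21_quot q" using q F21_quot_pos by simp
    have "F21_quot q \<le> F21_quot (exp (- 1))" using q by (intro F21_quot_mono) auto
    then have "q * F21_quot q \<le> exp (- 1) * exp (- 1)"
      using q F21_quot_pos[OF q(1)] by (intro mult_mono) (auto simp: F21_quot_large)
    then show le: "q * F21_quot q \<le> exp (- 2)" by (simp add: e2)
    have "exp (- 2) \<le> exp (- 3 / 2 :: real)" by simp
    with le show "q * F21_quot q \<le> exp (- 3 / 2)" by linarith
    have y: "0 < - ln q" using minus_ln_ge_1[OF q] by linarith
    have "ln (q * (exp (- 1) / - ln q)) = ln q + (ln (exp (- 1)) - ln (- ln q))"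
      by (simp only: ln_mult_pos[OF q(1) divide_pos_pos[OF exp_gt_zero y]] ln_divide_pos[OF exp_gt_zero y])
    then show "- ln (q * F21_quot q) = 1 - ln q + ln (- ln q)"
      using F21_quot_small[OF q] by simp
  qed
  have G_ge: "G s / s \<le> G t / t" if st: "0 < s" "s \<le> t" for s t
  proof -
    have "G (s / t * t) \<le> s / t * G t" using st by (intro G.M_scale_le) auto
    then show ?thesis using st by (simp add: field_simps)
  qed
  have "orlicz_dual_pair F21 16 G D 18"
  proof unfold_locales
    fix s t :: real assume s: "0 \<le> s" "s \<le> 1" and t: "0 \<le> t" "t \<le> 1"
    have F0: "0 \<le> F21 s" and G0: "0 \<le> G t" using s t by (auto intro: F21_nonneg G.M_nonneg)
    show "s * t \<le> 18 * (F21 s + G t)"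
    \<comment> \<open>The threshold is \<open>t = F21 s / s\<close>: up to it
      \<open>s * t \<le> F21 s\<close> is immediate, and beyond it \<open>s\<close> is compared with
      \<open>G t / t\<close>, which increases in \<open>t\<close>.\<close>
    proof (cases "s = 0 \<or> t \<le> s * F21_quot s")
      case True
      have "s * t \<le> F21 s"
      proof (cases "s = 0")
        case False
        then have "s * t \<le> s * (s * F21_quot s)" using True s by (intro mult_left_mono) auto
        then show ?thesis using s by (simp add: F21_eq power2_eq_square mult.assoc)
      qed (use F0 in simp)
      also have "\<dots> \<le> 18 * (F21 s + G t)" using F0 G0 by simp
      finally show ?thesis .
    next
      case False
      then have s0: "0 < s" and tv: "s * F21_quot s \<le> t" using s by auto
      have v0: "0 < s * F21_quot s" using s0 F21_quot_pos by simp
      then have t0: "0 < t" using tv by linarith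
      have "s \<le> 18 * (G t / t)"
      proof (cases "s \<le> exp (- 1)")
        case True
        note v = small[OF s0 True]
        have y: "1 \<le> - ln s" by (rule minus_ln_ge_1[OF s0 True])
        have "exp (- 1) * s = (s * F21_quot s) * (- ln s)"
          unfolding F21_quot_small[OF s0 True] using y by simp
        also have "\<dots> \<le> (s * F21_quot s) * (- ln (s * F21_quot s))"
          using v0 y unfolding v(4) by (intro mult_left_mono) auto
        also have "\<dots> = G (s * F21_quot s) / (s * F21_quot s)"
          using G[OF v(1,3)] v0 by (simp add: power2_eq_square)
        also have "\<dots> \<le> G t / t" by (rule G_ge[OF v0 tv])
        finally have "exp (- 1) * s \<le> G t / t" .
        moreover have "1 / 3 * s \<le> exp (- 1) * s" using e13 s0 by (intro mult_right_mono) auto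
        moreover have "0 \<le> G t / t" using G0 t0 by simp
        ultimately show ?thesis by linarith
      next
        case False
        then have "s * F21_quot s = s * s" by (simp add: F21_quot_large)
        moreover have "exp (- 1) * exp (- 1) \<le> s * s" using False s0 by (intro mult_mono) auto
        ultimately have "exp (- 2) \<le> t" using tv e2 by linarith
        then have "G (exp (- 2)) / exp (- 2) \<le> G t / t" by (intro G_ge) auto
        moreover have "G (exp (- 2)) / exp (- 2) = 2 * exp (- 2)"
          using G[of "exp (- 2)"] by (simp add: power2_eq_square)
        moreover have "1 / 3 * (1 / 3) \<le> exp (- 1) * exp (- 1 :: real)" using e13 by (intro mult_mono) auto
        ultimately show ?thesis using s e2 by linarith
      qed
      then have "s * t \<le> 18 * (G t / t) * t" using t by (intro mult_right_mono) auto
      then show ?thesis using t0 F0 by simp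
    qed
  next
    fix q :: real assume q: "0 \<le> q" "q \<le> 1"
    show "G (F21 q / q) \<le> 18 * F21 q"
    proof (cases "q = 0")
      case False
      then have q0: "0 < q" using q by simp
      have F0: "0 \<le> F21 q" using q by (rule_tac F21_nonneg)
      show ?thesis
      proof (cases "q \<le> exp (- 1)")
        case True
        note v = small[OF q0 True]
        define y where "y = - ln q"
        have y: "1 \<le> y" using minus_ln_ge_1[OF q0 True] by (simp add: y_def)
        have "ln y \<le> y - 1" using y by (intro ln_le_minus_one) auto
        then have ln_v: "- ln (q * F21_quot q) \<le> 2 * y" using v(4) by (simp add: y_def)
        have quot: "F21_quot q * y = exp (- 1)"
          using F21_quot_small[OF q0 True] y by (simp add: y_def)
        have "G (F21 q / q) = (q * F21_quot q)\<^sup>2 * (- ln (q * F21_quot q))"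
          unfolding F_over[OF q0] by (rule G[OF v(1,3)])
        also have "\<dots> \<le> (q * F21_quot q)\<^sup>2 * (2 * y)" using ln_v by (intro mult_left_mono) auto
        also have "\<dots> = 2 * (F21_quot q * y) * F21 q"
          using q by (simp add: F21_eq power2_eq_square)
        also have "\<dots> = 2 * exp (- 1) * F21 q" by (simp only: quot)
        also have "\<dots> \<le> 18 * F21 q"
        proof (rule mult_right_mono[OF _ F0])
          have "exp (- 1) \<le> (1::real)" by simp
          then show "2 * exp (- 1) \<le> (18::real)" by linarith
        qed
        finally show ?thesis .
      next
        case False
        then have quot: "F21_quot q = q" by (simp add: F21_quot_large)
        have "G (F21 q / q) = G (q * q)" unfolding F_over[OF q0] quot ..
        also have "\<dots> \<le> q * q" using q by (intro G.M_le_self mult_le_one) auto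
        also have "\<dots> \<le> q * q * (18 * q)"
        proof -
          have "1 \<le> 18 * q" using False e13 by linarith
          then have "q * q * 1 \<le> q * q * (18 * q)" using q by (intro mult_left_mono) auto
          then show ?thesis by simp
        qed
        also have "\<dots> = 18 * F21 q" using q by (simp add: F21_eq quot power2_eq_square)
        finally show ?thesis .
      qed
    qed simp
    show "F21 (G q / q) \<le> 18 * G q"
    proof (cases "q = 0")
      case False
      then have q0: "0 < q" using q by simp
      have G0: "0 \<le> G q" using q by (intro G.M_nonneg)
      show ?thesis
      proof (cases "q \<le> exp (- 3 / 2)")
        case True
        define y where "y = - ln q"
        have q_exp: "q = exp (- y)" using q0 by (simp add: y_def)
        have y: "3 / 2 \<le> y"
        proof -
          have "ln q \<le> ln (exp (- 3 / 2))" using q0 True by (subst ln_le_cancel_iff) auto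
          then show ?thesis by (simp add: y_def)
        qed
        have w: "G q / q = q * y" using G[OF q0 True] q0 by (simp add: y_def power2_eq_square)
        have w0: "0 < q * y" using q0 y by simp
        have w1: "q * y \<le> exp (- 1)"
        proof -
          have "y \<le> exp (y - 1)" using exp_ge_add_one_self[of "y - 1"] by simp
          then have "exp (- y) * y \<le> exp (- y) * exp (y - 1)" by (intro mult_left_mono) auto
          also have "\<dots> = exp (- 1)" by (simp flip: exp_add)
          finally show ?thesis by (simp add: q_exp)
        qed
        have "ln (y / 2) \<le> y / 2 - 1" using y by (intro ln_le_minus_one) auto
        moreover have "ln (y / 2) = ln y - ln 2" using y by (intro ln_divide_pos) auto
        moreover have "ln 2 \<le> (1::real)" using ln_le_minus_one[of "2::real"] by simp
        ultimately have "ln y \<le> y / 2" by linarith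
        moreover have "ln (q * y) = - y + ln y" 
        proof -
          have "0 < y" using y by linarith
          from ln_mult_pos[OF q0 this] show ?thesis by (simp add: y_def)
        qed
        ultimately have ln_w: "y / 2 \<le> - ln (q * y)" by linarith
        have "F21_quot (q * y) * y \<le> 2"
        proof -
          have "F21_quot (q * y) = exp (- 1) / - ln (q * y)" by (rule F21_quot_small[OF w0 w1])
          also have "\<dots> \<le> exp (- 1) / (y / 2)"
          proof (rule divide_left_mono[OF ln_w])
            have "0 < - ln (q * y)" using ln_w y by linarith
            then show "0 < - ln (q * y) * (y / 2)" using y by (intro mult_pos_pos) auto
          qed simp
          finally have "F21_quot (q * y) * y \<le> exp (- 1) / (y / 2) * y" using y by (intro mult_right_mono) auto
          also have "\<dots> = 2 * exp (- 1)" using y by simp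
          also have "\<dots> \<le> 2" by simp
          finally show ?thesis .
        qed
        have "F21 (G q / q) = (q\<^sup>2 * y) * (F21_quot (q * y) * y)"
          unfolding w F21_eq[OF less_imp_le[OF w0]] by (simp add: power2_eq_square)
        also have "\<dots> \<le> (q\<^sup>2 * y) * 2"
          using \<open>F21_quot (q * y) * y \<le> 2\<close> y by (intro mult_left_mono) auto
        also have "q\<^sup>2 * y = G q" using G[OF q0 True] by (simp add: y_def)
        finally show ?thesis using G0 by linarith
      next
        case False
        have "G q / q \<le> 1" using G.M_le_self[OF q] q0 by simp
        moreover have "0 \<le> G q / q" using G0 q0 by simp
        ultimately have "F21 (G q / q) \<le> 1" using F21.M_le_self[of "G q / q"] by linarith
        moreover have "1 / 18 \<le> G q"
        proof -
          have "G (exp (- 3 / 2)) \<le> G q" using False by (intro G.M_mono) auto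
          moreover have "G (exp (- 3 / 2)) = exp (- 3) * (3 / 2)"
            using G[of "exp (- 3 / 2)"] exp_double[of "- 3 / 2 :: real"] by simp
          moreover have "(1 / 3) ^ 3 \<le> exp (- 1 :: real) ^ 3" using e13 by (intro power_mono) auto
          moreover have "exp (- 1 :: real) ^ 3 = exp (- 3)" by (simp flip: exp_of_nat_mult)
          ultimately show ?thesis by (simp add: power3_eq_cube)
        qed
        ultimately show ?thesis by linarith
      qed
    qed simp
  qed simp
  then show ?thesis by blast
qed

theorem corollary5p2:
  fixes G :: "real \<Rightarrow> real"
  assumes "convex_orlicz_function G"
    and "\<And>t. 0 < t \<Longrightarrow> t \<le> exp (- 3 / 2) \<Longrightarrow> G t = t\<^sup>2 * (- ln t)"
  shows "has_unique_greedy_basis (orlicz_space F21) (orlicz_norm F21)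
    \<and> has_unique_greedy_basis (orlicz_space G) (orlicz_norm G)"
  using has_unique_greedy_basis_F21 has_unique_greedy_basis_dual orlicz_dual_pair_F21[OF assms]
  by blast

end
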